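(* Let $\{X(t)\}_{t\ge0}$ be the storage process on $[0,\infty)$ with release rate $r$ and input subordinator with Lévy measure $\nu$ (see context). Assume that (C1), (C2) and (C3) hold (or, in the case $\bar\nu(0)<\infty$, that ($\bar{\mathrm C}$1), ($\bar{\mathrm C}$2) and (C3) hold). Let $p\ge1$ and $\beta:[0,\infty)\to[0,\infty)$ be such that (i) $\int_{(0,\infty)}(u\vee u^p)\,\nu(du)<\infty$; (ii) $\beta$ is convex, and $\beta(t)=0$ if and only if $t=0$; (iii) there exists $\Gamma>0$ such that $r(u)-r(v)\le-\Gamma\,\beta(v-u)$ for all $0\le u\le v$. Then the process $\{X(t)\}_{t\ge0}$ admits a unique invariant $\pi\in\mathcal P_p$, and for any $\kappa>0$ and $\mu\in\mathcal P_p$ $$\mathcal W_p\Big(\int_{[0,\infty)}p(t,x,dy)\,\mu(dx),\,\pi(dy)\Big)\le\Big(\frac{\mathcal W_p(\mu,\pi)}{\kappa}+1\Big)B_\kappa^{-1}(\Gamma t),\qquad t\ge0,$$ where $B_\kappa(t)=\int_t^\kappa\frac{ds}{\beta(s)}$, $t\in(0,\kappa]$. Furthermore, $\limsup_{u\to\infty}u^p\,\bar\pi(u)<\infty$.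
   Context: Input process. $\{A(t)\}_{t\ge0}$ is a pure-jump subordinator (nondecreasing Lévy process without drift), defined on a stochastic basis satisfying the usual conditions, with Laplace transform $\mathbb E[e^{-\lambda A(t)}]=\exp\{t\int_{(0,\infty)}(e^{-\lambda u}-1)\,\nu(du)\}$, $\lambda\ge0$, where the Lévy measure $\nu$ on $(0,\infty)$ satisfies $\int_{(0,\infty)}(u\wedge1)\,\nu(du)<\infty$. For a measure $\mu$, $\bar\mu(u)=\mu((u,\infty))$; $\bar\nu(0)=\nu((0,\infty))$. Release rate. Conditions on $r$: (C1) $r:[0,\infty)\to[0,\infty)$, and $r(u)>0$ if and only if $u>0$. (C2) For every $\rho>0$ there is $\Gamma_\rho>0$ such that $|r(u)-r(v)|\le\Gamma_\rho|u-v|$ for all $0\le u,v\le\rho$. ($\bar{\mathrm C}$1) $r:[0,\infty)\to[0,\infty)$ is left continuous and has a strictly positive right limit at every point of $(0,\infty)$, and $r(u)=0$ if and only if $u=0$. ($\bar{\mathrm C}$2) $\int_0^u\frac{dv}{r(v)}<\infty$ for all $u>0$. Condition (C3). Let $\varphi:[1,\infty)\to(0,\infty)$ be a nondecreasing, differentiable and concave function, let $\Phi(t)=\int_1^t\frac{ds}{\varphi(s)}$, $t\ge1$, and let $\mathcal V:[0,\infty)\to[1,\infty)$ be continuously differentiable with $\mathcal V(u)=\Phi^{-1}\big(\int_1^u\frac{dv}{r(v)}+1\big)$ for $u\ge1$. (C3) requires $\int_{[1,\infty)}\mathcal V(u+v)\,\nu(dv)<\infty$ for all $u\ge0$. Storage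 process. Under (C1)–(C2) (or, if $\bar\nu(0)<\infty$, under ($\bar{\mathrm C}$1)–($\bar{\mathrm C}$2)), for each $x\ge0$ the equation $X(t)=x+A(t)-\int_0^t r(X(s))\,ds$ has a unique nonexplosive solution; these solutions form a nonnegative time-homogeneous strong Markov process with càdlàg paths, called the storage process $\{X(t)\}_{t\ge0}$. $\mathbb P^x$ denotes its law started from $x$, and $p(t,x,dy)=\mathbb P^x(X(t)\in dy)$. A probability measure $\pi$ on $[0,\infty)$ is invariant if $\int_{[0,\infty)}p(t,x,dy)\,\pi(dx)=\pi(dy)$ for all $t\ge0$. Wasserstein distance. $\mathcal P_p$ is the set of Borel probability measures $\mu$ on $[0,\infty)$ with $\int u^p\,\mu(du)<\infty$, and $\mathcal W_p(\mu,\eta)=\inf_{\Pi}\big(\int|x-y|^p\,\Pi(dx,dy)\big)^{1/p}$, the infimum being over all couplings $\Pi$ of $\mu$ and $\eta$ (probability measures on $[0,\infty)^2$ with marginals $\mu$ and $\eta$). *)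

theory Defs
  imports "HOL-Probability.Probability"
begin

abbreviation half_line :: "real measure" where
  "half_line \<equiv> restrict_space borel {0..}"

definition tail :: "real measure \<Rightarrow> real \<Rightarrow> ennreal" where
  "tail \<mu> u = emeasure \<mu> {u<..}"

definition cadlag :: "(real \<Rightarrow> real) \<Rightarrow> bool" where
  "cadlag f \<longleftrightarrow>
     (\<forall>t\<ge>0. (f \<longlongrightarrow> f t) (at_right t)) \<and> (\<forall>t>0. \<exists>l. (f \<longlongrightarrow> l) (at_left t))"

text \<open>Time is \<open>[0,\<infinity>)\<close>; values of a process or filtration at negative indices are irrelevant.\<close>

definition stochastic_basis :: "'a measure \<Rightarrow> (real \<Rightarrow> 'a measure) \<Rightarrow> bool" where
  "stochastic_basis M F \<longleftrightarrow>
     prob_space M \<and> complete_measure M \<and>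
     (\<forall>t\<ge>0. subalgebra M (F t)) \<and>
     (\<forall>s t. 0 \<le> s \<and> s \<le> t \<longrightarrow> sets (F s) \<subseteq> sets (F t)) \<and>
     (\<forall>t\<ge>0. sets (F t) = (\<Inter>s\<in>{t<..}. sets (F s))) \<and>
     null_sets M \<subseteq> sets (F 0)"

text \<open>A measure on \<open>(0,\<infinity>)\<close> has \<open>(0,\<infinity>)\<close> as its underlying space, so unrestricted integrals with
  respect to \<open>\<nu>\<close> are integrals over \<open>(0,\<infinity>)\<close>.\<close>

definition levy_measure :: "real measure \<Rightarrow> bool" where
  "levy_measure \<nu> \<longleftrightarrow>
     sets \<nu> = sets (restrict_space borel {0<..}) \<and>
     (\<integral>\<^sup>+u. ennreal (min u 1) \<partial>\<nu>) < \<infinity>"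

text \<open>The form of the Laplace exponent expresses that there is no drift. Stochastic continuity
  follows from stationarity of the increments and right continuity of the paths.\<close>

definition pure_jump_subordinator ::
  "'a measure \<Rightarrow> (real \<Rightarrow> 'a measure) \<Rightarrow> real measure \<Rightarrow> (real \<Rightarrow> 'a \<Rightarrow> real) \<Rightarrow> bool" where
  "pure_jump_subordinator M F \<nu> A \<longleftrightarrow>
     (\<forall>t\<ge>0. A t \<in> borel_measurable (F t)) \<and>
     (AE \<omega> in M. A 0 \<omega> = 0) \<and>
     (\<forall>s t. 0 \<le> s \<and> s \<le> t \<longrightarrow>
        prob_space.indep_set M (sets (F s))
          (sets (vimage_algebra (space M) (\<lambda>\<omega>. A t \<omega> - A s \<omega>) borel))) \<and>
     (\<forall>s t. 0 \<le> s \<and> s \<le> t \<longrightarrow>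
        distr M borel (\<lambda>\<omega>. A t \<omega> - A s \<omega>) = distr M borel (A (t - s))) \<and>
     (AE \<omega> in M. cadlag (\<lambda>t. A t \<omega>) \<and> mono_on {0..} (\<lambda>t. A t \<omega>)) \<and>
     (\<forall>t\<ge>0. \<forall>l\<ge>0. (\<integral>\<omega>. exp (- l * A t \<omega>) \<partial>M) = exp (t * (\<integral>u. (exp (- l * u) - 1) \<partial>\<nu>)))"

text \<open>Functions on \<open>[0,\<infinity>)\<close> or \<open>[1,\<infinity>)\<close> are total functions on the reals whose other values
  are irrelevant.\<close>

definition C1 :: "(real \<Rightarrow> real) \<Rightarrow> bool" where
  "C1 r \<longleftrightarrow> (\<forall>u\<ge>0. 0 \<le> r u \<and> (0 < r u \<longleftrightarrow> 0 < u))"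

definition C2 :: "(real \<Rightarrow> real) \<Rightarrow> bool" where
  "C2 r \<longleftrightarrow> (\<forall>\<rho>>0. \<exists>L>0. \<forall>u\<in>{0..\<rho>}. \<forall>v\<in>{0..\<rho>}. \<bar>r u - r v\<bar> \<le> L * \<bar>u - v\<bar>)"

definition C1_bar :: "(real \<Rightarrow> real) \<Rightarrow> bool" where
  "C1_bar r \<longleftrightarrow>
     (\<forall>u\<ge>0. 0 \<le> r u \<and> (r u = 0 \<longleftrightarrow> u = 0)) \<and>
     (\<forall>u>0. (r \<longlongrightarrow> r u) (at_left u) \<and> (\<exists>l>0. (r \<longlongrightarrow> l) (at_right u)))"

definition C2_bar :: "(real \<Rightarrow> real) \<Rightarrow> bool" where
  "C2_bar r \<longleftrightarrow> (\<forall>u>0. (\<integral>\<^sup>+v\<in>{0<..u}. ennreal (1 / r v) \<partial>lborel) < \<infinity>)"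

definition Phi :: "(real \<Rightarrow> real) \<Rightarrow> real \<Rightarrow> real" where
  "Phi \<phi> t = (LBINT s:{1..t}. 1 / \<phi> s)"

text \<open>\<open>Phi \<phi>\<close> is a bijection from \<open>[1,\<infinity>)\<close> onto \<open>[0,\<infinity>)\<close>, because a concave \<open>\<phi>\<close> grows at most
  linearly.\<close>

definition C3 :: "(real \<Rightarrow> real) \<Rightarrow> real measure \<Rightarrow> bool" where
  "C3 r \<nu> \<longleftrightarrow>
     (\<exists>\<phi> V.
        (\<forall>t\<ge>1. 0 < \<phi> t) \<and> mono_on {1..} \<phi> \<and> \<phi> differentiable_on {1..} \<and> concave_on {1..} \<phi> \<and>
        (\<forall>u\<ge>0. 1 \<le> V u) \<and>
        (\<exists>V'. continuous_on {0..} V' \<and>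
           (\<forall>u\<ge>0. (V has_real_derivative V' u) (at u within {0..}))) \<and>
        (\<forall>u\<ge>1. V u = inv_into {1..} (Phi \<phi>) ((LBINT v:{1..u}. 1 / r v) + 1)) \<and>
        (\<forall>u\<ge>0. (\<integral>\<^sup>+v\<in>{1..}. ennreal (V (u + v)) \<partial>\<nu>) < \<infinity>))"

text \<open>\<open>X x\<close> is the solution started from \<open>x\<close>, for every \<open>x \<ge> 0\<close>.\<close>

definition storage_process ::
  "'a measure \<Rightarrow> (real \<Rightarrow> 'a measure) \<Rightarrow> (real \<Rightarrow> 'a \<Rightarrow> real) \<Rightarrow> (real \<Rightarrow> real) \<Rightarrow>
   (real \<Rightarrow> real \<Rightarrow> 'a \<Rightarrow> real) \<Rightarrow> bool" where
  "storage_process M F A r X \<longleftrightarrow>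
     (\<forall>x\<ge>0.
        (\<forall>t\<ge>0. X x t \<in> measurable (F t) half_line) \<and>
        (AE \<omega> in M.
           cadlag (\<lambda>t. X x t \<omega>) \<and>
           (\<forall>t\<ge>0. set_integrable lborel {0..t} (\<lambda>s. r (X x s \<omega>)) \<and>
              X x t \<omega> = x + A t \<omega> - (LBINT s:{0..t}. r (X x s \<omega>)))))"

definition transition ::
  "'a measure \<Rightarrow> (real \<Rightarrow> real \<Rightarrow> 'a \<Rightarrow> real) \<Rightarrow> real \<Rightarrow> real \<Rightarrow> real measure" where
  "transition M X t x = distr M half_line (X x t)"

text \<open>For a probability measure \<open>\<mu>\<close> on the half-line, \<open>\<mu> \<bind> transition M X t\<close> is the measure
  \<open>\<integral> p(t,x,dy) \<mu>(dx)\<close>.\<close>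

definition invariant_measure ::
  "'a measure \<Rightarrow> (real \<Rightarrow> real \<Rightarrow> 'a \<Rightarrow> real) \<Rightarrow> real measure \<Rightarrow> bool" where
  "invariant_measure M X \<pi> \<longleftrightarrow>
     prob_space \<pi> \<and> sets \<pi> = sets half_line \<and>
     (\<forall>t\<ge>0. \<pi> \<bind> transition M X t = \<pi>)"

definition P_space :: "real \<Rightarrow> real measure set" where
  "P_space p = {\<mu>. prob_space \<mu> \<and> sets \<mu> = sets half_line \<and>
     (\<integral>\<^sup>+u. ennreal (u powr p) \<partial>\<mu>) < \<infinity>}"

definition couplings :: "real measure \<Rightarrow> real measure \<Rightarrow> (real \<times> real) measure set" where
  "couplings \<mu> \<eta> = {Q. prob_space Q \<and> sets Q = sets (half_line \<Otimes>\<^sub>M half_line) \<and>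
     distr Q half_line fst = \<mu> \<and> distr Q half_line snd = \<eta>}"

definition ennreal_powr :: "ennreal \<Rightarrow> real \<Rightarrow> ennreal" where
  "ennreal_powr x a = (if x = \<infinity> then \<infinity> else ennreal (enn2real x powr a))"

text \<open>The distance takes values in \<open>[0,\<infinity>]\<close>, so that its finiteness is never presupposed.\<close>

definition wasserstein :: "real \<Rightarrow> real measure \<Rightarrow> real measure \<Rightarrow> ennreal" where
  "wasserstein p \<mu> \<eta> =
     (INF Q\<in>couplings \<mu> \<eta>.
        ennreal_powr (\<integral>\<^sup>+z. ennreal (\<bar>fst z - snd z\<bar> powr p) \<partial>Q) (1 / p))"

definition B_rate :: "(real \<Rightarrow> real) \<Rightarrow> real \<Rightarrow> real \<Rightarrow> real" where
  "B_rate \<beta> \<kappa> t = (LBINT s:{t..\<kappa>}. 1 / \<beta> s)"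

text \<open>If \<open>\<beta>\<close> is convex on \<open>[0,\<infinity>)\<close> and vanishes only at \<open>0\<close>, then \<open>B_rate \<beta> \<kappa>\<close> is a bijection from
  \<open>(0,\<kappa>]\<close> onto \<open>[0,\<infinity>)\<close>, since \<open>\<beta> s \<le> s * \<beta> \<kappa> / \<kappa>\<close> there.\<close>

definition B_inv :: "(real \<Rightarrow> real) \<Rightarrow> real \<Rightarrow> real \<Rightarrow> real" where
  "B_inv \<beta> \<kappa> = inv_into {0<..\<kappa>} (B_rate \<beta> \<kappa>)"

end

theory Submission
  imports Defs
begin

text \<open>Two solutions driven by the same input differ by an absolutely continuous function \<open>D\<close> with
  \<open>\<bar>D\<bar>' \<le> - \<Gamma> \<beta>(\<bar>D\<bar>)\<close>. As \<open>\<beta>\<close> is convex with \<open>\<beta>(0) = 0\<close>, one may divide \<open>D\<close> by any constant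
  \<open>\<ge> 1\<close>, whence \<open>\<bar>D t\<bar> \<le> max 1 (\<bar>D 0\<bar> / \<kappa>) B\<^sub>\<kappa>\<^sup>-\<^sup>1(\<Gamma> t)\<close>. Applied to the coordinates of a coupling and integrated,
  this gives the bound on \<open>W\<^sub>p\<close>, and uniqueness of the invariant law. The Markov property follows from the
  convergence of the implicit Euler scheme, whose error satisfies
  \<open>e\<^sub>n\<^sup>2 \<le> 2 h C (2 A(t) + t C)\<close> for every nondecreasing \<open>r\<close>, continuous or not. For existence, \<open>E[A(1)\<^sup>p]\<close> is
  finite by size biasing, so \<open>E[X(n)\<^sup>p]\<close> satisfies a contractive recursion; any weak limit of the laws
  of \<open>X(n)\<close> is invariant, by the contraction again.\<close>

section \<open>Inverse of the integrated rate\<close>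

text \<open>The hypotheses provide one solution for each fixed starting point, with an exceptional
  set depending on that point, and say nothing about the Markov property. A solution cannot simply
  be restarted from the random state \<open>X x s\<close>. The Euler scheme circumvents this: it is
  an explicit functional of the state at time \<open>s\<close> and of the later increments, hence a
  chain whose kernel does not depend on \<open>s\<close>. It is implicit because (iii) makes
  \<open>r\<close> nondecreasing but gives no modulus of continuity, and monotonicity alone controls
  the error of a resolvent step.

  The only link between the input and \<open>\<nu>\<close> in the definition is the Laplace
  transform. Differentiating it gives E[A h(A)] = int E[h(u + A)] u nu(du) for A = A(1), so a moment
  of order p is bounded through one of order p - 1, which is absorbed into the left side after
  splitting at a high level.

  The summand \<open>1\<close> in the factor of the final bound comes from max 1 x <= 1 + x and
  Minkowski's inequality.\<close>

locale dissipation_rate =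
  fixes \<beta> :: "real \<Rightarrow> real"
  assumes nonneg: "0 \<le> t \<Longrightarrow> 0 \<le> \<beta> t"
    and convex: "convex_on {0..} \<beta>"
    and zero_iff: "0 \<le> t \<Longrightarrow> \<beta> t = 0 \<longleftrightarrow> t = 0"
begin

lemma pos: "0 < t \<Longrightarrow> 0 < \<beta> t"
  using nonneg[of t] zero_iff[of t] by auto

text \<open>Convexity between \<open>0\<close> and \<open>x\<close> with
  \<open>\<beta> 0 = 0\<close>. Behind the monotonicity of \<open>\<beta>\<close>, the divergence of
  \<open>B_rate\<close> at \<open>0\<close>, the rescaling of differences and the linear lower bound
  for the release.\<close>

lemma le_scale:
  assumes "0 \<le> \<theta>" "\<theta> \<le> 1" "0 \<le> x"
  shows "\<beta> (\<theta> * x) \<le> \<theta> * \<beta> x"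
  using convex_onD[OF convex, of \<theta> 0 x] assms zero_iff[of 0] by auto

lemma mono:
  assumes "0 \<le> x" "x \<le> y"
  shows "\<beta> x \<le> \<beta> y"
proof (cases "y = 0")
  case False
  then have "0 < y" using assms by auto
  have "\<beta> (x / y * y) \<le> x / y * \<beta> y"
    using assms \<open>0 < y\<close> by (intro le_scale) auto
  also have "\<dots> \<le> 1 * \<beta> y"
    using assms \<open>0 < y\<close> nonneg[of y] by (intro mult_right_mono) auto
  finally show ?thesis using \<open>0 < y\<close> by simp
qed (use assms in auto)

lemma continuous_on_pos: "continuous_on {0<..} \<beta>"
  using convex by (intro convex_on_continuous) (auto intro: convex_on_subset)

lemma continuous_on_inverse: "0 < x \<Longrightarrow> continuous_on {x..y} (\<lambda>s. 1 / \<beta> s)"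
  by (intro continuous_intros continuous_on_subset[OF continuous_on_pos])
     (auto simp: zero_iff)

lemma inverse_integrable: "0 < x \<Longrightarrow> (\<lambda>s. 1 / \<beta> s) integrable_on {x..y}"
  using continuous_on_inverse[of x y] by (rule integrable_continuous_interval)

lemma B_rate_eq_integral:
  assumes "0 < x"
  shows "B_rate \<beta> \<kappa> x = integral {x..\<kappa>} (\<lambda>s. 1 / \<beta> s)"
  unfolding B_rate_def
  using borel_integrable_atLeastAtMost'[OF continuous_on_inverse[OF assms]]
  by (rule set_borel_integral_eq_integral)

lemma B_rate_diff:
  assumes "0 < x" "x \<le> y" "y \<le> \<kappa>"
  shows "B_rate \<beta> \<kappa> x - B_rate \<beta> \<kappa> y = integral {x..y} (\<lambda>s. 1 / \<beta> s)"
  using assms Henstock_Kurzweil_Integration.integral_combine[OF assms(2,3) inverse_integrable[OF assms(1)]]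
  by (simp add: B_rate_eq_integral)

text \<open>\<open>1 / \<beta>\<close> is nonincreasing, so on the interval it is at least its value
  at the right end. Along a decreasing path this replaces the chain rule for
  \<open>B_rate\<close>.\<close>

lemma B_rate_diff_ge:
  assumes "0 < x" "x \<le> y" "y \<le> \<kappa>"
  shows "(y - x) / \<beta> y \<le> B_rate \<beta> \<kappa> x - B_rate \<beta> \<kappa> y"
proof -
  have "(y - x) / \<beta> y = integral {x..y} (\<lambda>s. 1 / \<beta> y)" using assms by simp
  also have "\<dots> \<le> integral {x..y} (\<lambda>s. 1 / \<beta> s)"
    using assms inverse_integrable[of x y]
    by (intro integral_le) (auto intro!: divide_left_mono mono mult_pos_pos pos)
  finally show ?thesis using B_rate_diff[OF assms] by simp
qed

lemma B_rate_diff_le: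
  assumes "0 < x" "x \<le> y" "y \<le> \<kappa>"
  shows "B_rate \<beta> \<kappa> x - B_rate \<beta> \<kappa> y \<le> (y - x) / \<beta> x"
proof -
  have "integral {x..y} (\<lambda>s. 1 / \<beta> s) \<le> integral {x..y} (\<lambda>s. 1 / \<beta> x)"
    using assms inverse_integrable[of x y]
    by (intro integral_le) (auto intro!: divide_left_mono mono mult_pos_pos pos)
  also have "\<dots> = (y - x) / \<beta> x" using assms by simp
  finally show ?thesis using B_rate_diff[OF assms] by simp
qed

lemma B_rate_strict:
  assumes "0 < x" "x < y" "y \<le> \<kappa>"
  shows "B_rate \<beta> \<kappa> y < B_rate \<beta> \<kappa> x"
proof -
  have "0 < (y - x) / \<beta> y" using assms pos[of y] by simp
  then show ?thesis using B_rate_diff_ge[of x y \<kappa>] assms by linarith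
qed

lemma B_rate_self: "0 < \<kappa> \<Longrightarrow> B_rate \<beta> \<kappa> \<kappa> = 0"
  by (simp add: B_rate_eq_integral)

text \<open>On \<open>(0, \<kappa>]\<close> the graph of \<open>\<beta>\<close> lies below the chord
  of slope \<open>b\<close>, so \<open>1 / \<beta> s\<close> dominates \<open>1 / (s * b)\<close>,
  which is not integrable at \<open>0\<close>.\<close>

lemma B_rate_unbounded:
  assumes "0 < \<kappa>"
  obtains x where "0 < x" "x \<le> \<kappa>" "s \<le> B_rate \<beta> \<kappa> x"
proof -
  define b where "b = \<beta> \<kappa> / \<kappa>"
  have b: "0 < b" using assms pos[of \<kappa>] by (simp add: b_def)
  \<comment> \<open>Solves \<open>(ln \<kappa> - ln x) / b = \<bar>s\<bar>\<close>, where the left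
    side is the comparison integral.\<close>
  define x where "x = \<kappa> * exp (- b * \<bar>s\<bar>)"
  have x: "0 < x" "x \<le> \<kappa>" using assms b by (auto simp: x_def mult_le_cancel_left1)
  have "\<bar>s\<bar> = (ln \<kappa> - ln x) / b"
    using assms b by (simp add: x_def ln_mult)
  also have "\<dots> = integral {x..\<kappa>} (\<lambda>s. 1 / (s * b))"
  proof -
    have "((\<lambda>s. 1 / (s * b)) has_integral ln \<kappa> / b - ln x / b) {x..\<kappa>}"
      using x b
      by (intro fundamental_theorem_of_calculus)
         (auto intro!: derivative_eq_intros simp: has_real_derivative_iff_has_vector_derivative[symmetric])
    then show ?thesis by (simp add: integral_unique diff_divide_distrib)
  qed
  also have "\<dots> \<le> integral {x..\<kappa>} (\<lambda>s. 1 / \<beta> s)"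
  proof (rule integral_le)
    show "(\<lambda>s. 1 / (s * b)) integrable_on {x..\<kappa>}"
      using x b by (intro integrable_continuous_interval continuous_intros) auto
    show "1 / (s * b) \<le> 1 / \<beta> s" if "s \<in> {x..\<kappa>}" for s
    proof -
      have "\<beta> (s / \<kappa> * \<kappa>) \<le> s / \<kappa> * \<beta> \<kappa>"
        using that x assms by (intro le_scale) auto
      then have "\<beta> s \<le> s * b" using assms by (simp add: b_def)
      then show ?thesis using that x pos[of s] b
        by (intro divide_left_mono) auto
    qed
  qed (use x inverse_integrable in auto)
  finally show ?thesis using that[of x] x by (simp add: B_rate_eq_integral)
qed

lemma B_rate_surj:
  assumes "0 < \<kappa>" "0 \<le> s"
  shows "\<exists>z. 0 < z \<and> z \<le> \<kappa> \<and> B_rate \<beta> \<kappa> z = s"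
proof -
  obtain x where x: "0 < x" "x \<le> \<kappa>" "s \<le> B_rate \<beta> \<kappa> x"
    using B_rate_unbounded[OF assms(1)] .
  \<comment> \<open>The two difference bounds make \<open>B_rate\<close> Lipschitz on
    \<open>{x..\<kappa>}\<close>, with the largest value of the integrand as constant; then the
    intermediate value theorem applies.\<close>
  have "\<bar>B_rate \<beta> \<kappa> u - B_rate \<beta> \<kappa> v\<bar> \<le> 1 / \<beta> x * \<bar>u - v\<bar>"
    if uv: "u \<in> {x..\<kappa>}" "v \<in> {x..\<kappa>}" for u v
  proof -
    have *: "\<bar>B_rate \<beta> \<kappa> u - B_rate \<beta> \<kappa> v\<bar> \<le> 1 / \<beta> x * \<bar>u - v\<bar>"
      if "u \<in> {x..\<kappa>}" "v \<in> {x..\<kappa>}" "u \<le> v" for u v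
    proof -
      have "(v - u) / \<beta> u \<le> (v - u) / \<beta> x"
        using that x by (intro divide_left_mono mono mult_pos_pos pos) auto
      moreover have "0 \<le> (v - u) / \<beta> v" using that x pos[of v] by auto
      ultimately show ?thesis
        using B_rate_diff_le[of u v \<kappa>] B_rate_diff_ge[of u v \<kappa>] that x by auto
    qed
    show ?thesis using *[of u v] *[of v u] uv by (cases "u \<le> v") (auto simp: abs_minus_commute)
  qed
  then have "(1 / \<beta> x)-lipschitz_on {x..\<kappa>} (B_rate \<beta> \<kappa>)"
    using x pos[of x] by (intro lipschitz_onI) (auto simp: dist_real_def)
  then have "continuous_on {x..\<kappa>} (B_rate \<beta> \<kappa>)" by (rule lipschitz_on_continuous_on)
  then obtain z where "x \<le> z" "z \<le> \<kappa>" "B_rate \<beta> \<kappa> z = s"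
    using IVT2'[of "B_rate \<beta> \<kappa>" \<kappa> s x] x assms B_rate_self[OF assms(1)] by auto
  then show ?thesis using x by (intro exI[of _ z]) auto
qed

lemma
  assumes "0 < \<kappa>" "0 \<le> s"
  shows B_inv_pos: "0 < B_inv \<beta> \<kappa> s"
    and B_inv_le: "B_inv \<beta> \<kappa> s \<le> \<kappa>"
    and B_rate_B_inv: "B_rate \<beta> \<kappa> (B_inv \<beta> \<kappa> s) = s"
proof -
  have "s \<in> B_rate \<beta> \<kappa> ` {0<..\<kappa>}" using B_rate_surj[OF assms] by force
  from inv_into_into[OF this] f_inv_into_f[OF this]
  show "0 < B_inv \<beta> \<kappa> s" "B_inv \<beta> \<kappa> s \<le> \<kappa>" "B_rate \<beta> \<kappa> (B_inv \<beta> \<kappa> s) = s"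
    by (auto simp: B_inv_def)
qed

text \<open>\<open>B_rate\<close> decreases strictly, so a lower bound for
  \<open>B_rate \<beta> \<kappa> z\<close> turns into an upper bound for \<open>z\<close>.\<close>

lemma le_B_inv:
  assumes "0 < \<kappa>" "0 < z" "z \<le> \<kappa>" "0 \<le> s" "s \<le> B_rate \<beta> \<kappa> z"
  shows "z \<le> B_inv \<beta> \<kappa> s"
  using B_rate_strict[of "B_inv \<beta> \<kappa> s" z \<kappa>] assms B_inv_pos[of \<kappa> s] B_rate_B_inv[of \<kappa> s]
  by force

lemma B_inv_tendsto_0:
  assumes "0 < \<kappa>"
  shows "(B_inv \<beta> \<kappa> \<longlongrightarrow> 0) at_top"
proof (rule order_tendstoI)
  fix a :: real assume "a < 0"
  show "\<forall>\<^sub>F s in at_top. a < B_inv \<beta> \<kappa> s"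
    using eventually_ge_at_top[of 0]
  proof eventually_elim
    case (elim s)
    then show ?case using B_inv_pos[OF assms elim] \<open>a < 0\<close> by linarith
  qed
next
  fix a :: real assume "0 < a"
  \<comment> \<open>The minimum keeps \<open>b\<close> in the domain \<open>(0, \<kappa>]\<close> of
    \<open>B_rate\<close>.\<close>
  define b where "b = min a \<kappa>"
  have b: "0 < b" "b \<le> \<kappa>" "b \<le> a" using \<open>0 < a\<close> assms by (auto simp: b_def)
  have "B_inv \<beta> \<kappa> s < a" if "max 0 (B_rate \<beta> \<kappa> b) < s" for s
  proof (rule ccontr)
    assume "\<not> B_inv \<beta> \<kappa> s < a"
    then have "b \<le> B_inv \<beta> \<kappa> s" using b by simp
    then have "s \<le> B_rate \<beta> \<kappa> b"
      using B_rate_strict[of b "B_inv \<beta> \<kappa> s" \<kappa>] b B_rate_B_inv[OF assms, of s] B_inv_le[OF assms, of s] that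
      by (cases "b = B_inv \<beta> \<kappa> s") auto
    then show False using that by simp
  qed
  then show "\<forall>\<^sub>F s in at_top. B_inv \<beta> \<kappa> s < a"
    using eventually_gt_at_top[of "max 0 (B_rate \<beta> \<kappa> b)"] by (auto elim: eventually_mono)
qed

text \<open>Separation of variables for \<open>E' \<le> - \<Gamma> * \<beta> E\<close> without a
  derivative: Riemann sums show that \<open>B_rate \<beta> \<kappa> (E t)\<close> grows by at least
  \<open>\<Gamma> * T\<close>. In \<open>decay\<close> the rate is taken at the right end, where it
  is smallest, which is what an integral over \<open>[a, b]\<close> gives directly.\<close>

lemma le_B_inv_of_decay:
  fixes E :: "real \<Rightarrow> real"
  assumes \<kappa>: "0 < \<kappa>" and \<Gamma>: "0 < \<Gamma>" and T: "0 \<le> T"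
    and cont: "continuous_on {0..T} E"
    and E_nonneg: "\<And>t. 0 \<le> t \<Longrightarrow> t \<le> T \<Longrightarrow> 0 \<le> E t"
    and E0: "E 0 \<le> \<kappa>"
    and decay: "\<And>a b. 0 \<le> a \<Longrightarrow> a \<le> b \<Longrightarrow> b \<le> T \<Longrightarrow> E b \<le> E a - \<Gamma> * (b - a) * \<beta> (E b)"
  shows "E T \<le> B_inv \<beta> \<kappa> (\<Gamma> * T)"
\<comment> \<open>The degenerate cases: below, \<open>m = \<beta> (E T)\<close> and the mesh must be
  positive.\<close>
proof (cases "T = 0 \<or> E T = 0")
  case True
  then show ?thesis
  proof
    assume "T = 0"
    then show ?thesis
      using le_B_inv[of \<kappa> "E 0" 0] E_nonneg[of 0] E0 B_inv_pos[OF \<kappa>, of 0]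
        B_rate_strict[of "E 0" \<kappa> \<kappa>] B_rate_self[OF \<kappa>] \<kappa>
      by (cases "E 0 = 0"; cases "E 0 = \<kappa>") auto
  next
    assume "E T = 0"
    then show ?thesis using B_inv_pos[of \<kappa> "\<Gamma> * T"] assms by simp
  qed
next
  case False
  then have "0 < T" "0 < E T" using T E_nonneg[of T] by auto
  have anti: "E b \<le> E a" if "0 \<le> a" "a \<le> b" "b \<le> T" for a b
  proof -
    have "0 \<le> \<Gamma> * (b - a) * \<beta> (E b)"
      using that \<Gamma> nonneg[of "E b"] E_nonneg[of b] by auto
    then show ?thesis using decay[OF that] by linarith
  qed
  have range: "E t \<in> {E T..\<kappa>}" if "t \<in> {0..T}" for t
    using that anti[of t T] anti[of 0 t] E0 by auto
  define m where "m = \<beta> (E T)"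
  have m: "0 < m" using pos \<open>0 < E T\<close> by (simp add: m_def)
  have "continuous_on {0..T} (\<lambda>t. \<beta> (E t))"
    using range \<open>0 < E T\<close>
    by (intro continuous_on_compose2[OF continuous_on_pos cont]) (force dest: range)
  then have unif: "uniformly_continuous_on {0..T} (\<lambda>t. \<beta> (E t))"
    by (rule compact_uniformly_continuous) simp
  \<comment> \<open>\<open>e\<close> bounds the oscillation of \<open>\<beta> (E t)\<close> over one
    mesh interval. As \<open>\<beta> (E t)\<close> is at least \<open>m\<close>, passing from the
    left-end rate to the right-end one costs at most the factor \<open>1 - e / m\<close>.\<close>
  have "\<Gamma> * T * (1 - e / m) \<le> B_rate \<beta> \<kappa> (E T) - B_rate \<beta> \<kappa> (E 0)" if "0 < e" for e
  proof -
    obtain d where d: "0 < d"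
      "\<And>s t. s \<in> {0..T} \<Longrightarrow> t \<in> {0..T} \<Longrightarrow> dist s t < d \<Longrightarrow> dist (\<beta> (E s)) (\<beta> (E t)) < e"
      using unif \<open>0 < e\<close> unfolding uniformly_continuous_on_def by metis
    obtain n :: nat where n: "T / d < real n" using reals_Archimedean2 by blast
    have "0 < T / d" using \<open>0 < T\<close> d(1) by simp
    then have n0: "0 < n" using n by (cases n) auto
    define g where "g k = real k * T / n" for k :: nat
    have step: "\<Gamma> * (T / n) * (1 - e / m) \<le> B_rate \<beta> \<kappa> (E (g (Suc k))) - B_rate \<beta> \<kappa> (E (g k))"
      if "k < n" for k
    proof -
      have g: "0 \<le> g k" "g k \<le> g (Suc k)" "g (Suc k) \<le> T" "g (Suc k) - g k = T / n"
      proof -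
        have "real (Suc k) \<le> real n" using that by simp
        then have "real (Suc k) * T \<le> real n * T"
          using \<open>0 < T\<close> by (intro mult_right_mono) auto
        then show "g (Suc k) \<le> T" using n0 by (simp add: g_def divide_le_eq mult.commute)
      qed (use \<open>0 < T\<close> n0 in \<open>auto simp: g_def divide_simps algebra_simps\<close>)
      have "T / n < d" using n n0 d(1) by (simp add: divide_simps mult.commute split: if_splits)
      then have "dist (g (Suc k)) (g k) < d" using g by (simp add: dist_real_def)
      then have "dist (\<beta> (E (g (Suc k)))) (\<beta> (E (g k))) < e"
        using d(2)[of "g (Suc k)" "g k"] g by auto
      then have close: "\<beta> (E (g k)) - e \<le> \<beta> (E (g (Suc k)))" by (simp add: dist_real_def)
      have ge: "m \<le> \<beta> (E (g k))"
        unfolding m_def using g range[of "g k"] \<open>0 < E T\<close> by (intro mono) auto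
      have "1 - e / m \<le> 1 - e / \<beta> (E (g k))"
        using ge m \<open>0 < e\<close> by (simp add: frac_le)
      also have "\<dots> = (\<beta> (E (g k)) - e) / \<beta> (E (g k))" using ge m by (simp add: field_simps)
      also have "\<dots> \<le> \<beta> (E (g (Suc k))) / \<beta> (E (g k))"
        using close ge m by (intro divide_right_mono) auto
      finally have "\<Gamma> * (T / n) * (1 - e / m) \<le> \<Gamma> * (T / n) * (\<beta> (E (g (Suc k))) / \<beta> (E (g k)))"
        using \<Gamma> \<open>0 < T\<close> by (intro mult_left_mono) auto
      also have "\<dots> = \<Gamma> * (g (Suc k) - g k) * \<beta> (E (g (Suc k))) / \<beta> (E (g k))" using g by simp
      also have "\<dots> \<le> (E (g k) - E (g (Suc k))) / \<beta> (E (g k))"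
        using decay[of "g k" "g (Suc k)"] g ge m by (intro divide_right_mono) auto
      also have "\<dots> \<le> B_rate \<beta> \<kappa> (E (g (Suc k))) - B_rate \<beta> \<kappa> (E (g k))"
        using g range[of "g k"] range[of "g (Suc k)"] anti[of "g k" "g (Suc k)"] \<open>0 < E T\<close>
        by (intro B_rate_diff_ge) auto
      finally show ?thesis .
    qed
    have "\<Gamma> * T * (1 - e / m) = (\<Sum>k<n. \<Gamma> * (T / n) * (1 - e / m))" using n0 by simp
    also have "\<dots> \<le> (\<Sum>k<n. B_rate \<beta> \<kappa> (E (g (Suc k))) - B_rate \<beta> \<kappa> (E (g k)))"
      using step by (intro sum_mono) auto
    also have "\<dots> = B_rate \<beta> \<kappa> (E (g n)) - B_rate \<beta> \<kappa> (E (g 0))"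
      by (rule sum_lessThan_telescope)
    finally show ?thesis using n0 by (simp add: g_def)
  qed
  note bound = this
  have "\<Gamma> * T \<le> B_rate \<beta> \<kappa> (E T) - B_rate \<beta> \<kappa> (E 0)"
  proof (rule field_le_epsilon)
    fix d :: real assume "0 < d"
    then show "\<Gamma> * T \<le> B_rate \<beta> \<kappa> (E T) - B_rate \<beta> \<kappa> (E 0) + d"
      \<comment> \<open>With this \<open>e\<close> the loss \<open>\<Gamma> * T * e / m\<close>
        equals \<open>d\<close>.\<close>
      using bound[of "d * m / (\<Gamma> * T)"] m \<Gamma> \<open>0 < T\<close> by (simp add: right_diff_distrib)
  qed
  moreover have "0 \<le> B_rate \<beta> \<kappa> (E 0)"
    using range[of 0] T \<open>0 < E T\<close> B_rate_strict[of "E 0" \<kappa> \<kappa>] B_rate_self[OF \<kappa>]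
    by (cases "E 0 = \<kappa>") auto
  ultimately show ?thesis
    using range[of T] T \<open>0 < E T\<close> \<Gamma> \<kappa> by (intro le_B_inv) auto
qed

end

section \<open>Storage paths and the implicit Euler scheme\<close>

text \<open>The equation for a single sample, freed from probability. With the gauge integral,
  intervals can be split and integrands compared without measurability arguments.\<close>

definition storage_path :: "(real \<Rightarrow> real) \<Rightarrow> (real \<Rightarrow> real) \<Rightarrow> real \<Rightarrow> (real \<Rightarrow> real) \<Rightarrow> bool" where
  "storage_path r a x \<xi> \<longleftrightarrow>
     (\<forall>t\<ge>0. 0 \<le> \<xi> t \<and> (\<lambda>s. r (\<xi> s)) integrable_on {0..t} \<and>
        \<xi> t = x + a t - integral {0..t} (\<lambda>s. r (\<xi> s)))"

lemma storage_path_nonneg: "storage_path r a x \<xi> \<Longrightarrow> 0 \<le> t \<Longrightarrow> 0 \<le> \<xi> t"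
  unfolding storage_path_def by blast

lemma storage_path_integrable:
  assumes "storage_path r a x \<xi>" "0 \<le> s"
  shows "(\<lambda>s. r (\<xi> s)) integrable_on {s..t}"
proof (cases "s \<le> t")
  case True
  then have "(\<lambda>s. r (\<xi> s)) integrable_on {0..t}"
    using assms by (simp add: storage_path_def)
  then show ?thesis
    using assms True by (rule_tac integrable_on_subinterval) auto
qed (simp add: integrable_on_empty)

lemma storage_path_increment:
  assumes "storage_path r a x \<xi>" "0 \<le> s" "s \<le> t"
  shows "\<xi> t = \<xi> s + (a t - a s) - integral {s..t} (\<lambda>s. r (\<xi> s))"
proof -
  have "integral {0..s} (\<lambda>s. r (\<xi> s)) + integral {s..t} (\<lambda>s. r (\<xi> s)) = integral {0..t} (\<lambda>s. r (\<xi> s))"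
    using assms storage_path_integrable[OF assms(1), of 0 t]
    by (intro Henstock_Kurzweil_Integration.integral_combine) auto
  then show ?thesis using assms by (simp add: storage_path_def)
qed

lemma storage_path_diff:
  assumes "storage_path r a x \<xi>" "storage_path r a y \<eta>" "0 \<le> s" "s \<le> t"
  shows "\<eta> t - \<xi> t = \<eta> s - \<xi> s - integral {s..t} (\<lambda>u. r (\<eta> u) - r (\<xi> u))"
proof -
  have "integral {s..t} (\<lambda>u. r (\<eta> u) - r (\<xi> u)) = integral {s..t} (\<lambda>u. r (\<eta> u)) - integral {s..t} (\<lambda>u. r (\<xi> u))"
    using storage_path_integrable[OF assms(1,3)] storage_path_integrable[OF assms(2,3)]
    by (intro Henstock_Kurzweil_Integration.integral_diff)
  then show ?thesis
    using storage_path_increment[OF assms(1,3,4)] storage_path_increment[OF assms(2-4)] by linarith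
qed

text \<open>The common input cancels in the difference, and its jumps with it.\<close>

lemma storage_path_diff_continuous:
  assumes "storage_path r a x \<xi>" "storage_path r a y \<eta>"
  shows "continuous_on {0..T} (\<lambda>t. \<eta> t - \<xi> t)"
proof -
  have "continuous_on {0..T} (\<lambda>t. \<eta> 0 - \<xi> 0 - integral {0..t} (\<lambda>u. r (\<eta> u) - r (\<xi> u)))"
    using storage_path_integrable[OF assms(1)] storage_path_integrable[OF assms(2)]
    by (intro continuous_intros indefinite_integral_continuous_1 integrable_diff) auto
  then show ?thesis
    by (rule continuous_on_eq) (rule storage_path_diff[OF assms order_refl, symmetric], simp)
qed

text \<open>Monotonicity follows from (iii), the value at \<open>0\<close> from (C1) or its variant.
  Order preservation and the convergence of the Euler scheme rest on these two facts.\<close>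

locale monotone_release =
  fixes r :: "real \<Rightarrow> real"
  assumes r_zero: "r 0 = 0"
    and r_mono: "0 \<le> u \<Longrightarrow> u \<le> v \<Longrightarrow> r u \<le> r v"
begin

lemma r_nonneg: "0 \<le> u \<Longrightarrow> 0 \<le> r u"
  using r_mono[of 0 u] r_zero by simp

text \<open>Let \<open>s\<close> be the last time up to \<open>t\<close> with
  \<open>\<xi> s \<le> \<eta> s\<close>. Afterwards \<open>\<eta>\<close> is the smaller path and
  releases no more than \<open>\<xi>\<close>, so the difference cannot become negative.\<close>

lemma storage_path_order:
  assumes \<xi>: "storage_path r a x \<xi>" and \<eta>: "storage_path r a y \<eta>"
    and "\<xi> 0 \<le> \<eta> 0" "0 \<le> t"
  shows "\<xi> t \<le> \<eta> t"
proof (rule ccontr)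
  assume neg: "\<not> \<xi> t \<le> \<eta> t"
  let ?D = "\<lambda>u. \<eta> u - \<xi> u"
  define S where "S = {u \<in> {0..t}. 0 \<le> ?D u}"
  have "S = {0..t} \<inter> ?D -` {0..}" by (auto simp: S_def)
  also have "closed \<dots>"
    using storage_path_diff_continuous[OF \<xi> \<eta>, of t] by (intro continuous_closed_preimage) auto
  finally have "closed S" .
  have S: "0 \<in> S" "bdd_above S" using assms by (auto simp: S_def bdd_above_def)
  define s where "s = Sup S"
  have "s \<in> S" unfolding s_def using S \<open>closed S\<close> by (intro closed_contains_Sup) auto
  then have s: "0 \<le> s" "s \<le> t" "0 \<le> ?D s" by (auto simp: S_def)
  have late: "?D u \<le> 0" if "s < u" "u \<le> t" for u
    using that s cSup_upper[of u S] S by (force simp: S_def s_def)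
  have int: "(\<lambda>u. r (\<eta> u) - r (\<xi> u)) integrable_on {s..t}"
    using storage_path_integrable[OF \<xi>] storage_path_integrable[OF \<eta>] s by (intro integrable_diff) auto
  \<comment> \<open>At \<open>u = s\<close> itself the two rates may be in the other order; one
    point is negligible.\<close>
  let ?g = "\<lambda>u. if u = s then 0 else r (\<eta> u) - r (\<xi> u)"
  have "integral {s..t} (\<lambda>u. r (\<eta> u) - r (\<xi> u)) = integral {s..t} ?g"
    by (rule integral_spike[of "{s}"]) auto
  also have "\<dots> \<le> integral {s..t} (\<lambda>u. 0)"
  proof (rule integral_le)
    show "?g integrable_on {s..t}"
      using int by (rule integrable_spike[of _ _ "{s}"]) auto
    show "?g u \<le> 0" if "u \<in> {s..t}" for u
      using that late[of u] s storage_path_nonneg[OF \<eta>, of u] r_mono[of "\<eta> u" "\<xi> u"] by auto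
  qed (rule integrable_0)
  finally have "0 \<le> ?D t" using storage_path_diff[OF \<xi> \<eta> s(1,2)] s by simp
  then show False using neg by simp
qed

lemma storage_path_release_le:
  assumes \<xi>: "storage_path r a x \<xi>" and "0 \<le> s" "s \<le> t"
  shows "\<xi> t \<le> \<xi> s + (a t - a s)"
proof -
  have "0 \<le> integral {s..t} (\<lambda>s. r (\<xi> s))"
    using assms by (intro Henstock_Kurzweil_Integration.integral_nonneg storage_path_integrable[OF \<xi>])
      (auto intro!: r_nonneg storage_path_nonneg[OF \<xi>])
  then show ?thesis using storage_path_increment[OF assms] by simp
qed

section \<open>The implicit Euler step for a monotone release rate\<close>

text \<open>The graph of \<open>r\<close> completed by vertical segments at its jumps is maximal monotone;
  \<open>resolvent h\<close> is its resolvent \<open>(1 + h r)\<^sup>-\<^sup>1\<close>.\<close>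

definition resolvent :: "real \<Rightarrow> real \<Rightarrow> real" where
  "resolvent h y = Sup {v \<in> {0..max 0 y}. v + h * r v \<le> max 0 y}"

context
  fixes h :: real
  assumes h: "0 < h"
begin

text \<open>\<open>max 0 y\<close> makes the set nonempty for every real \<open>y\<close>, so that
  \<open>resolvent h\<close> is monotone on the whole line and hence Borel.\<close>

lemma resolvent_set:
  shows "0 \<in> {v \<in> {0..max 0 y}. v + h * r v \<le> max 0 y}"
    and "bdd_above {v \<in> {0..max 0 y}. v + h * r v \<le> max 0 y}"
  by (auto simp: r_zero bdd_above_def)

lemma resolvent_nonneg: "0 \<le> resolvent h y"
  unfolding resolvent_def using resolvent_set by (rule cSup_upper)

lemma resolvent_le: "0 \<le> y \<Longrightarrow> resolvent h y \<le> y"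
  unfolding resolvent_def using resolvent_set[of y] by (intro cSup_least) auto

lemma resolvent_mono: "y \<le> z \<Longrightarrow> resolvent h y \<le> resolvent h z"
  unfolding resolvent_def using resolvent_set[of y] resolvent_set[of z]
  by (intro cSup_subset_mono) (auto simp: max_def split: if_splits)

text \<open>If \<open>r\<close> jumps at the resolvent, \<open>(y - resolvent h y) / h\<close> need
  not be a value of \<open>r\<close>. This bound and \<open>r_ge_above_resolvent\<close> place it
  between the values of \<open>r\<close> on the two sides.\<close>

lemma r_le_below_resolvent:
  assumes "0 \<le> y" "0 \<le> v" "v < resolvent h y"
  shows "h * r v \<le> y - resolvent h y"
proof -
  have "resolvent h y \<le> y - h * r v"
  proof (rule ccontr)
    assume "\<not> ?thesis"
    \<comment> \<open>A member \<open>w\<close> of the set above both numbers would satisfy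
      \<open>w + h * r w \<ge> w + h * r v > y\<close>.\<close>
    then have "max v (y - h * r v) < resolvent h y" using assms by simp
    then have "\<exists>w\<in>{v \<in> {0..max 0 y}. v + h * r v \<le> max 0 y}. max v (y - h * r v) < w"
      unfolding resolvent_def using resolvent_set[of y]
      by (subst (asm) less_cSup_iff[OF _ resolvent_set(2)]) (blast, assumption)
    then obtain w where w: "0 \<le> w" "w \<le> y" "w + h * r w \<le> y" "max v (y - h * r v) < w"
      using assms(1) by auto
    then have "h * r v \<le> h * r w" using h assms by (intro mult_left_mono r_mono) auto
    then show False using w by simp
  qed
  then show ?thesis by simp
qed

lemma r_ge_above_resolvent:
  assumes "0 \<le> y" "resolvent h y < v"
  shows "y - resolvent h y \<le> h * r v"
proof (rule ccontr)
  assume "\<not> ?thesis"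
  then have lt: "resolvent h y < y - h * r v" by simp
  \<comment> \<open>\<open>w\<close> belongs to the set, since
    \<open>w + h * r w \<le> (y - h * r v) + h * r v\<close>, and yet exceeds its supremum.\<close>
  define w where "w = min v (y - h * r v)"
  have w: "resolvent h y < w" "w \<le> v" "w \<le> y - h * r v" using lt assms by (auto simp: w_def)
  have w0: "0 \<le> w" using w resolvent_nonneg[of y] by simp
  have "h * r w \<le> h * r v" "0 \<le> h * r w" using h w w0 r_nonneg[of w] by (auto intro!: mult_left_mono r_mono)
  then have "w \<le> resolvent h y"
    unfolding resolvent_def using resolvent_set(2)[of y] w w0 assms(1) by (intro cSup_upper) auto
  then show False using w by simp
qed

lemma resolvent_drop_le:
  assumes "0 \<le> y"
  shows "y - resolvent h y \<le> h * r y"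
  using r_ge_above_resolvent[OF assms, of y] resolvent_le[OF assms] r_nonneg[OF assms] h
  by (cases "resolvent h y = y") auto

text \<open>Monotonicity of the completed graph, which contains the point with abscissa
  \<open>resolvent h y\<close> and ordinate \<open>(y - resolvent h y) / h\<close>.\<close>

lemma resolvent_monotone:
  assumes "0 \<le> y" "0 \<le> v"
  shows "0 \<le> (v - resolvent h y) * (r v - (y - resolvent h y) / h)"
proof (cases v "resolvent h y" rule: linorder_cases)
  case less
  then have "r v \<le> (y - resolvent h y) / h"
    using r_le_below_resolvent[OF assms less] h by (simp add: pos_le_divide_eq mult.commute)
  then show ?thesis using less by (intro mult_nonpos_nonpos) auto
next
  case greater
  then have "(y - resolvent h y) / h \<le> r v"
    using r_ge_above_resolvent[OF assms(1) greater] h by (simp add: pos_divide_le_eq mult.commute)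
  then show ?thesis using greater by (intro mult_nonneg_nonneg) auto
qed simp

text \<open>An energy estimate. The new error \<open>e\<close> differs from the old one by the
  integral of \<open>r (\<xi> u) - \<rho>\<close>, with \<open>\<rho>\<close> the release rate of
  the scheme. After multiplication by \<open>e\<close> the part
  \<open>(V - \<xi> u) * (r (\<xi> u) - \<rho>)\<close> is nonpositive by
  \<open>resolvent_monotone\<close>, so only the input and the oscillation of \<open>\<xi>\<close>
  within one step remain.\<close>

lemma euler_step:
  assumes \<xi>: "storage_path r a x \<xi>" and a: "mono_on {0..} a"
    and s: "0 \<le> s" and U: "0 \<le> U" and C: "r U \<le> C" "r (\<xi> s + (a (s + h) - a s)) \<le> C"
  shows "(resolvent h U + (a (s + h) - a s) - \<xi> (s + h))\<^sup>2
    \<le> (U - \<xi> s)\<^sup>2 + 2 * h * C * (2 * (a (s + h) - a s) + h * C)"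
proof -
  define V where "V = resolvent h U"
  define \<rho> where "\<rho> = (U - V) / h"
  define \<Delta> where "\<Delta> = a (s + h) - a s"
  define e where "e = V + \<Delta> - \<xi> (s + h)"
  let ?I = "{s..s + h}"
  have am: "a u \<le> a v" if "0 \<le> u" "u \<le> v" for u v
    using a that by (auto simp: mono_on_def)
  have \<Delta>: "0 \<le> \<Delta>" using am[of s "s + h"] s h by (simp add: \<Delta>_def)
  have \<rho>: "0 \<le> \<rho>" "\<rho> \<le> C"
    using resolvent_le[OF U] resolvent_drop_le[OF U] C h
    by (auto simp: \<rho>_def V_def pos_divide_le_eq mult.commute intro: order_trans[OF _ mult_right_mono[OF C(1)]])
  have int: "(\<lambda>u. r (\<xi> u)) integrable_on ?I" using storage_path_integrable[OF \<xi> s] .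
  have r\<xi>: "0 \<le> r (\<xi> u)" "r (\<xi> u) \<le> C" if "u \<in> ?I" for u
  proof -
    have u: "0 \<le> u" using that s by auto
    show "0 \<le> r (\<xi> u)" using storage_path_nonneg[OF \<xi> u] by (rule r_nonneg)
    have "\<xi> u \<le> \<xi> s + (a u - a s)" using that s by (intro storage_path_release_le[OF \<xi>]) auto
    also have "\<dots> \<le> \<xi> s + (a (s + h) - a s)" using am[of u "s + h"] u that by auto
    finally have "r (\<xi> u) \<le> r (\<xi> s + (a (s + h) - a s))"
      using storage_path_nonneg[OF \<xi> u] by (intro r_mono) auto
    then show "r (\<xi> u) \<le> C" using C by simp
  qed
  \<comment> \<open>From \<open>u\<close> to the end of the step the path rises by at most
    \<open>\<Delta>\<close> and falls by at most \<open>h * C\<close>.\<close>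
  have close: "\<bar>\<xi> (s + h) - \<xi> u\<bar> \<le> \<Delta> + h * C" if "u \<in> ?I" for u
  proof -
    have u: "0 \<le> u" "u \<le> s + h" "s \<le> u" using that s by auto
    have "integral {u..s + h} (\<lambda>v. r (\<xi> v)) \<le> integral {u..s + h} (\<lambda>v. C)"
      using r\<xi> u storage_path_integrable[OF \<xi>] by (intro integral_le) auto
    also have "\<dots> \<le> h * C" using u \<rho> by (auto intro!: mult_right_mono)
    finally have "integral {u..s + h} (\<lambda>v. r (\<xi> v)) \<le> h * C" .
    moreover have "0 \<le> integral {u..s + h} (\<lambda>v. r (\<xi> v))"
      using r\<xi> u storage_path_integrable[OF \<xi>] by (intro Henstock_Kurzweil_Integration.integral_nonneg) auto
    ultimately show ?thesis
      using storage_path_increment[OF \<xi> u(1,2)] am[of u "s + h"] am[of s u] u s h \<rho>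
      unfolding \<Delta>_def by auto
  qed
  have step: "e - (U - \<xi> s) = integral ?I (\<lambda>u. r (\<xi> u) - \<rho>)"
  proof -
    have "integral ?I (\<lambda>u. r (\<xi> u) - \<rho>) = integral ?I (\<lambda>u. r (\<xi> u)) - h * \<rho>"
      using int h by (subst Henstock_Kurzweil_Integration.integral_diff) auto
    also have "h * \<rho> = U - V" using h by (simp add: \<rho>_def)
    finally show ?thesis using storage_path_increment[OF \<xi> s, of "s + h"] h
      by (simp add: e_def \<Delta>_def)
  qed
  have pw: "e * (r (\<xi> u) - \<rho>) \<le> (2 * \<Delta> + h * C) * C" if "u \<in> ?I" for u
  proof -
    have u: "0 \<le> u" using that s by auto
    have "0 \<le> (\<xi> u - V) * (r (\<xi> u) - \<rho>)"
      unfolding V_def \<rho>_def using resolvent_monotone[OF U storage_path_nonneg[OF \<xi> u]] by simp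
    moreover have "e * (r (\<xi> u) - \<rho>) = (\<Delta> - (\<xi> (s + h) - \<xi> u)) * (r (\<xi> u) - \<rho>) - (\<xi> u - V) * (r (\<xi> u) - \<rho>)"
      by (simp add: e_def algebra_simps)
    moreover have "(\<Delta> - (\<xi> (s + h) - \<xi> u)) * (r (\<xi> u) - \<rho>) \<le> \<bar>\<Delta> - (\<xi> (s + h) - \<xi> u)\<bar> * \<bar>r (\<xi> u) - \<rho>\<bar>"
      by (metis abs_ge_self abs_mult)
    moreover have "\<dots> \<le> (2 * \<Delta> + h * C) * C"
      using close[OF that] r\<xi>[OF that] \<rho> \<Delta> by (intro mult_mono) auto
    ultimately show ?thesis by linarith
  qed
  have "e * (e - (U - \<xi> s)) = integral ?I (\<lambda>u. e * (r (\<xi> u) - \<rho>))"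
    unfolding step using int by (simp add: integrable_diff)
  also have "\<dots> \<le> integral ?I (\<lambda>u. (2 * \<Delta> + h * C) * C)"
    using pw int by (intro integral_le integrable_on_mult_right integrable_diff) auto
  also have "\<dots> = h * (2 * \<Delta> + h * C) * C" using h by simp
  finally have "e * (e - (U - \<xi> s)) \<le> h * (2 * \<Delta> + h * C) * C" .
  \<comment> \<open>\<open>e\<^sup>2 - d\<^sup>2 = 2 * e * (e - d) - (e - d)\<^sup>2\<close> with
    \<open>d = U - \<xi> s\<close>.\<close>
  moreover have "e\<^sup>2 - (U - \<xi> s)\<^sup>2 \<le> 2 * (e * (e - (U - \<xi> s)))"
    using zero_le_power2[of "e - (U - \<xi> s)"] by (simp add: power2_eq_square algebra_simps)
  ultimately show ?thesis unfolding e_def V_def \<Delta>_def by (simp add: algebra_simps)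
qed

end

text \<open>Release comes before input, so that a step adds an independent increment to a function
  of the present state, which is the form of \<open>euler_kernel\<close>.\<close>

primrec euler :: "real \<Rightarrow> (real \<Rightarrow> real) \<Rightarrow> real \<Rightarrow> real \<Rightarrow> nat \<Rightarrow> real" where
  "euler h a s y 0 = y"
| "euler h a s y (Suc k) =
     resolvent h (euler h a s y k) + (a (s + real (Suc k) * h) - a (s + real k * h))"

lemma euler_bounds:
  assumes h: "0 < h" and a: "mono_on {0..} a" and "0 \<le> s" "0 \<le> y"
  shows "0 \<le> euler h a s y k \<and> euler h a s y k \<le> y + (a (s + real k * h) - a s)"
proof (induction k)
  case (Suc k)
  have "a (s + real k * h) \<le> a (s + real (Suc k) * h)"
    using a assms by (auto simp: mono_on_def algebra_simps)
  then show ?case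
    using Suc resolvent_nonneg[OF h, of "euler h a s y k"] resolvent_le[OF h, of "euler h a s y k"] by auto
qed (use assms in simp)

text \<open>The error vanishes at \<open>k = 0\<close>; the bounds of the single steps add up and
  the increments telescope. \<open>C\<close> is \<open>r\<close> at the largest content reachable by
  the last step, hence valid in every step.\<close>

lemma euler_error:
  assumes \<xi>: "storage_path r a x \<xi>" and a: "mono_on {0..} a"
    and s: "0 \<le> s" and h: "0 < h" and "k \<le> n"
    and C: "C = r (\<xi> s + (a (s + real n * h) - a s))"
  shows "(euler h a s (\<xi> s) k - \<xi> (s + real k * h))\<^sup>2
    \<le> 2 * h * C * (2 * (a (s + real k * h) - a s) + real k * h * C)"
  using \<open>k \<le> n\<close>
proof (induction k)
  case (Suc k)
  let ?t = "s + real k * h"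
  have eq: "s + real (Suc k) * h = ?t + h" by (simp add: algebra_simps)
  have le: "a ?t \<le> a (s + real n * h)" "a (?t + h) \<le> a (s + real n * h)"
  proof -
    have *: "real (Suc k) * h \<le> real n * h" "real k * h \<le> real n * h"
      using Suc.prems h by (auto intro!: mult_right_mono)
    then show "a ?t \<le> a (s + real n * h)" "a (?t + h) \<le> a (s + real n * h)"
      using a s h by (auto simp: mono_on_def eq algebra_simps intro!: add_nonneg_nonneg)
  qed
  have t: "0 \<le> ?t" using s h by simp
  have at: "a ?t \<le> a (?t + h)" using a t h by (auto simp: mono_on_def)
  note bd = euler_bounds[OF h a s storage_path_nonneg[OF \<xi> s], of k]
  have "r (euler h a s (\<xi> s) k) \<le> C"
    unfolding C using bd le by (intro r_mono) auto
  moreover have "r (\<xi> ?t + (a (?t + h) - a ?t)) \<le> C"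
    unfolding C using storage_path_release_le[OF \<xi> s, of ?t] le at h storage_path_nonneg[OF \<xi> t]
    by (intro r_mono) auto
  ultimately have "(resolvent h (euler h a s (\<xi> s) k) + (a (?t + h) - a ?t) - \<xi> (?t + h))\<^sup>2
    \<le> (euler h a s (\<xi> s) k - \<xi> ?t)\<^sup>2 + 2 * h * C * (2 * (a (?t + h) - a ?t) + h * C)"
    using bd by (intro euler_step[OF h \<xi> a t]) auto
  then show ?case
    using Suc.IH Suc.prems by (simp add: eq) (simp add: algebra_simps)
qed simp

lemma euler_tendsto:
  assumes \<xi>: "storage_path r a x \<xi>" and a: "mono_on {0..} a"
    and s: "0 \<le> s" and t: "0 < t"
  shows "(\<lambda>n. euler (t / real (Suc n)) a s (\<xi> s) (Suc n)) \<longlonglongrightarrow> \<xi> (s + t)"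
proof -
  \<comment> \<open>\<open>C\<close> depends on the total input and not on the number of steps, so
    the squared error is of order \<open>1 / n\<close>.\<close>
  define C where "C = r (\<xi> s + (a (s + t) - a s))"
  define b where "b n = 2 * (t / real (Suc n)) * C * (2 * (a (s + t) - a s) + t * C)" for n
  define e where "e n = euler (t / real (Suc n)) a s (\<xi> s) (Suc n) - \<xi> (s + t)" for n
  have "(e n)\<^sup>2 \<le> b n" for n
    using euler_error[OF \<xi> a s, of "t / real (Suc n)" "Suc n" "Suc n" C] t
    by (simp add: e_def b_def C_def del: of_nat_Suc euler.simps)
  moreover have "b \<longlonglongrightarrow> 0"
  proof -
    have "(\<lambda>n. t * inverse (real (Suc n))) \<longlonglongrightarrow> t * 0"
      by (intro tendsto_intros LIMSEQ_inverse_real_of_nat)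
    then have "(\<lambda>n. 2 * (t / real (Suc n)) * C * (2 * (a (s + t) - a s) + t * C)) \<longlonglongrightarrow>
        2 * 0 * C * (2 * (a (s + t) - a s) + t * C)"
      by (intro tendsto_mult tendsto_const) (simp add: divide_inverse del: of_nat_Suc)
    then show ?thesis by (simp add: b_def[abs_def] del: of_nat_Suc)
  qed
  ultimately have "(\<lambda>n. (e n)\<^sup>2) \<longlonglongrightarrow> 0"
    by (rule_tac tendsto_sandwich[of "\<lambda>_. 0" _ _ b]) auto
  then have "(\<lambda>n. sqrt ((e n)\<^sup>2)) \<longlonglongrightarrow> sqrt 0" by (rule tendsto_real_sqrt)
  then have "e \<longlonglongrightarrow> 0" by (simp add: tendsto_rabs_zero_iff)
  then show ?thesis unfolding e_def by (rule LIM_zero_cancel)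
qed

end

section \<open>Contraction of two storage paths with a common input\<close>

locale dissipative_release = monotone_release r + dissipation_rate \<beta>
  for r \<beta> :: "real \<Rightarrow> real" +
  fixes \<Gamma> :: real
  assumes \<Gamma>: "0 < \<Gamma>"
    and dissipative: "0 \<le> u \<Longrightarrow> u \<le> v \<Longrightarrow> \<Gamma> * \<beta> (v - u) \<le> r v - r u"
begin

text \<open>The difference is nonincreasing, so on \<open>[s, t]\<close> it is at least its final
  value, and the difference of the release rates is at least \<open>\<Gamma>\<close> times
  \<open>\<beta>\<close> of that value.\<close>

lemma storage_path_decay:
  assumes \<xi>: "storage_path r a x \<xi>" and \<eta>: "storage_path r a y \<eta>"
    and le: "\<xi> 0 \<le> \<eta> 0" and s: "0 \<le> s" "s \<le> t"
  shows "\<eta> t - \<xi> t \<le> \<eta> s - \<xi> s - \<Gamma> * (t - s) * \<beta> (\<eta> t - \<xi> t)"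
proof -
  have ord: "\<xi> u \<le> \<eta> u" if "0 \<le> u" for u using storage_path_order[OF \<xi> \<eta> le that] .
  have int: "(\<lambda>u. r (\<eta> u) - r (\<xi> u)) integrable_on {s..t}" if "0 \<le> s" for s t
    using storage_path_integrable[OF \<xi>] storage_path_integrable[OF \<eta>] that by (intro integrable_diff) auto
  have D: "\<eta> v - \<xi> v = \<eta> u - \<xi> u - integral {u..v} (\<lambda>u. r (\<eta> u) - r (\<xi> u))" if "0 \<le> u" "u \<le> v" for u v
    using storage_path_diff[OF \<xi> \<eta> that] .
  have anti: "\<eta> v - \<xi> v \<le> \<eta> u - \<xi> u" if "0 \<le> u" "u \<le> v" for u v
  proof -
    have "0 \<le> integral {u..v} (\<lambda>u. r (\<eta> u) - r (\<xi> u))"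
      using int that storage_path_nonneg[OF \<xi>] ord
      by (intro Henstock_Kurzweil_Integration.integral_nonneg) (auto intro!: r_mono)
    then show ?thesis using D[OF that] by simp
  qed
  have "\<Gamma> * (t - s) * \<beta> (\<eta> t - \<xi> t) = integral {s..t} (\<lambda>u. \<Gamma> * \<beta> (\<eta> t - \<xi> t))"
    using s by simp
  also have "\<dots> \<le> integral {s..t} (\<lambda>u. r (\<eta> u) - r (\<xi> u))"
  proof (rule integral_le)
    fix u assume u: "u \<in> {s..t}"
    then have u0: "0 \<le> u" using s by auto
    have "\<Gamma> * \<beta> (\<eta> t - \<xi> t) \<le> \<Gamma> * \<beta> (\<eta> u - \<xi> u)"
      using \<Gamma> u u0 s ord[of t] anti[of u t] by (intro mult_left_mono mono) auto
    also have "\<dots> \<le> r (\<eta> u) - r (\<xi> u)"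
      using storage_path_nonneg[OF \<xi> u0] ord[OF u0] by (rule dissipative)
    finally show "\<Gamma> * \<beta> (\<eta> t - \<xi> t) \<le> r (\<eta> u) - r (\<xi> u)" .
  qed (use int s in auto)
  finally show ?thesis using D[OF s] by simp
qed

lemma storage_path_contraction:
  assumes \<xi>: "storage_path r a x \<xi>" and \<eta>: "storage_path r a y \<eta>"
    and \<kappa>: "0 < \<kappa>" and t: "0 \<le> t"
  shows "\<bar>\<eta> t - \<xi> t\<bar> \<le> max 1 (\<bar>\<eta> 0 - \<xi> 0\<bar> / \<kappa>) * B_inv \<beta> \<kappa> (\<Gamma> * t)"
proof -
  have *: "\<eta> t - \<xi> t \<le> max 1 (\<bar>\<eta> 0 - \<xi> 0\<bar> / \<kappa>) * B_inv \<beta> \<kappa> (\<Gamma> * t) \<and> \<xi> t \<le> \<eta> t"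
    if \<xi>: "storage_path r a x \<xi>" and \<eta>: "storage_path r a y \<eta>" and le: "\<xi> 0 \<le> \<eta> 0"
    for x \<xi> y \<eta>
  proof -
    \<comment> \<open>The least constant not below \<open>1\<close> that brings the initial
      difference down to \<open>\<kappa>\<close>; \<open>le_scale\<close> asks for
      \<open>1 / c \<le> 1\<close>.\<close>
    define c where "c = max 1 (\<bar>\<eta> 0 - \<xi> 0\<bar> / \<kappa>)"
    have c: "1 \<le> c" "\<eta> 0 - \<xi> 0 \<le> c * \<kappa>"
      using \<kappa> le by (auto simp: c_def max_def divide_simps mult.commute)
    have ord: "\<xi> u \<le> \<eta> u" if "0 \<le> u" for u using storage_path_order[OF \<xi> \<eta> le that] .
    have "(\<eta> t - \<xi> t) / c \<le> B_inv \<beta> \<kappa> (\<Gamma> * t)"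
    proof (rule le_B_inv_of_decay[OF \<kappa> \<Gamma> t])
      show "continuous_on {0..t} (\<lambda>u. (\<eta> u - \<xi> u) / c)"
        using c by (intro continuous_on_divide storage_path_diff_continuous[OF \<xi> \<eta>] continuous_on_const) auto
      show "0 \<le> (\<eta> u - \<xi> u) / c" if "0 \<le> u" for u using ord[OF that] c by auto
      show "(\<eta> 0 - \<xi> 0) / c \<le> \<kappa>" using c by (simp add: pos_divide_le_eq mult.commute)
      show "(\<eta> v - \<xi> v) / c \<le> (\<eta> u - \<xi> u) / c - \<Gamma> * (v - u) * \<beta> ((\<eta> v - \<xi> v) / c)"
        if "0 \<le> u" "u \<le> v" for u v
      proof -
        have "\<beta> (1 / c * (\<eta> v - \<xi> v)) \<le> 1 / c * \<beta> (\<eta> v - \<xi> v)"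
          using c ord[of v] that by (intro le_scale) auto
        then have "\<Gamma> * (v - u) * \<beta> ((\<eta> v - \<xi> v) / c) \<le> \<Gamma> * (v - u) * (\<beta> (\<eta> v - \<xi> v) / c)"
          using \<Gamma> that by (intro mult_left_mono) auto
        moreover have "(\<eta> v - \<xi> v) / c \<le> (\<eta> u - \<xi> u - \<Gamma> * (v - u) * \<beta> (\<eta> v - \<xi> v)) / c"
          using storage_path_decay[OF \<xi> \<eta> le that] c by (intro divide_right_mono) auto
        ultimately show ?thesis by (simp add: diff_divide_distrib)
      qed
    qed
    then show ?thesis using c ord[OF t] by (simp add: pos_divide_le_eq mult.commute c_def)
  qed
  show ?thesis
  proof (cases "\<xi> 0 \<le> \<eta> 0")
    case True
    then show ?thesis using *[OF \<xi> \<eta>] by simp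
  next
    case False
    then show ?thesis using *[OF \<eta> \<xi>] by (simp add: abs_minus_commute)
  qed
qed

end

section \<open>Laplace exponents of subordinators\<close>

text \<open>Fatou's lemma, in the form that carries bounds on difference quotients and on truncated
  moments to the limit.\<close>

lemma nn_integral_le_of_tendsto:
  fixes g :: "nat \<Rightarrow> 'a \<Rightarrow> real"
  assumes [measurable]: "\<And>n. g n \<in> borel_measurable M"
    and lim: "AE x in M. (\<lambda>n. g n x) \<longlonglongrightarrow> g' x"
    and le: "\<And>n. (\<integral>\<^sup>+x. ennreal (g n x) \<partial>M) \<le> C"
  shows "(\<integral>\<^sup>+x. ennreal (g' x) \<partial>M) \<le> C"
proof -
  have "(\<integral>\<^sup>+x. ennreal (g' x) \<partial>M) = (\<integral>\<^sup>+x. liminf (\<lambda>n. ennreal (g n x)) \<partial>M)"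
    using lim by (intro nn_integral_cong_AE) (auto simp: lim_imp_Liminf[OF _ tendsto_ennrealI])
  also have "\<dots> \<le> liminf (\<lambda>n. \<integral>\<^sup>+x. ennreal (g n x) \<partial>M)"
    by (rule nn_integral_liminf) simp
  also have "\<dots> \<le> C"
    using le by (intro Liminf_le) auto
  finally show ?thesis .
qed

text \<open>Uniqueness in the Hausdorff moment problem: polynomials have equal integrals, and they
  approximate \<open>h\<close> uniformly on \<open>[0, 1]\<close>.\<close>

lemma integral_eq_of_moments_eq:
  fixes Z1 :: "'a \<Rightarrow> real" and Z2 :: "'b \<Rightarrow> real" and h :: "real \<Rightarrow> real"
  assumes "finite_measure N1" "finite_measure N2"
    and [measurable]: "Z1 \<in> borel_measurable N1" "Z2 \<in> borel_measurable N2"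
    and Z1: "AE x in N1. Z1 x \<in> {0..1}" and Z2: "AE x in N2. Z2 x \<in> {0..1}"
    and moments: "\<And>k. (\<integral>x. Z1 x ^ k \<partial>N1) = (\<integral>x. Z2 x ^ k \<partial>N2)"
    and h: "continuous_on {0..1} h" and [measurable]: "h \<in> borel_measurable borel"
  shows "(\<integral>x. h (Z1 x) \<partial>N1) = (\<integral>x. h (Z2 x) \<partial>N2)"
proof -
  interpret N1: finite_measure N1 by fact
  interpret N2: finite_measure N2 by fact
  define c where "c = measure N1 (space N1) + measure N2 (space N2)"
  have "0 \<le> c" by (simp add: c_def)
  have approx: "\<bar>(\<integral>x. h (Z x) \<partial>N) - (\<Sum>i\<le>n. a i * (\<integral>x. Z x ^ i \<partial>N))\<bar> \<le> e * measure N (space N)"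
    if "finite_measure N" and [measurable]: "Z \<in> borel_measurable N" and Z: "AE x in N. Z x \<in> {0..1}"
      and e: "\<And>s. s \<in> {0..1} \<Longrightarrow> \<bar>h s - (\<Sum>i\<le>n. a i * s ^ i)\<bar> < e" for N Z a n e
  proof -
    interpret finite_measure N by fact
    have pow: "integrable N (\<lambda>x. Z x ^ i)" for i
    proof (rule integrable_const_bound)
      show "AE x in N. norm (Z x ^ i) \<le> 1"
        using Z by eventually_elim (auto intro: power_le_one)
    qed simp
    have "bounded (h ` {0..1})"
      using compact_continuous_image[OF h] by (auto intro: compact_imp_bounded)
    then obtain B where B: "\<forall>s\<in>{0..1}. \<bar>h s\<bar> \<le> B" unfolding bounded_iff by auto
    have hint: "integrable N (\<lambda>x. h (Z x))"
    proof (rule integrable_const_bound)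
      show "AE x in N. norm (h (Z x)) \<le> B"
        using Z by eventually_elim (use B in auto)
    qed simp
    have "(\<integral>x. h (Z x) \<partial>N) - (\<Sum>i\<le>n. a i * (\<integral>x. Z x ^ i \<partial>N)) =
        (\<integral>x. h (Z x) - (\<Sum>i\<le>n. a i * Z x ^ i) \<partial>N)"
      using pow hint by (simp add: Bochner_Integration.integral_diff)
    also have "\<bar>\<dots>\<bar> \<le> (\<integral>x. \<bar>h (Z x) - (\<Sum>i\<le>n. a i * Z x ^ i)\<bar> \<partial>N)"
      by (rule integral_abs_bound)
    also have "\<dots> \<le> (\<integral>x. e \<partial>N)"
    proof (rule integral_mono_AE)
      show "AE x in N. \<bar>h (Z x) - (\<Sum>i\<le>n. a i * Z x ^ i)\<bar> \<le> e"
        using Z by eventually_elim (rule less_imp_le, rule e)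
    qed (use pow hint in auto)
    finally show ?thesis by (simp add: mult.commute)
  qed
  have "\<bar>(\<integral>x. h (Z1 x) \<partial>N1) - (\<integral>x. h (Z2 x) \<partial>N2)\<bar> \<le> 0 + d" if "0 < d" for d
  proof -
    \<comment> \<open>\<open>c\<close> is the total mass of both measures; adding \<open>1\<close>
      keeps the denominator positive.\<close>
    define e where "e = d / (c + 1)"
    have e: "0 < e" "e * c \<le> d"
      using that \<open>0 \<le> c\<close> by (auto simp: e_def field_simps)
    obtain g where g: "real_polynomial_function g" "\<And>s. s \<in> {0..1} \<Longrightarrow> \<bar>h s - g s\<bar> < e"
      using Stone_Weierstrass_real_polynomial_function[OF compact_Icc h \<open>0 < e\<close>] by blast
    obtain a n where an: "g = (\<lambda>s. \<Sum>i\<le>n. a i * s ^ i)"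
      using g(1) by (auto simp: real_polynomial_function_iff_sum)
    show ?thesis
      using approx[OF assms(1,3) Z1 g(2)[unfolded an]] approx[OF assms(2,4) Z2 g(2)[unfolded an]] e(2)
      unfolding moments c_def by (simp add: distrib_left)
  qed
  then have "\<bar>(\<integral>x. h (Z1 x) \<partial>N1) - (\<integral>x. h (Z2 x) \<partial>N2)\<bar> \<le> 0"
    by (rule field_le_epsilon)
  then show ?thesis by simp
qed

locale subordinator =
  fixes M :: "'a measure" and F :: "real \<Rightarrow> 'a measure" and \<nu> :: "real measure"
    and A :: "real \<Rightarrow> 'a \<Rightarrow> real"
  assumes basis: "stochastic_basis M F"
    and levy: "levy_measure \<nu>"
    and subordinator: "pure_jump_subordinator M F \<nu> A"
begin

sublocale prob_space M
  using basis by (simp add: stochastic_basis_def)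

lemma subalgebra_F: "0 \<le> t \<Longrightarrow> subalgebra M (F t)"
  using basis unfolding stochastic_basis_def by blast

lemma measurable_F: "0 \<le> t \<Longrightarrow> f \<in> measurable (F t) N \<Longrightarrow> f \<in> measurable M N"
  by (rule measurable_from_subalg[OF subalgebra_F])

lemma measurable_F_mono:
  assumes "0 \<le> s" "s \<le> t" "f \<in> measurable (F s) N"
  shows "f \<in> measurable (F t) N"
proof -
  have "sets (F s) \<subseteq> sets (F t)"
    using assms(1,2) basis unfolding stochastic_basis_def by blast
  moreover have "space (F s) = space (F t)"
    using subalgebra_F[of s] subalgebra_F[of t] assms by (simp add: subalgebra_def)
  ultimately have "subalgebra (F t) (F s)" by (simp add: subalgebra_def)
  then show ?thesis using assms(3) by (rule measurable_from_subalg)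
qed

lemma A_measurable_F: "0 \<le> t \<Longrightarrow> A t \<in> borel_measurable (F t)"
  using subordinator by (simp add: pure_jump_subordinator_def)

lemma A_measurable [measurable]: "0 \<le> t \<Longrightarrow> A t \<in> borel_measurable M"
  using A_measurable_F measurable_F by blast

lemma AE_A_path: "AE \<omega> in M. A 0 \<omega> = 0 \<and> mono_on {0..} (\<lambda>t. A t \<omega>)"
  using subordinator unfolding pure_jump_subordinator_def by auto

lemma AE_A_nonneg: "0 \<le> t \<Longrightarrow> AE \<omega> in M. 0 \<le> A t \<omega>"
  using AE_A_path by eventually_elim (force simp: mono_on_def)

lemma increment_distr:
  "0 \<le> s \<Longrightarrow> s \<le> t \<Longrightarrow> distr M borel (\<lambda>\<omega>. A t \<omega> - A s \<omega>) = distr M borel (A (t - s))"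
  using subordinator unfolding pure_jump_subordinator_def by blast

lemma increment_indep:
  "0 \<le> s \<Longrightarrow> s \<le> t \<Longrightarrow>
    indep_set (sets (F s)) (sets (vimage_algebra (space M) (\<lambda>\<omega>. A t \<omega> - A s \<omega>) borel))"
  using subordinator unfolding pure_jump_subordinator_def by blast

text \<open>By independence the joint law of \<open>\<xi>\<close> and the increment is a product,
  and by stationarity its second factor is the law of \<open>A h\<close>; Fubini does the
  rest.\<close>

lemma integral_increment:
  fixes g :: "real \<Rightarrow> real \<Rightarrow> real"
  assumes s: "0 \<le> s" "0 \<le> h" and \<xi>: "\<xi> \<in> borel_measurable (F s)"
    and g: "case_prod g \<in> borel_measurable (borel \<Otimes>\<^sub>M borel)" and B: "\<And>x y. \<bar>g x y\<bar> \<le> B"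
  shows "(\<integral>\<omega>. g (\<xi> \<omega>) (A (s + h) \<omega> - A s \<omega>) \<partial>M) = (\<integral>\<omega>. (\<integral>\<omega>'. g (\<xi> \<omega>) (A h \<omega>') \<partial>M) \<partial>M)"
proof -
  let ?I = "\<lambda>\<omega>. A (s + h) \<omega> - A s \<omega>"
  have [measurable]: "\<xi> \<in> borel_measurable M" "?I \<in> borel_measurable M" "A h \<in> borel_measurable M"
    using measurable_F[OF s(1) \<xi>] A_measurable[of s] A_measurable[of "s + h"] A_measurable[of h] s by auto
  have "distr M borel ?I = distr M borel (A (s + h - s))"
    by (rule increment_distr) (use s in auto)
  then have dist: "distr M borel ?I = distr M borel (A h)" by simp
  have "indep_set (sets (F s)) (sets (vimage_algebra (space M) ?I borel))"
    by (rule increment_indep) (use s in auto)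
  then have ind: "indep_sets (case_bool (sets (F s)) (sets (vimage_algebra (space M) ?I borel))) UNIV"
    by (simp add: indep_set_def)
  have sp: "space (F s) = space M" using subalgebra_F[OF s(1)] by (simp add: subalgebra_def)
  \<comment> \<open>\<open>indep_var\<close> speaks of the generated sigma-algebras, which lie
    inside the two independent families.\<close>
  have "sigma_sets (space M) {\<xi> -` B \<inter> space M |B. B \<in> sets borel} \<subseteq> sets (F s)"
    using measurable_sets[OF \<xi>] unfolding sp
    by (intro sets.sigma_sets_subset[of _ "F s", unfolded sp]) auto
  moreover have "sigma_sets (space M) {?I -` B \<inter> space M |B. B \<in> sets borel}
      \<subseteq> sets (vimage_algebra (space M) ?I borel)"
    by (intro sets.sigma_sets_subset[of _ "vimage_algebra (space M) ?I borel", unfolded space_vimage_algebra])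
       (auto intro: in_vimage_algebra)
  ultimately have "indep_set (sigma_sets (space M) {\<xi> -` B \<inter> space M |B. B \<in> sets borel})
      (sigma_sets (space M) {?I -` B \<inter> space M |B. B \<in> sets borel})"
    unfolding indep_set_def
    by (rule_tac indep_sets_mono_sets[OF ind]) (simp split: bool.split)
  then have "indep_var borel \<xi> borel ?I"
    unfolding indep_var_eq by simp
  then have joint: "distr M borel \<xi> \<Otimes>\<^sub>M distr M borel ?I = distr M (borel \<Otimes>\<^sub>M borel) (\<lambda>\<omega>. (\<xi> \<omega>, ?I \<omega>))"
    by (simp add: indep_var_distribution_eq)
  interpret D1: prob_space "distr M borel \<xi>" by (rule prob_space_distr) simp
  interpret D2: prob_space "distr M borel (A h)" by (rule prob_space_distr) simp
  interpret D: pair_prob_space "distr M borel \<xi>" "distr M borel (A h)" ..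
  note [measurable] = g
  have "(\<integral>\<omega>. g (\<xi> \<omega>) (?I \<omega>) \<partial>M) = (\<integral>z. case_prod g z \<partial>distr M (borel \<Otimes>\<^sub>M borel) (\<lambda>\<omega>. (\<xi> \<omega>, ?I \<omega>)))"
    by (subst integral_distr) auto
  also have "\<dots> = (\<integral>x. \<integral>y. g x y \<partial>distr M borel (A h) \<partial>distr M borel \<xi>)"
    unfolding joint[symmetric] dist using B
    by (subst D.integral_fst'[symmetric]) (auto intro!: D.P.integrable_const_bound[where B = B])
  also have "\<dots> = (\<integral>\<omega>. (\<integral>\<omega>'. g (\<xi> \<omega>) (A h \<omega>') \<partial>M) \<partial>M)"
    by (subst integral_distr) (auto simp: integral_distr)
  finally show ?thesis .
qed

end


locale subordinator_moment = subordinator M F \<nu> A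
  for M :: "'a measure" and F \<nu> A +
  fixes p :: real
  assumes p: "1 \<le> p"
    and moment: "(\<integral>\<^sup>+u. ennreal (max u (u powr p)) \<partial>\<nu>) < \<infinity>"
begin

lemma sets_\<nu>: "sets \<nu> = sets (restrict_space borel {0<..})"
  using levy by (simp add: levy_measure_def)

lemma space_\<nu>: "space \<nu> = {0<..}"
  using sets_eq_imp_space_eq[OF sets_\<nu>] by (simp add: space_restrict_space)

lemma measurable_\<nu>: "f \<in> borel_measurable borel \<Longrightarrow> f \<in> borel_measurable \<nu>"
  by (subst measurable_cong_sets[OF sets_\<nu> refl]) (rule measurable_restrict_space1)

lemma integrable_\<nu>: "integrable \<nu> (\<lambda>u. u)" "integrable \<nu> (\<lambda>u. u powr p)"
proof -
  have "integrable \<nu> (\<lambda>u. max u (u powr p))"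
    using moment by (intro integrableI_nonneg measurable_\<nu>) (auto simp: space_\<nu>)
  note * = Bochner_Integration.integrable_bound[OF this]
  show "integrable \<nu> (\<lambda>u. u)" "integrable \<nu> (\<lambda>u. u powr p)"
    by (intro * AE_I2 measurable_\<nu>; auto simp: space_\<nu> max_def)+
qed

definition \<nu>_mean :: real where "\<nu>_mean = (\<integral>u. u \<partial>\<nu>)"

lemma \<nu>_mean_nonneg: "0 \<le> \<nu>_mean"
  unfolding \<nu>_mean_def by (intro integral_nonneg_AE) (auto simp: space_\<nu>)

text \<open>The Laplace exponent of the subordinator.\<close>

definition \<psi> :: "real \<Rightarrow> real" where "\<psi> l = (\<integral>u. exp (- (l * u)) - 1 \<partial>\<nu>)"

lemma laplace: "0 \<le> l \<Longrightarrow> (\<integral>\<omega>. exp (- (l * A 1 \<omega>)) \<partial>M) = exp (\<psi> l)"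
proof -
  have "\<forall>t\<ge>0. \<forall>l\<ge>0. (\<integral>\<omega>. exp (- l * A t \<omega>) \<partial>M) = exp (t * (\<integral>u. (exp (- l * u) - 1) \<partial>\<nu>))"
    using subordinator unfolding pure_jump_subordinator_def by blast
  from this[rule_format, of 1 l] show "0 \<le> l \<Longrightarrow> ?thesis" by (simp add: \<psi>_def)
qed

text \<open>Domination for the difference quotients of \<open>l \<mapsto> exp (- (l * a))\<close>,
  uniformly in \<open>d\<close>. The bound \<open>a\<close> is integrable under \<open>\<nu>\<close>
  and, once \<open>integrable_A1\<close> is known, under the law of \<open>A 1\<close>.\<close>

lemma exp_diff_quotient_bounds:
  fixes a l d :: real
  assumes "0 \<le> a" "0 \<le> l" "0 < d"
  shows "0 \<le> (exp (- (l * a)) - exp (- ((l + d) * a))) / d"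
    and "(exp (- (l * a)) - exp (- ((l + d) * a))) / d \<le> a"
proof -
  have eq: "exp (- (l * a)) - exp (- ((l + d) * a)) = exp (- (l * a)) * (1 - exp (- (d * a)))"
    by (simp add: algebra_simps flip: exp_add)
  have "0 \<le> 1 - exp (- (d * a))" "1 - exp (- (d * a)) \<le> d * a"
    using assms exp_ge_add_one_self[of "- (d * a)"] by auto
  moreover have "exp (- (l * a)) \<le> 1" using assms by simp
  moreover have "exp (- (l * a)) * (1 - exp (- (d * a))) \<le> 1 * (1 - exp (- (d * a)))"
    using calculation by (intro mult_right_mono) auto
  ultimately have "0 \<le> exp (- (l * a)) * (1 - exp (- (d * a)))" "exp (- (l * a)) * (1 - exp (- (d * a))) \<le> d * a"
    by (auto simp: zero_le_mult_iff)
  then show "0 \<le> (exp (- (l * a)) - exp (- ((l + d) * a))) / d" "(exp (- (l * a)) - exp (- ((l + d) * a))) / d \<le> a"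
    using assms unfolding eq by (auto simp: divide_simps mult.commute)
qed

text \<open>Only positive increments of \<open>l\<close> occur, since at \<open>l = 0\<close> the
  Laplace transform is given to the right only.\<close>

lemma exp_diff_quotient_tendsto:
  fixes a l :: real
  shows "(\<lambda>n. (exp (- (l * a)) - exp (- ((l + inverse (real (Suc n))) * a))) / inverse (real (Suc n)))
    \<longlonglongrightarrow> a * exp (- (l * a))"
proof -
  have "((\<lambda>x. - exp (- x * a)) has_real_derivative a * exp (- (l * a))) (at l)"
    by (auto intro!: derivative_eq_intros)
  then have "(\<lambda>d. (- exp (- ((l + d) * a)) - - exp (- (l * a))) / d) \<midarrow>0\<rightarrow> a * exp (- (l * a))"
    by (simp add: DERIV_def)
  moreover have "filterlim (\<lambda>n. inverse (real (Suc n))) (at 0) sequentially"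
    by (intro filterlim_atI LIMSEQ_inverse_real_of_nat) auto
  ultimately show ?thesis
    by (rule filterlim_compose[THEN filterlim_cong[THEN iffD1, rotated 3]]) auto
qed

lemma integrable_exp_minus_one: "0 \<le> l \<Longrightarrow> integrable \<nu> (\<lambda>u. exp (- (l * u)) - 1)"
proof (rule Bochner_Integration.integrable_bound[where f = "\<lambda>u. l * u"])
  assume "0 \<le> l"
  have "\<bar>exp (- (l * u)) - 1\<bar> \<le> l * u" if "0 < u" for u
  proof -
    have "0 \<le> l * u" using that \<open>0 \<le> l\<close> by simp
    moreover from this have "exp (- (l * u)) \<le> 1" by simp
    ultimately show ?thesis using exp_ge_add_one_self[of "- (l * u)"] by linarith
  qed
  then show "AE u in \<nu>. norm (exp (- (l * u)) - 1) \<le> norm (l * u)"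
    by (auto simp: space_\<nu> intro!: AE_I2) (metis abs_ge_self order_trans)
qed (auto intro: integrable_\<nu> measurable_\<nu>)

lemma \<psi>_diff: 
  assumes "0 \<le> l" "0 < d"
  shows "(\<psi> l - \<psi> (l + d)) / d = (\<integral>u. (exp (- (l * u)) - exp (- ((l + d) * u))) / d \<partial>\<nu>)"
  unfolding \<psi>_def using assms
  by (subst Bochner_Integration.integral_diff[symmetric]) (auto intro!: integrable_exp_minus_one)

lemma \<psi>_quotient_bounds:
  assumes "0 \<le> l" "0 < d"
  shows "0 \<le> (\<psi> l - \<psi> (l + d)) / d" "(\<psi> l - \<psi> (l + d)) / d \<le> \<nu>_mean"
proof -
  have [simp]: "AE u in \<nu>. 0 \<le> (exp (- (l * u)) - exp (- ((l + d) * u))) / d"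
    "AE u in \<nu>. (exp (- (l * u)) - exp (- ((l + d) * u))) / d \<le> u"
    using exp_diff_quotient_bounds[OF _ assms] by (auto simp: space_\<nu> intro!: AE_I2)
  show "0 \<le> (\<psi> l - \<psi> (l + d)) / d"
    unfolding \<psi>_diff[OF assms] by (rule integral_nonneg_AE) simp
  show "(\<psi> l - \<psi> (l + d)) / d \<le> \<nu>_mean"
    unfolding \<psi>_diff[OF assms] \<nu>_mean_def
  proof (rule integral_mono_AE)
    show "integrable \<nu> (\<lambda>u. (exp (- (l * u)) - exp (- ((l + d) * u))) / d)"
      using integrable_exp_minus_one[of l] integrable_exp_minus_one[of "l + d"] assms
        Bochner_Integration.integrable_diff[of \<nu> "\<lambda>u. exp (- (l * u)) - 1" "\<lambda>u. exp (- ((l + d) * u)) - 1"]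
      by simp
  qed (use integrable_\<nu> in auto)
qed

lemma \<psi>_quotient_tendsto:
  assumes "0 \<le> l"
  shows "(\<lambda>n. (\<psi> l - \<psi> (l + inverse (real (Suc n)))) / inverse (real (Suc n)))
    \<longlonglongrightarrow> (\<integral>u. u * exp (- (l * u)) \<partial>\<nu>)"
proof -
  have "(\<lambda>n. \<integral>u. (exp (- (l * u)) - exp (- ((l + inverse (real (Suc n))) * u))) / inverse (real (Suc n)) \<partial>\<nu>)
    \<longlonglongrightarrow> (\<integral>u. u * exp (- (l * u)) \<partial>\<nu>)"
  proof (rule integral_dominated_convergence[where w = "\<lambda>u. u"])
    show "AE u in \<nu>. norm ((exp (- (l * u)) - exp (- ((l + inverse (real (Suc n))) * u))) / inverse (real (Suc n))) \<le> u" for n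
    proof (rule AE_I2)
      fix u assume "u \<in> space \<nu>"
      then have "0 \<le> u" by (simp add: space_\<nu>)
      have "0 < inverse (real (Suc n))" by simp
      from exp_diff_quotient_bounds[OF \<open>0 \<le> u\<close> assms this]
      show "norm ((exp (- (l * u)) - exp (- ((l + inverse (real (Suc n))) * u))) / inverse (real (Suc n))) \<le> u"
        by (simp only: real_norm_def abs_of_nonneg)
    qed
    show "AE u in \<nu>. (\<lambda>n. (exp (- (l * u)) - exp (- ((l + inverse (real (Suc n))) * u))) / inverse (real (Suc n)))
      \<longlonglongrightarrow> u * exp (- (l * u))"
      by (intro AE_I2 exp_diff_quotient_tendsto)
  qed ((rule integrable_\<nu> measurable_\<nu>; measurable)+)
  then show ?thesis using assms by (simp add: \<psi>_diff del: of_nat_Suc)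
qed

text \<open>A chain rule for \<open>exp\<close> after \<open>\<psi>\<close>, by the sandwich
  \<open>e / (1 + e) \<le> 1 - exp (- e) \<le> e\<close> for the decrease \<open>e\<close> of
  \<open>\<psi>\<close>.\<close>

lemma exp_\<psi>_quotient_le:
  assumes "0 \<le> l" "0 < d"
  shows "(exp (\<psi> l) - exp (\<psi> (l + d))) / d \<le> exp (\<psi> l) * ((\<psi> l - \<psi> (l + d)) / d)"
    and "exp (\<psi> l) * ((\<psi> l - \<psi> (l + d)) / d / (1 + (\<psi> l - \<psi> (l + d)))) \<le> (exp (\<psi> l) - exp (\<psi> (l + d))) / d"
proof -
  define e where "e = \<psi> l - \<psi> (l + d)"
  have e: "0 \<le> e" using \<psi>_quotient_bounds(1)[OF assms] assms by (simp add: e_def zero_le_divide_iff)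
  have eq: "exp (\<psi> l) - exp (\<psi> (l + d)) = exp (\<psi> l) * (1 - exp (- e))"
    by (simp add: e_def algebra_simps flip: exp_add)
  have "1 - exp (- e) \<le> e" using exp_ge_add_one_self[of "- e"] by simp
  moreover have "e / (1 + e) \<le> 1 - exp (- e)"
    using exp_ge_add_one_self[of e] e by (simp add: exp_minus field_simps)
  ultimately have "exp (\<psi> l) * (1 - exp (- e)) / d \<le> exp (\<psi> l) * e / d"
      "exp (\<psi> l) * (e / (1 + e)) / d \<le> exp (\<psi> l) * (1 - exp (- e)) / d"
    using assms by (intro divide_right_mono mult_left_mono; simp)+
  then show "(exp (\<psi> l) - exp (\<psi> (l + d))) / d \<le> exp (\<psi> l) * ((\<psi> l - \<psi> (l + d)) / d)"
    "exp (\<psi> l) * ((\<psi> l - \<psi> (l + d)) / d / (1 + (\<psi> l - \<psi> (l + d)))) \<le> (exp (\<psi> l) - exp (\<psi> (l + d))) / d"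
    unfolding eq e_def[symmetric] by (simp_all add: mult.commute)
qed

lemma exp_\<psi>_quotient_tendsto:
  assumes "0 \<le> l"
  shows "(\<lambda>n. (exp (\<psi> l) - exp (\<psi> (l + inverse (real (Suc n))))) / inverse (real (Suc n)))
    \<longlonglongrightarrow> exp (\<psi> l) * (\<integral>u. u * exp (- (l * u)) \<partial>\<nu>)"
proof (rule tendsto_sandwich)
  let ?d = "\<lambda>n. inverse (real (Suc n))"
  let ?q = "\<lambda>n. (\<psi> l - \<psi> (l + ?d n)) / ?d n"
  let ?m = "\<integral>u. u * exp (- (l * u)) \<partial>\<nu>"
  have d: "0 < ?d n" for n by simp
  have q: "?q \<longlonglongrightarrow> ?m" using assms by (rule \<psi>_quotient_tendsto)
  have "(\<lambda>n. ?q n * ?d n) \<longlonglongrightarrow> ?m * 0" by (intro tendsto_mult q LIMSEQ_inverse_real_of_nat)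
  then have diff: "(\<lambda>n. \<psi> l - \<psi> (l + ?d n)) \<longlonglongrightarrow> 0" by (simp del: of_nat_Suc)
  show "\<forall>\<^sub>F n in sequentially. exp (\<psi> l) * (?q n / (1 + (\<psi> l - \<psi> (l + ?d n)))) \<le> (exp (\<psi> l) - exp (\<psi> (l + ?d n))) / ?d n"
    by (intro always_eventually allI exp_\<psi>_quotient_le(2) assms d)
  show "\<forall>\<^sub>F n in sequentially. (exp (\<psi> l) - exp (\<psi> (l + ?d n))) / ?d n \<le> exp (\<psi> l) * ?q n"
    by (intro always_eventually allI exp_\<psi>_quotient_le(1) assms d)
  show "(\<lambda>n. exp (\<psi> l) * ?q n) \<longlonglongrightarrow> exp (\<psi> l) * ?m"
    by (intro tendsto_mult tendsto_const q)
  have "(\<lambda>n. exp (\<psi> l) * (?q n / (1 + (\<psi> l - \<psi> (l + ?d n))))) \<longlonglongrightarrow> exp (\<psi> l) * (?m / (1 + 0))"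
    by (intro tendsto_mult tendsto_divide tendsto_add tendsto_const q diff) simp
  then show "(\<lambda>n. exp (\<psi> l) * (?q n / (1 + (\<psi> l - \<psi> (l + ?d n))))) \<longlonglongrightarrow> exp (\<psi> l) * ?m" by simp
qed

lemma AE_A1: "AE \<omega> in M. 0 \<le> A 1 \<omega>"
  by (rule AE_A_nonneg) simp

lemma integrable_exp_A1:
  assumes "0 \<le> l"
  shows "integrable M (\<lambda>\<omega>. exp (- (l * A 1 \<omega>)))"
proof (rule integrable_const_bound[where B = 1])
  show "AE \<omega> in M. norm (exp (- (l * A 1 \<omega>))) \<le> 1"
    using AE_A1 by eventually_elim (use assms in auto)
qed simp

lemma expectation_quotient:
  assumes "0 \<le> l" "0 < d"
  shows "integrable M (\<lambda>\<omega>. (exp (- (l * A 1 \<omega>)) - exp (- ((l + d) * A 1 \<omega>))) / d)"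
    and "(\<integral>\<omega>. (exp (- (l * A 1 \<omega>)) - exp (- ((l + d) * A 1 \<omega>))) / d \<partial>M) = (exp (\<psi> l) - exp (\<psi> (l + d))) / d"
proof -
  have i: "integrable M (\<lambda>\<omega>. exp (- (l * A 1 \<omega>)))" "integrable M (\<lambda>\<omega>. exp (- ((l + d) * A 1 \<omega>)))"
    using assms by (auto intro!: integrable_exp_A1)
  show "integrable M (\<lambda>\<omega>. (exp (- (l * A 1 \<omega>)) - exp (- ((l + d) * A 1 \<omega>))) / d)"
    by (intro integrable_divide_zero Bochner_Integration.integrable_diff i)
  show "(\<integral>\<omega>. (exp (- (l * A 1 \<omega>)) - exp (- ((l + d) * A 1 \<omega>))) / d \<partial>M) = (exp (\<psi> l) - exp (\<psi> (l + d))) / d"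
    using i assms by (simp only: integral_divide_zero Bochner_Integration.integral_diff laplace add_nonneg_nonneg less_imp_le)
qed

text \<open>The difference quotients of the Laplace transform at \<open>0\<close> are at most
  \<open>\<nu>_mean\<close>, and Fatou passes to the limit. The terms
  \<open>0 * A 1 \<omega>\<close> keep the shape of the quotient lemmas at
  \<open>l = 0\<close>.\<close>

lemma integrable_A1: "integrable M (A 1)"
proof (rule integrableI_nonneg)
  let ?d = "\<lambda>n. inverse (real (Suc n))"
  let ?f = "\<lambda>n \<omega>. (exp (- (0 * A 1 \<omega>)) - exp (- ((0 + ?d n) * A 1 \<omega>))) / ?d n"
  have "(\<integral>\<^sup>+\<omega>. ennreal (A 1 \<omega> * exp (- (0 * A 1 \<omega>))) \<partial>M) \<le> ennreal \<nu>_mean"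
  proof (rule nn_integral_le_of_tendsto)
    show "AE \<omega> in M. (\<lambda>n. ?f n \<omega>) \<longlonglongrightarrow> A 1 \<omega> * exp (- (0 * A 1 \<omega>))"
      by (intro AE_I2 exp_diff_quotient_tendsto)
    show "(\<integral>\<^sup>+\<omega>. ennreal (?f n \<omega>) \<partial>M) \<le> ennreal \<nu>_mean" for n
    proof -
      have d: "0 < ?d n" by simp
      have "AE \<omega> in M. 0 \<le> ?f n \<omega>"
        using AE_A1 by eventually_elim (rule exp_diff_quotient_bounds(1)[OF _ order_refl d])
      then have "(\<integral>\<^sup>+\<omega>. ennreal (?f n \<omega>) \<partial>M) = ennreal ((exp (\<psi> 0) - exp (\<psi> (0 + ?d n))) / ?d n)"
        using expectation_quotient[OF order_refl d] by (subst nn_integral_eq_integral) auto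
      moreover have "(exp (\<psi> 0) - exp (\<psi> (0 + ?d n))) / ?d n \<le> \<nu>_mean"
        using exp_\<psi>_quotient_le(1)[OF order_refl d] \<psi>_quotient_bounds(2)[OF order_refl d]
        by (simp add: \<psi>_def)
      ultimately show ?thesis by (simp add: ennreal_leI)
    qed
  qed auto
  then show "(\<integral>\<^sup>+\<omega>. ennreal (A 1 \<omega>) \<partial>M) < \<infinity>" by (simp add: le_less_trans)
qed (use AE_A1 in auto)

text \<open>Both sides are minus the right derivative of the Laplace transform at \<open>l\<close>,
  once taken under the expectation and once from the exponential formula.\<close>

lemma expectation_A1_exp:
  assumes "0 \<le> l"
  shows "(\<integral>\<omega>. A 1 \<omega> * exp (- (l * A 1 \<omega>)) \<partial>M) = exp (\<psi> l) * (\<integral>u. u * exp (- (l * u)) \<partial>\<nu>)"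
proof (rule LIMSEQ_unique)
  let ?d = "\<lambda>n. inverse (real (Suc n))"
  have d: "0 < ?d n" for n by simp
  have "(\<lambda>n. \<integral>\<omega>. (exp (- (l * A 1 \<omega>)) - exp (- ((l + ?d n) * A 1 \<omega>))) / ?d n \<partial>M)
      \<longlonglongrightarrow> (\<integral>\<omega>. A 1 \<omega> * exp (- (l * A 1 \<omega>)) \<partial>M)"
  proof (rule integral_dominated_convergence[where w = "A 1"])
    show "AE \<omega> in M. (\<lambda>n. (exp (- (l * A 1 \<omega>)) - exp (- ((l + ?d n) * A 1 \<omega>))) / ?d n) \<longlonglongrightarrow> A 1 \<omega> * exp (- (l * A 1 \<omega>))"
      by (intro AE_I2 exp_diff_quotient_tendsto)
    show "AE \<omega> in M. norm ((exp (- (l * A 1 \<omega>)) - exp (- ((l + ?d n) * A 1 \<omega>))) / ?d n) \<le> A 1 \<omega>" for n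
      using AE_A1
    proof eventually_elim
      case (elim \<omega>)
      then show ?case
        using exp_diff_quotient_bounds[OF elim assms d[of n]] by (simp only: real_norm_def abs_of_nonneg)
    qed
  qed (use integrable_A1 in auto)
  then show "(\<lambda>n. (exp (\<psi> l) - exp (\<psi> (l + ?d n))) / ?d n) \<longlonglongrightarrow> (\<integral>\<omega>. A 1 \<omega> * exp (- (l * A 1 \<omega>)) \<partial>M)"
    by (simp only: expectation_quotient(2)[OF assms d])
qed (rule exp_\<psi>_quotient_tendsto[OF assms])

end

section \<open>Moments of subordinators\<close>

lemma powr_add_le:
  fixes x y q :: real
  assumes "0 \<le> x" "0 \<le> y" "0 \<le> q"
  shows "(x + y) powr q \<le> 2 powr q * (x powr q + y powr q)"
proof -
  have "(x + y) powr q \<le> (2 * max x y) powr q"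
    using assms by (intro powr_mono2) auto
  also have "\<dots> = 2 powr q * max x y powr q"
    by (rule powr_mult)
  also have "\<dots> \<le> 2 powr q * (x powr q + y powr q)"
    by (intro mult_left_mono) (auto simp: max_def)
  finally show ?thesis .
qed

context subordinator_moment
begin

text \<open>The size-biased Levy measure. The moment condition makes it finite even if
  \<open>\<nu>\<close> is not, so that its product with \<open>M\<close> is determined by
  moments.\<close>

definition \<rho> :: "real measure" where "\<rho> = density \<nu> (\<lambda>u. ennreal u)"

lemma integral_\<rho>:
  fixes f :: "real \<Rightarrow> real"
  assumes "f \<in> borel_measurable borel"
  shows "(\<integral>u. f u \<partial>\<rho>) = (\<integral>u. u * f u \<partial>\<nu>)"
  unfolding \<rho>_def
  using assms by (subst integral_density) (auto intro!: measurable_\<nu> AE_I2 simp: space_\<nu>)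

lemma finite_\<rho>: "finite_measure \<rho>"
proof
  have "emeasure \<rho> (space \<rho>) = (\<integral>\<^sup>+u. ennreal u \<partial>\<nu>)"
    unfolding \<rho>_def
    by (subst emeasure_density) (auto intro!: measurable_\<nu> nn_integral_cong simp: indicator_def)
  also have "\<dots> = ennreal (\<integral>u. u \<partial>\<nu>)"
    using integrable_\<nu>(1) by (intro nn_integral_eq_integral) (auto simp: space_\<nu> intro!: AE_I2)
  finally show "emeasure \<rho> (space \<rho>) \<noteq> \<infinity>" by simp
qed

lemma measure_\<rho>: "measure \<rho> (space \<rho>) = \<nu>_mean"
  using integral_\<rho>[of "\<lambda>_. 1"] by (simp add: \<nu>_mean_def)

lemma AE_\<rho>: "AE u in \<rho>. 0 < u"
  unfolding \<rho>_def by (subst AE_density) (auto intro!: measurable_\<nu> AE_I2 simp: space_\<nu>)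

lemma measurable_\<rho>: "f \<in> borel_measurable borel \<Longrightarrow> f \<in> borel_measurable \<rho>"
  unfolding \<rho>_def measurable_density_eq1 by (rule measurable_\<nu>)

lemma measurable_fst_\<rho> [measurable]: "fst \<in> borel_measurable (\<rho> \<Otimes>\<^sub>M N)"
  by (rule measurable_compose[OF measurable_fst measurable_\<rho>]) simp

text \<open>For \<open>h(s) = s\<^sup>k\<close> this is the derivative of the Laplace transform at \<open>k\<close>.\<close>

lemma size_bias:
  fixes h :: "real \<Rightarrow> real"
  assumes h: "continuous_on {0..1} h" and [measurable]: "h \<in> borel_measurable borel"
  shows "(\<integral>\<omega>. A 1 \<omega> * h (exp (- A 1 \<omega>)) \<partial>M)
    = (\<integral>z. h (exp (- (fst z + A 1 (snd z)))) \<partial>(\<rho> \<Otimes>\<^sub>M M))"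
proof -
  interpret \<rho>: finite_measure \<rho> by (rule finite_\<rho>)
  interpret PP: pair_sigma_finite \<rho> M ..
  \<comment> \<open>The substitution \<open>exp (- a)\<close> maps the half line into
    \<open>[0, 1]\<close>. Both sides become integrals of \<open>h\<close> against finite measures,
    whose moments are Laplace transforms at integers.\<close>
  let ?N1 = "density M (\<lambda>\<omega>. ennreal (A 1 \<omega>))"
  have [measurable]: "A 1 \<in> borel_measurable M" by (rule A_measurable) simp
  have dens: "(\<integral>\<omega>. f \<omega> \<partial>?N1) = (\<integral>\<omega>. A 1 \<omega> * f \<omega> \<partial>M)"
    if [measurable]: "f \<in> borel_measurable M" for f :: "'a \<Rightarrow> real"
    using AE_A1 by (subst integral_density) auto
  have fin1: "finite_measure ?N1"
  proof
    have "emeasure ?N1 (space ?N1) = (\<integral>\<^sup>+\<omega>. ennreal (A 1 \<omega>) \<partial>M)"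
      by (subst emeasure_density) (auto intro!: nn_integral_cong simp: indicator_def)
    also have "\<dots> = ennreal (\<integral>\<omega>. A 1 \<omega> \<partial>M)"
      using integrable_A1 AE_A1 by (rule nn_integral_eq_integral)
    finally show "emeasure ?N1 (space ?N1) \<noteq> \<infinity>" by simp
  qed
  have fin2: "finite_measure (\<rho> \<Otimes>\<^sub>M M)"
    by (rule finite_measure_pair_measure) unfold_locales
  have AE2: "AE z in \<rho> \<Otimes>\<^sub>M M. 0 < fst z \<and> 0 \<le> A 1 (snd z)"
  proof (rule PP.AE_pair_measure)
    show "AE u in \<rho>. AE \<omega> in M. 0 < fst (u, \<omega>) \<and> 0 \<le> A 1 (snd (u, \<omega>))"
      using AE_\<rho> by eventually_elim (use AE_A1 in auto)
  qed measurable
  have "(\<integral>\<omega>. h (exp (- A 1 \<omega>)) \<partial>?N1) = (\<integral>z. h (exp (- (fst z + A 1 (snd z)))) \<partial>(\<rho> \<Otimes>\<^sub>M M))"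
  proof (rule integral_eq_of_moments_eq[OF fin1 fin2 _ _ _ _ _ h])
    show "AE \<omega> in ?N1. exp (- A 1 \<omega>) \<in> {0..1}"
      using AE_A1 by (subst AE_density) auto
    show "AE z in \<rho> \<Otimes>\<^sub>M M. exp (- (fst z + A 1 (snd z))) \<in> {0..1}"
      using AE2 by eventually_elim auto
    show "(\<integral>\<omega>. exp (- A 1 \<omega>) ^ k \<partial>?N1) = (\<integral>z. exp (- (fst z + A 1 (snd z))) ^ k \<partial>(\<rho> \<Otimes>\<^sub>M M))" for k
    proof -
      have pow: "exp (- x) ^ k = exp (- (real k * x))" for x :: real
        by (simp flip: exp_of_nat_mult)
      have "(\<integral>\<omega>. exp (- A 1 \<omega>) ^ k \<partial>?N1) = (\<integral>\<omega>. A 1 \<omega> * exp (- (real k * A 1 \<omega>)) \<partial>M)"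
        by (simp add: dens pow)
      also have "\<dots> = exp (\<psi> k) * (\<integral>u. u * exp (- (real k * u)) \<partial>\<nu>)"
        by (rule expectation_A1_exp) simp
      also have "\<dots> = (\<integral>u. exp (- (real k * u)) * exp (\<psi> k) \<partial>\<rho>)"
        by (simp add: integral_\<rho> mult.commute)
      also have "\<dots> = (\<integral>u. \<integral>\<omega>. exp (- (real k * (u + A 1 \<omega>))) \<partial>M \<partial>\<rho>)"
      proof (intro Bochner_Integration.integral_cong refl)
        fix u
        have "(\<integral>\<omega>. exp (- (real k * (u + A 1 \<omega>))) \<partial>M) = (\<integral>\<omega>. exp (- (real k * u)) * exp (- (real k * A 1 \<omega>)) \<partial>M)"
          by (simp add: distrib_left flip: exp_add)
        also have "\<dots> = exp (- (real k * u)) * exp (\<psi> k)"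
          by (simp add: laplace)
        finally show "exp (- (real k * u)) * exp (\<psi> k) = (\<integral>\<omega>. exp (- (real k * (u + A 1 \<omega>))) \<partial>M)" ..
      qed
      also have "\<dots> = (\<integral>z. exp (- (real k * (fst z + A 1 (snd z)))) \<partial>(\<rho> \<Otimes>\<^sub>M M))"
      proof -
        have "AE z in \<rho> \<Otimes>\<^sub>M M. norm (exp (- (real k * (fst z + A 1 (snd z))))) \<le> 1"
          using AE2 by eventually_elim auto
        then have "integrable (\<rho> \<Otimes>\<^sub>M M) (\<lambda>z. exp (- (real k * (fst z + A 1 (snd z)))))"
          by (intro finite_measure.integrable_const_bound[OF fin2, where B = 1]) measurable
        from PP.integral_fst'[OF this] show ?thesis by simp
      qed
      also have "\<dots> = (\<integral>z. exp (- (fst z + A 1 (snd z))) ^ k \<partial>(\<rho> \<Otimes>\<^sub>M M))"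
        by (simp only: pow)
      finally show ?thesis .
    qed
  qed measurable
  then show ?thesis by (simp add: dens)
qed

lemma size_bias_truncated:
  assumes q: "0 < q" and N: "0 < N"
  shows "(\<integral>\<omega>. A 1 \<omega> * min (A 1 \<omega>) N powr q \<partial>M)
    = (\<integral>u. \<integral>\<omega>. min (u + A 1 \<omega>) N powr q \<partial>M \<partial>\<rho>)"
proof -
  interpret \<rho>: finite_measure \<rho> by (rule finite_\<rho>)
  interpret PP: pair_sigma_finite \<rho> M ..
  have [measurable]: "A 1 \<in> borel_measurable M" by (rule A_measurable) simp
  \<comment> \<open>\<open>- ln s\<close> undoes the substitution; the cut at
    \<open>exp (- N)\<close> truncates at level \<open>N\<close> and keeps \<open>h\<close>
    continuous at \<open>0\<close>.\<close>
  define h where "h s = (- ln (max s (exp (- N)))) powr q" for s :: real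
  have h: "h (exp (- a)) = min a N powr q" for a
  proof -
    have "max (exp (- a)) (exp (- N)) = exp (- min a N)" by (auto simp: max_def min_def)
    then show ?thesis by (simp add: h_def)
  qed
  have max_pos: "0 < max s (exp (- N))" for s by (simp add: less_max_iff_disj)
  have "continuous_on {0..1} h"
    unfolding h_def
  proof (intro continuous_on_powr' continuous_intros ballI)
    fix s :: real assume s: "s \<in> {0..1}"
    have "ln (max s (exp (- N))) \<le> 0"
      using s max_pos[of s] N by (subst ln_le_zero_iff) auto
    then show "0 \<le> - ln (max s (exp (- N))) \<and> (- ln (max s (exp (- N))) = 0 \<longrightarrow> 0 < q)" using q by simp
    show "max s (exp (- N)) \<noteq> 0" using max_pos[of s] by simp
  qed
  moreover have "h \<in> borel_measurable borel" unfolding h_def by measurable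
  ultimately have "(\<integral>\<omega>. A 1 \<omega> * min (A 1 \<omega>) N powr q \<partial>M)
      = (\<integral>z. min (fst z + A 1 (snd z)) N powr q \<partial>(\<rho> \<Otimes>\<^sub>M M))"
    using size_bias[of h] unfolding h by simp
  also have "\<dots> = (\<integral>u. \<integral>\<omega>. min (u + A 1 \<omega>) N powr q \<partial>M \<partial>\<rho>)"
  proof -
    have fin2: "finite_measure (\<rho> \<Otimes>\<^sub>M M)"
      by (rule finite_measure_pair_measure) unfold_locales
    have "AE z in \<rho> \<Otimes>\<^sub>M M. 0 < fst z \<and> 0 \<le> A 1 (snd z)"
    proof (rule PP.AE_pair_measure)
      show "AE u in \<rho>. AE \<omega> in M. 0 < fst (u, \<omega>) \<and> 0 \<le> A 1 (snd (u, \<omega>))"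
        using AE_\<rho> by eventually_elim (use AE_A1 in auto)
    qed measurable
    then have "AE z in \<rho> \<Otimes>\<^sub>M M. norm (min (fst z + A 1 (snd z)) N powr q) \<le> N powr q"
      by eventually_elim (use N q in \<open>auto intro!: powr_mono2\<close>)
    then have "integrable (\<rho> \<Otimes>\<^sub>M M) (\<lambda>z. min (fst z + A 1 (snd z)) N powr q)"
      by (intro finite_measure.integrable_const_bound[OF fin2, where B = "N powr q"]) measurable
    from PP.integral_fst'[OF this] show ?thesis by simp
  qed
  finally show ?thesis .
qed

text \<open>Size biasing bounds the expectation \<open>I\<close> by an affine function of
  \<open>b\<close>, the truncated moment of order \<open>q = p - 1\<close>, and splitting at
  \<open>K\<close> gives \<open>b \<le> I / K + K powr q\<close>. For large \<open>K\<close> the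
  term with \<open>I\<close> is absorbed into the left side; this is legitimate because truncation
  makes \<open>I\<close> finite.\<close>

lemma truncated_moment_le:
  assumes p1: "1 < p"
  shows "\<exists>R. \<forall>N>0. (\<integral>\<omega>. A 1 \<omega> * min (A 1 \<omega>) N powr (p - 1) \<partial>M) \<le> R"
proof -
  interpret \<rho>: finite_measure \<rho> by (rule finite_\<rho>)
  have [measurable]: "A 1 \<in> borel_measurable M" by (rule A_measurable) simp
  define q where "q = p - 1"
  have q: "0 < q" using p1 by (simp add: q_def)
  define S where "S = (\<integral>u. u powr q \<partial>\<rho>)"
  define c where "c = (2::real) powr q"
  \<comment> \<open>Chosen such that \<open>c * \<nu>_mean / K \<le> 1 / 2\<close>; then
    \<open>I \<le> I / 2 + R / 2\<close> with \<open>R\<close> independent of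
    \<open>N\<close>.\<close>
  define K where "K = 2 * c * \<nu>_mean + 1"
  define R where "R = 2 * c * (\<nu>_mean * K powr q + S)"
  have c: "0 < c" by (simp add: c_def)
  have K: "0 < K" using c \<nu>_mean_nonneg by (simp add: K_def add_nonneg_pos)
  have int_S: "integrable \<rho> (\<lambda>u. u powr q)"
  proof -
    have "integrable \<nu> (\<lambda>u. u * u powr q)"
      using integrable_\<nu>(2) by (rule integrable_cong_AE_imp)
        (auto intro!: measurable_\<nu> AE_I2 simp: space_\<nu> q_def powr_diff)
    then show ?thesis unfolding \<rho>_def
      by (subst integrable_density) (auto intro!: measurable_\<nu> AE_I2 simp: space_\<nu>)
  qed
  have "(\<integral>\<omega>. A 1 \<omega> * min (A 1 \<omega>) N powr q \<partial>M) \<le> R" if N: "0 < N" for N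
  proof -
    define I where "I = (\<integral>\<omega>. A 1 \<omega> * min (A 1 \<omega>) N powr q \<partial>M)"
    define b where "b = (\<integral>\<omega>. min (A 1 \<omega>) N powr q \<partial>M)"
    have bound: "AE \<omega> in M. norm (min (u + A 1 \<omega>) N powr q) \<le> N powr q" if "0 \<le> u" for u
      using AE_A1 by eventually_elim (use N q that in \<open>auto intro!: powr_mono2\<close>)
    have int: "integrable M (\<lambda>\<omega>. min (u + A 1 \<omega>) N powr q)" if "0 \<le> u" for u
      using bound[OF that] by (rule integrable_const_bound) measurable
    have intb: "integrable M (\<lambda>\<omega>. min (A 1 \<omega>) N powr q)" using int[of 0] by simp
    have intI: "integrable M (\<lambda>\<omega>. A 1 \<omega> * min (A 1 \<omega>) N powr q)"
    proof (rule Bochner_Integration.integrable_bound)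
      show "integrable M (\<lambda>\<omega>. A 1 \<omega> * N powr q)" using integrable_A1 by simp
      show "AE \<omega> in M. norm (A 1 \<omega> * min (A 1 \<omega>) N powr q) \<le> norm (A 1 \<omega> * N powr q)"
        using AE_A1 bound[OF order_refl] by eventually_elim (auto simp: abs_mult intro!: mult_left_mono)
    qed measurable
    have "b \<le> (\<integral>\<omega>. A 1 \<omega> * min (A 1 \<omega>) N powr q / K + K powr q \<partial>M)"
      unfolding b_def
    proof (rule integral_mono_AE)
      show "AE \<omega> in M. min (A 1 \<omega>) N powr q \<le> A 1 \<omega> * min (A 1 \<omega>) N powr q / K + K powr q"
        using AE_A1
      proof eventually_elim
        case (elim \<omega>)
        show ?case
        proof (cases "A 1 \<omega> \<le> K")
          case True
          then have "min (A 1 \<omega>) N powr q \<le> K powr q" using elim N q by (intro powr_mono2) auto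
          moreover have "0 \<le> A 1 \<omega> * min (A 1 \<omega>) N powr q / K" using elim K by simp
          ultimately show ?thesis by simp
        next
          case False
          then have "1 * min (A 1 \<omega>) N powr q \<le> A 1 \<omega> / K * min (A 1 \<omega>) N powr q"
            using K by (intro mult_right_mono) auto
          then show ?thesis by (simp add: add_increasing2)
        qed
      qed
    qed (use intb intI in auto)
    also have "\<dots> = I / K + K powr q"
      using intI by (simp add: I_def prob_space)
    finally have b: "b \<le> I / K + K powr q" .
    have "I = (\<integral>u. \<integral>\<omega>. min (u + A 1 \<omega>) N powr q \<partial>M \<partial>\<rho>)"
      unfolding I_def using q N by (rule size_bias_truncated)
    also have "\<dots> \<le> (\<integral>u. c * (b + u powr q) \<partial>\<rho>)"
    proof (rule integral_mono_AE)
      have [measurable]: "(\<lambda>z. z) \<in> borel_measurable \<rho>" by (intro measurable_\<rho>) simp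
      show "integrable \<rho> (\<lambda>u. \<integral>\<omega>. min (u + A 1 \<omega>) N powr q \<partial>M)"
      proof (rule \<rho>.integrable_const_bound[where B = "N powr q"])
        show "AE u in \<rho>. norm (\<integral>\<omega>. min (u + A 1 \<omega>) N powr q \<partial>M) \<le> N powr q"
          using AE_\<rho>
        proof eventually_elim
          case (elim u)
          then have "0 \<le> u" by simp
          have "norm (\<integral>\<omega>. min (u + A 1 \<omega>) N powr q \<partial>M) \<le> (\<integral>\<omega>. norm (min (u + A 1 \<omega>) N powr q) \<partial>M)"
            by (rule integral_norm_bound)
          also have "\<dots> \<le> (\<integral>\<omega>. N powr q \<partial>M)"
            using int[OF \<open>0 \<le> u\<close>] bound[OF \<open>0 \<le> u\<close>] by (intro integral_mono_AE integrable_norm) auto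
          finally have "norm (\<integral>\<omega>. min (u + A 1 \<omega>) N powr q \<partial>M) \<le> (\<integral>\<omega>. N powr q \<partial>M)" .
          then show ?case by (simp add: prob_space)
        qed
      qed measurable
      show "integrable \<rho> (\<lambda>u. c * (b + u powr q))" using int_S by simp
      show "AE u in \<rho>. (\<integral>\<omega>. min (u + A 1 \<omega>) N powr q \<partial>M) \<le> c * (b + u powr q)"
        using AE_\<rho>
      proof eventually_elim
        case (elim u)
        then have u: "0 \<le> u" by simp
        have "(\<integral>\<omega>. min (u + A 1 \<omega>) N powr q \<partial>M) \<le> (\<integral>\<omega>. c * (min (A 1 \<omega>) N powr q + u powr q) \<partial>M)"
        proof (rule integral_mono_AE)
          show "AE \<omega> in M. min (u + A 1 \<omega>) N powr q \<le> c * (min (A 1 \<omega>) N powr q + u powr q)"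
            using AE_A1
          proof eventually_elim
            case (elim \<omega>)
            have "min (u + A 1 \<omega>) N powr q \<le> (min (A 1 \<omega>) N + u) powr q"
              using elim u N q by (intro powr_mono2) auto
            also have "\<dots> \<le> c * (min (A 1 \<omega>) N powr q + u powr q)"
              unfolding c_def using elim u N q by (intro powr_add_le) auto
            finally show ?case .
          qed
        qed (use int[OF u] intb in auto)
        also have "\<dots> = c * (b + u powr q)" using intb by (simp add: b_def prob_space)
        finally show ?case .
      qed
    qed
    also have "\<dots> = c * (b * \<nu>_mean + S)"
      using int_S by (simp add: S_def measure_\<rho>)
    also have "\<dots> \<le> c * ((I / K + K powr q) * \<nu>_mean + S)"
      using b c \<nu>_mean_nonneg by (intro mult_left_mono add_right_mono mult_right_mono) auto
    also have "\<dots> = I * (c * \<nu>_mean / K) + R / 2"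
      by (simp add: R_def algebra_simps)
    also have "\<dots> \<le> I * (1 / 2) + R / 2"
    proof -
      have "0 \<le> I" unfolding I_def
      proof (rule integral_nonneg_AE)
        show "AE \<omega> in M. 0 \<le> A 1 \<omega> * min (A 1 \<omega>) N powr q"
          using AE_A1 by eventually_elim simp
      qed
      moreover have "c * \<nu>_mean / K \<le> 1 / 2"
        using K by (simp add: K_def field_simps)
      ultimately show ?thesis by (intro add_right_mono mult_left_mono) auto
    qed
    finally show ?thesis unfolding I_def by simp
  qed
  then show ?thesis unfolding q_def by auto
qed

lemma A1_moment_finite: "(\<integral>\<^sup>+\<omega>. ennreal (A 1 \<omega> powr p) \<partial>M) < \<infinity>"
proof (cases "p = 1")
  \<comment> \<open>The exponent \<open>p - 1\<close> vanishes, and integrability of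
    \<open>A 1\<close> is enough.\<close>
  case True
  have "(\<integral>\<^sup>+\<omega>. ennreal (A 1 \<omega> powr p) \<partial>M) = (\<integral>\<^sup>+\<omega>. ennreal (A 1 \<omega>) \<partial>M)"
    using AE_A1 by (intro nn_integral_cong_AE) (auto simp: True)
  also have "\<dots> = ennreal (\<integral>\<omega>. A 1 \<omega> \<partial>M)"
    using integrable_A1 AE_A1 by (rule nn_integral_eq_integral)
  finally show ?thesis by simp
next
  case False
  have [measurable]: "A 1 \<in> borel_measurable M" by (rule A_measurable) simp
  obtain R where R: "\<And>N. 0 < N \<Longrightarrow> (\<integral>\<omega>. A 1 \<omega> * min (A 1 \<omega>) N powr (p - 1) \<partial>M) \<le> R"
    using truncated_moment_le False p by auto
  have "(\<integral>\<^sup>+\<omega>. ennreal (A 1 \<omega> powr p) \<partial>M) \<le> ennreal R"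
  proof (rule nn_integral_le_of_tendsto)
    show "(\<lambda>\<omega>. A 1 \<omega> * min (A 1 \<omega>) (real (Suc n)) powr (p - 1)) \<in> borel_measurable M" for n
      by measurable
    show "AE \<omega> in M. (\<lambda>n. A 1 \<omega> * min (A 1 \<omega>) (real (Suc n)) powr (p - 1)) \<longlonglongrightarrow> A 1 \<omega> powr p"
      using AE_A1
    proof eventually_elim
      case (elim \<omega>)
      obtain m where m: "A 1 \<omega> \<le> real m" using real_arch_simple by blast
      have "A 1 \<omega> * min (A 1 \<omega>) (real (Suc n)) powr (p - 1) = A 1 \<omega> powr p" if "m \<le> n" for n
      proof -
        have "min (A 1 \<omega>) (real (Suc n)) = A 1 \<omega>" using m that by simp
        moreover have "A 1 \<omega> * A 1 \<omega> powr (p - 1) = A 1 \<omega> powr p"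
          using elim p by (cases "A 1 \<omega> = 0") (auto simp: powr_diff)
        ultimately show ?thesis by simp
      qed
      then show ?case by (intro tendsto_eventually eventually_sequentiallyI[of m]) auto
    qed
    show "(\<integral>\<^sup>+\<omega>. ennreal (A 1 \<omega> * min (A 1 \<omega>) (real (Suc n)) powr (p - 1)) \<partial>M) \<le> ennreal R" for n
    proof -
      have "integrable M (\<lambda>\<omega>. A 1 \<omega> * min (A 1 \<omega>) (real (Suc n)) powr (p - 1))"
      proof (rule Bochner_Integration.integrable_bound)
        show "integrable M (\<lambda>\<omega>. A 1 \<omega> * real (Suc n) powr (p - 1))" using integrable_A1 by simp
        show "AE \<omega> in M. norm (A 1 \<omega> * min (A 1 \<omega>) (real (Suc n)) powr (p - 1)) \<le> norm (A 1 \<omega> * real (Suc n) powr (p - 1))"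
          using AE_A1 by eventually_elim (use p in \<open>auto simp: abs_mult simp del: of_nat_Suc intro!: mult_left_mono powr_mono2\<close>)
      qed measurable
      moreover have "AE \<omega> in M. 0 \<le> A 1 \<omega> * min (A 1 \<omega>) (real (Suc n)) powr (p - 1)"
        using AE_A1 by eventually_elim simp
      ultimately show ?thesis
        using R[of "real (Suc n)"] by (subst nn_integral_eq_integral) (auto intro: ennreal_leI)
    qed
  qed
  then show ?thesis by (simp add: le_less_trans)
qed

end

section \<open>The Markov semigroup\<close>

lemma (in monotone_release) resolvent_measurable [measurable]:
  "0 < h \<Longrightarrow> resolvent h \<in> borel_measurable borel"
  by (intro borel_measurable_mono monoI resolvent_mono)

text \<open>Complements the contraction bound, which does not vanish as the starting points approach
  each other.\<close>

lemma (in dissipative_release) storage_path_lipschitz: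
  assumes \<xi>: "storage_path r a x \<xi>" and \<eta>: "storage_path r a y \<eta>" and t: "0 \<le> t"
  shows "\<bar>\<eta> t - \<xi> t\<bar> \<le> \<bar>\<eta> 0 - \<xi> 0\<bar>"
proof -
  have *: "\<eta> t - \<xi> t \<le> \<eta> 0 - \<xi> 0 \<and> \<xi> t \<le> \<eta> t"
    if \<xi>: "storage_path r a x \<xi>" and \<eta>: "storage_path r a y \<eta>" and le: "\<xi> 0 \<le> \<eta> 0"
    for x \<xi> y \<eta>
  proof -
    have ord: "\<xi> t \<le> \<eta> t" using storage_path_order[OF \<xi> \<eta> le t] .
    then have "0 \<le> \<Gamma> * (t - 0) * \<beta> (\<eta> t - \<xi> t)"
      using \<Gamma> t nonneg[of "\<eta> t - \<xi> t"] by (intro mult_nonneg_nonneg) auto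
    then show ?thesis using ord storage_path_decay[OF \<xi> \<eta> le order_refl t] by linarith
  qed
  show ?thesis
  proof (cases "\<xi> 0 \<le> \<eta> 0")
    case True
    then show ?thesis using *[OF \<xi> \<eta>] by simp
  next
    case False
    then show ?thesis using *[OF \<eta> \<xi>] by simp
  qed
qed

lemma space_half_line [simp]: "space half_line = {0..}"
  by (simp add: space_restrict_space)

lemma measurable_half_line_borel [measurable (raw)]:
  "f \<in> measurable M half_line \<Longrightarrow> f \<in> borel_measurable M"
  by (simp add: measurable_restrict_space2_iff)

lemma borel_measurable_half_line: "f \<in> borel_measurable borel \<Longrightarrow> f \<in> borel_measurable half_line"
  by (rule measurable_restrict_space1)

locale storage =
  subordinator_moment M F \<nu> A p + dissipative_release r \<beta> \<Gamma>
  for M :: "'a measure" and F \<nu> A p r \<beta> \<Gamma> +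
  fixes X :: "real \<Rightarrow> real \<Rightarrow> 'a \<Rightarrow> real"
  assumes storage: "storage_process M F A r X"
begin

lemma X_measurable_F: "0 \<le> x \<Longrightarrow> 0 \<le> t \<Longrightarrow> X x t \<in> measurable (F t) half_line"
  using storage unfolding storage_process_def by blast

lemma X_measurable_half_line: "0 \<le> x \<Longrightarrow> 0 \<le> t \<Longrightarrow> X x t \<in> measurable M half_line"
  by (rule measurable_F[OF _ X_measurable_F])

lemma X_measurable [measurable]: "0 \<le> x \<Longrightarrow> 0 \<le> t \<Longrightarrow> X x t \<in> borel_measurable M"
  by (rule measurable_half_line_borel[OF X_measurable_half_line])

lemma X_nonneg: "0 \<le> x \<Longrightarrow> 0 \<le> t \<Longrightarrow> \<omega> \<in> space M \<Longrightarrow> 0 \<le> X x t \<omega>"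
  using measurable_space[OF X_measurable_half_line] by fastforce

text \<open>The exceptional set depends on \<open>x\<close>; integration over the starting point
  therefore passes through \<open>flow\<close>.\<close>

lemma AE_storage_path:
  assumes "0 \<le> x"
  shows "AE \<omega> in M. storage_path r (\<lambda>t. A t \<omega>) x (\<lambda>t. X x t \<omega>) \<and> X x 0 \<omega> = x"
proof -
  have "AE \<omega> in M. cadlag (\<lambda>t. X x t \<omega>) \<and>
           (\<forall>t\<ge>0. set_integrable lborel {0..t} (\<lambda>s. r (X x s \<omega>)) \<and>
              X x t \<omega> = x + A t \<omega> - (LBINT s:{0..t}. r (X x s \<omega>)))"
    using storage assms unfolding storage_process_def by blast
  then show ?thesis
    using AE_space AE_A_path
  proof eventually_elim
    case (elim \<omega>)
    have sp: "storage_path r (\<lambda>t. A t \<omega>) x (\<lambda>t. X x t \<omega>)"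
      unfolding storage_path_def
    proof (intro allI impI conjI)
      fix t :: real assume t: "0 \<le> t"
      show "0 \<le> X x t \<omega>" using X_nonneg assms t elim(2) by blast
      have int: "set_integrable lborel {0..t} (\<lambda>s. r (X x s \<omega>))" using elim(1) t by blast
      show "(\<lambda>s. r (X x s \<omega>)) integrable_on {0..t}"
        using set_borel_integral_eq_integral(1)[OF int] .
      show "X x t \<omega> = x + A t \<omega> - integral {0..t} (\<lambda>s. r (X x s \<omega>))"
        using set_borel_integral_eq_integral(2)[OF int] elim(1) t by metis
    qed
    moreover have "X x 0 \<omega> = x + A 0 \<omega> - integral {0..0} (\<lambda>s. r (X x s \<omega>))"
      using sp unfolding storage_path_def by blast
    ultimately show ?case using elim(3) by simp
  qed
qed

text \<open>Transition operator of one Euler step: \<open>A h\<close> has the law of every increment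
  over a step of length \<open>h\<close>.\<close>

definition euler_kernel :: "real \<Rightarrow> (real \<Rightarrow> real) \<Rightarrow> real \<Rightarrow> real" where
  "euler_kernel h f y = (\<integral>\<omega>. f (resolvent h y + A h \<omega>) \<partial>M)"

lemma euler_kernel_measurable:
  assumes "0 < h" and [measurable]: "f \<in> borel_measurable borel"
  shows "euler_kernel h f \<in> borel_measurable borel"
proof -
  have [measurable]: "A h \<in> borel_measurable M" "resolvent h \<in> borel_measurable borel"
    using assms(1) by (auto intro: A_measurable resolvent_measurable)
  show ?thesis unfolding euler_kernel_def[abs_def] by measurable
qed

text \<open>A function that is not integrable has integral \<open>0\<close>, and
  \<open>0 \<le> B\<close>.\<close>

lemma abs_expectation_le:
  fixes f :: "'a \<Rightarrow> real"
  assumes "\<And>\<omega>. \<bar>f \<omega>\<bar> \<le> B"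
  shows "\<bar>\<integral>\<omega>. f \<omega> \<partial>M\<bar> \<le> B"
proof -
  have "0 \<le> B" using assms[of undefined] by (rule order_trans[OF abs_ge_zero])
  show ?thesis
  proof (cases "integrable M f")
    case True
    have "\<bar>\<integral>\<omega>. f \<omega> \<partial>M\<bar> \<le> (\<integral>\<omega>. \<bar>f \<omega>\<bar> \<partial>M)" by (rule integral_abs_bound)
    also have "\<dots> \<le> (\<integral>\<omega>. B \<partial>M)" using True assms by (intro integral_mono) auto
    finally show ?thesis by (simp add: prob_space)
  qed (use \<open>0 \<le> B\<close> in \<open>simp add: not_integrable_integral_eq\<close>)
qed

lemma euler_kernel_funpow:
  assumes "0 < h" "f \<in> borel_measurable borel" "\<And>y. \<bar>f y\<bar> \<le> B"
  shows "(euler_kernel h ^^ k) f \<in> borel_measurable borel \<and> (\<forall>y. \<bar>(euler_kernel h ^^ k) f y\<bar> \<le> B)"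
proof (induction k)
  case (Suc k)
  let ?g = "(euler_kernel h ^^ k) f"
  have "\<bar>euler_kernel h ?g y\<bar> \<le> B" for y
    unfolding euler_kernel_def[of h ?g] by (rule abs_expectation_le) (use Suc in blast)
  then show ?case
    using euler_kernel_measurable[OF assms(1), of ?g] Suc by simp
qed (use assms in auto)

lemma euler_measurable:
  assumes s: "0 \<le> s" and h: "0 < h" and \<xi>: "\<xi> \<in> borel_measurable (F s)"
  shows "(\<lambda>\<omega>. euler h (\<lambda>t. A t \<omega>) s (\<xi> \<omega>) k) \<in> borel_measurable (F (s + real k * h))"
proof (induction k)
  case (Suc k)
  let ?s = "s + real k * h" and ?t = "s + real (Suc k) * h"
  have st: "0 \<le> ?s" "?s \<le> ?t" using s h by (auto simp: algebra_simps)
  note [measurable] = measurable_F_mono[OF st Suc] measurable_F_mono[OF st A_measurable_F[OF st(1)]]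
    A_measurable_F[OF order_trans[OF st]] resolvent_measurable[OF h]
  show ?case unfolding euler.simps by measurable
qed (use \<xi> in simp)

text \<open>The last step is removed first: its increment is independent of the past, so
  \<open>integral_increment\<close> turns \<open>f\<close> into \<open>euler_kernel h f\<close>.
  Hence the induction with \<open>f\<close> arbitrary.\<close>

lemma expectation_euler:
  assumes s: "0 \<le> s" and h: "0 < h" and \<xi>: "\<xi> \<in> borel_measurable (F s)"
    and "f \<in> borel_measurable borel" "\<And>y. \<bar>f y\<bar> \<le> B"
  shows "(\<integral>\<omega>. f (euler h (\<lambda>t. A t \<omega>) s (\<xi> \<omega>) k) \<partial>M) = (\<integral>\<omega>. (euler_kernel h ^^ k) f (\<xi> \<omega>) \<partial>M)"
  using assms(4,5)
proof (induction k arbitrary: f)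
  case (Suc k)
  let ?s = "s + real k * h"
  have eq: "s + real (Suc k) * h = ?s + h" by (simp add: algebra_simps)
  note [measurable] = Suc.prems(1) resolvent_measurable[OF h]
  have "(\<integral>\<omega>. f (euler h (\<lambda>t. A t \<omega>) s (\<xi> \<omega>) (Suc k)) \<partial>M)
      = (\<integral>\<omega>. (\<lambda>y z. f (resolvent h y + z)) (euler h (\<lambda>t. A t \<omega>) s (\<xi> \<omega>) k) (A (?s + h) \<omega> - A ?s \<omega>) \<partial>M)"
    by (simp only: euler.simps eq)
  also have "\<dots> = (\<integral>\<omega>. (\<integral>\<omega>'. f (resolvent h (euler h (\<lambda>t. A t \<omega>) s (\<xi> \<omega>) k) + A h \<omega>') \<partial>M) \<partial>M)"
    using s h Suc.prems(2) by (intro integral_increment euler_measurable \<xi>) auto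
  also have "\<dots> = (\<integral>\<omega>. euler_kernel h f (euler h (\<lambda>t. A t \<omega>) s (\<xi> \<omega>) k) \<partial>M)"
    by (simp add: euler_kernel_def)
  also have "\<dots> = (\<integral>\<omega>. (euler_kernel h ^^ k) (euler_kernel h f) (\<xi> \<omega>) \<partial>M)"
    using euler_kernel_funpow[OF h Suc.prems, of 1] by (intro Suc.IH) auto
  finally show ?case by (simp add: funpow_swap1)
qed simp

text \<open>The operators on the left involve neither \<open>x\<close> nor \<open>s\<close>; they
  meet the process only through the state at time \<open>s\<close>.\<close>

lemma expectation_X_limit:
  assumes x: "0 \<le> x" and s: "0 \<le> s" and t: "0 < t"
    and f: "continuous_on UNIV f" "\<And>y. \<bar>f y\<bar> \<le> B"
  shows "(\<lambda>n. \<integral>\<omega>. (euler_kernel (t / real (Suc n)) ^^ Suc n) f (X x s \<omega>) \<partial>M)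
    \<longlonglongrightarrow> (\<integral>\<omega>. f (X x (s + t) \<omega>) \<partial>M)"
proof -
  have [measurable]: "f \<in> borel_measurable borel" using f(1) by (rule borel_measurable_continuous_onI)
  have h: "0 < t / real (Suc n)" for n using t by simp
  have \<xi>: "X x s \<in> borel_measurable (F s)"
    by (rule measurable_half_line_borel[OF X_measurable_F[OF x s]])
  let ?e = "\<lambda>n \<omega>. euler (t / real (Suc n)) (\<lambda>t. A t \<omega>) s (X x s \<omega>) (Suc n)"
  have "(\<lambda>n. \<integral>\<omega>. f (?e n \<omega>) \<partial>M) \<longlonglongrightarrow> (\<integral>\<omega>. f (X x (s + t) \<omega>) \<partial>M)"
  proof (rule integral_dominated_convergence[where w = "\<lambda>_. B"])
    show "(\<lambda>\<omega>. f (X x (s + t) \<omega>)) \<in> borel_measurable M"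
      using X_measurable[of x "s + t"] x s t by simp
    show "(\<lambda>\<omega>. f (?e n \<omega>)) \<in> borel_measurable M" for n
    proof -
      have "0 \<le> s + real (Suc n) * (t / real (Suc n))" using s t by simp
      from measurable_F[OF this euler_measurable[OF s h \<xi>]] show ?thesis by (rule measurable_compose) simp
    qed
    show "AE \<omega> in M. (\<lambda>n. f (?e n \<omega>)) \<longlonglongrightarrow> f (X x (s + t) \<omega>)"
      using AE_storage_path[OF x] AE_A_path
    proof eventually_elim
      case (elim \<omega>)
      then have "(\<lambda>n. ?e n \<omega>) \<longlonglongrightarrow> X x (s + t) \<omega>"
        using euler_tendsto[of "\<lambda>t. A t \<omega>" x "\<lambda>t. X x t \<omega>" s t] s t by blast
      then show ?case
        using f(1) by (intro isCont_tendsto_compose[of _ f]) (auto simp: continuous_on_eq_continuous_at)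
    qed
  qed (use f in auto)
  then show ?thesis
    by (simp only: expectation_euler[OF s h \<xi> \<open>f \<in> borel_measurable borel\<close> f(2)])
qed

text \<open>A jointly measurable version of the flow \<open>(x, \<omega>) \<mapsto> X x t \<omega>\<close>, obtained by approximating \<open>x\<close>
  from above by rationals.\<close>

definition flow :: "real \<Rightarrow> real \<Rightarrow> 'a \<Rightarrow> real" where
  "flow t x \<omega> = max 0 (lim (\<lambda>n. X (real (nat \<lceil>real (Suc n) * x\<rceil>) / real (Suc n)) t \<omega>))"

lemma flow_measurable:
  assumes t: "0 \<le> t"
  shows "case_prod (flow t) \<in> measurable (half_line \<Otimes>\<^sub>M M) half_line"
proof -
  have "(\<lambda>z. X (real (nat \<lceil>real (Suc n) * fst z\<rceil>) / real (Suc n)) t (snd z))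
      \<in> borel_measurable (half_line \<Otimes>\<^sub>M M)" for n
  proof (rule measurable_compose_countable[where g = "\<lambda>z. nat \<lceil>real (Suc n) * fst z\<rceil>"])
    show "(\<lambda>z. X (real i / real (Suc n)) t (snd z)) \<in> borel_measurable (half_line \<Otimes>\<^sub>M M)" for i
      by (rule measurable_compose[OF measurable_snd X_measurable]) (use t in auto)
    have [measurable]: "fst \<in> borel_measurable (half_line \<Otimes>\<^sub>M M)"
      by (rule measurable_half_line_borel) simp
    show "(\<lambda>z. nat \<lceil>real (Suc n) * fst z\<rceil>) \<in> measurable (half_line \<Otimes>\<^sub>M M) (count_space UNIV)"
      by measurable
  qed
  then have "(\<lambda>z. lim (\<lambda>n. X (real (nat \<lceil>real (Suc n) * fst z\<rceil>) / real (Suc n)) t (snd z)))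
      \<in> borel_measurable (half_line \<Otimes>\<^sub>M M)"
    by (rule borel_measurable_lim_metric)
  \<comment> \<open>Where the sequence diverges, \<open>lim\<close> is arbitrary;
    \<open>max 0\<close> keeps the value in the half line everywhere.\<close>
  then show ?thesis
    by (subst measurable_restrict_space2_iff) (auto simp: flow_def case_prod_beta' simp del: of_nat_Suc)
qed

lemma AE_X_diff:
  assumes "0 \<le> x" "0 \<le> y" "0 \<le> t"
  shows "AE \<omega> in M. \<bar>X y t \<omega> - X x t \<omega>\<bar> \<le> \<bar>y - x\<bar> \<and>
    (\<forall>\<kappa>>0. \<bar>X y t \<omega> - X x t \<omega>\<bar> \<le> max 1 (\<bar>y - x\<bar> / \<kappa>) * B_inv \<beta> \<kappa> (\<Gamma> * t))"
  using AE_storage_path[OF assms(1)] AE_storage_path[OF assms(2)]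
proof eventually_elim
  case (elim \<omega>)
  then have x: "storage_path r (\<lambda>t. A t \<omega>) x (\<lambda>t. X x t \<omega>)" "X x 0 \<omega> = x"
    and y: "storage_path r (\<lambda>t. A t \<omega>) y (\<lambda>t. X y t \<omega>)" "X y 0 \<omega> = y" by auto
  show ?case
    using storage_path_lipschitz[OF x(1) y(1) assms(3)] storage_path_contraction[OF x(1) y(1) _ assms(3)]
    by (auto simp: x(2) y(2))
qed

text \<open>The grid points \<open>y n\<close> are countably many and share one null set; off it
  \<open>\<bar>y n - x\<bar>\<close> bounds the distance of the solutions and tends to
  \<open>0\<close>.\<close>

lemma AE_flow:
  assumes x: "0 \<le> x" and t: "0 \<le> t"
  shows "AE \<omega> in M. flow t x \<omega> = X x t \<omega>"
proof -
  define y where "y n = real (nat \<lceil>real (Suc n) * x\<rceil>) / real (Suc n)" for n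
  have y: "0 \<le> y n" "\<bar>y n - x\<bar> \<le> inverse (real (Suc n))" for n
  proof -
    have "0 \<le> real (Suc n) * x" using x by simp
    then have "real (Suc n) * x \<le> real (nat \<lceil>real (Suc n) * x\<rceil>)"
      "real (nat \<lceil>real (Suc n) * x\<rceil>) \<le> real (Suc n) * x + 1"
      by linarith+
    then have "x \<le> y n" "y n \<le> x + inverse (real (Suc n))"
      unfolding y_def by (simp_all add: field_simps del: of_nat_Suc)
    then show "\<bar>y n - x\<bar> \<le> inverse (real (Suc n))" by simp
  qed (simp add: y_def)
  have "AE \<omega> in M. \<forall>n. \<bar>X (y n) t \<omega> - X x t \<omega>\<bar> \<le> \<bar>y n - x\<bar>"
    unfolding AE_all_countable
  proof
    fix n show "AE \<omega> in M. \<bar>X (y n) t \<omega> - X x t \<omega>\<bar> \<le> \<bar>y n - x\<bar>"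
      using AE_X_diff[OF x y(1) t] by eventually_elim blast
  qed
  then show ?thesis
    using AE_space
  proof eventually_elim
    case (elim \<omega>)
    have "(\<lambda>n. X (y n) t \<omega> - X x t \<omega>) \<longlonglongrightarrow> 0"
    proof (rule Lim_null_comparison)
      show "\<forall>\<^sub>F n in sequentially. norm (X (y n) t \<omega> - X x t \<omega>) \<le> inverse (real (Suc n))"
        using elim y(2) by (intro always_eventually allI) (metis order_trans real_norm_def)
    qed (rule LIMSEQ_inverse_real_of_nat)
    then have "(\<lambda>n. X (y n) t \<omega>) \<longlonglongrightarrow> X x t \<omega>" by (rule LIM_zero_cancel)
    then have "lim (\<lambda>n. X (y n) t \<omega>) = X x t \<omega>" by (rule limI)
    then show ?case using X_nonneg[OF x t elim(2)] by (simp add: flow_def y_def del: of_nat_Suc)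
  qed
qed

lemma flow_measurable_snd: "0 \<le> x \<Longrightarrow> 0 \<le> t \<Longrightarrow> flow t x \<in> measurable M half_line"
  using measurable_Pair2[OF flow_measurable[of t], of x] by simp

lemma transition_eq: "0 \<le> x \<Longrightarrow> 0 \<le> t \<Longrightarrow> transition M X t x = distr M half_line (flow t x)"
  unfolding transition_def
  by (intro distr_cong_AE X_measurable_half_line flow_measurable_snd refl) (use AE_flow[of x t] in \<open>auto elim: AE_mp\<close>)

text \<open>Joint measurability of \<open>flow\<close> makes the transition laws a kernel, which is
  what gives \<open>\<bind>\<close> its meaning as a mixture.\<close>

lemma transition_measurable:
  assumes "0 \<le> t"
  shows "transition M X t \<in> measurable half_line (subprob_algebra half_line)"
proof -
  have "(\<lambda>x. distr M half_line (flow t x)) \<in> measurable half_line (subprob_algebra half_line)"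
    using flow_measurable[OF assms]
    by (rule measurable_distr2) (simp add: space_subprob_algebra prob_space_imp_subprob_space prob_space_axioms)
  then show ?thesis
    by (rule measurable_cong[THEN iffD1, rotated]) (use transition_eq assms in auto)
qed

text \<open>The mixture becomes the law of \<open>flow\<close> on a product space, where starting
  point and noise are independent; integrals and couplings are computed there.\<close>

lemma bind_transition:
  assumes "prob_space \<mu>" and sets: "sets \<mu> = sets half_line" and t: "0 \<le> t"
  shows "\<mu> \<bind> transition M X t = distr (\<mu> \<Otimes>\<^sub>M M) half_line (case_prod (flow t))"
proof -
  interpret \<mu>: prob_space \<mu> by fact
  have space: "space \<mu> = {0..}" using sets_eq_imp_space_eq[OF sets] by simp
  have mp: "measurable (\<mu> \<Otimes>\<^sub>M M) half_line = measurable (half_line \<Otimes>\<^sub>M M) half_line"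
    by (rule measurable_cong_sets[OF sets_pair_measure_cong[OF sets refl] refl])
  have fm: "case_prod (flow t) \<in> measurable (\<mu> \<Otimes>\<^sub>M M) half_line"
    unfolding mp using t by (rule flow_measurable)
  have tm: "transition M X t \<in> measurable \<mu> (subprob_algebra half_line)"
    using transition_measurable[OF t] measurable_cong_sets[OF sets refl] by blast
  show ?thesis
  proof (rule measure_eqI)
    show "sets (\<mu> \<bind> transition M X t) = sets (distr (\<mu> \<Otimes>\<^sub>M M) half_line (case_prod (flow t)))"
      by (subst sets_bind[OF sets_kernel[OF tm]]) (auto simp: space)
    fix B assume "B \<in> sets (\<mu> \<bind> transition M X t)"
    then have B: "B \<in> sets half_line"
      by (subst (asm) sets_bind[OF sets_kernel[OF tm]]) (auto simp: space)
    have "emeasure (\<mu> \<bind> transition M X t) B = (\<integral>\<^sup>+x. emeasure (transition M X t x) B \<partial>\<mu>)"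
      using tm B by (intro emeasure_bind) (auto simp: space)
    also have "\<dots> = (\<integral>\<^sup>+x. emeasure M (Pair x -` (case_prod (flow t) -` B \<inter> space (\<mu> \<Otimes>\<^sub>M M))) \<partial>\<mu>)"
    proof (rule nn_integral_cong)
      fix x assume "x \<in> space \<mu>"
      then have x: "0 \<le> x" by (simp add: space)
      have "Pair x -` (case_prod (flow t) -` B \<inter> space (\<mu> \<Otimes>\<^sub>M M)) = flow t x -` B \<inter> space M"
        using x by (auto simp: space_pair_measure space)
      then show "emeasure (transition M X t x) B = emeasure M (Pair x -` (case_prod (flow t) -` B \<inter> space (\<mu> \<Otimes>\<^sub>M M)))"
        using B x t by (simp add: transition_eq emeasure_distr flow_measurable_snd)
    qed
    also have "\<dots> = emeasure (\<mu> \<Otimes>\<^sub>M M) (case_prod (flow t) -` B \<inter> space (\<mu> \<Otimes>\<^sub>M M))"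
      using measurable_sets[OF fm B] by (rule emeasure_pair_measure_alt[symmetric])
    also have "\<dots> = emeasure (distr (\<mu> \<Otimes>\<^sub>M M) half_line (case_prod (flow t))) B"
      using fm B by (rule emeasure_distr[symmetric])
    finally show "emeasure (\<mu> \<bind> transition M X t) B = emeasure (distr (\<mu> \<Otimes>\<^sub>M M) half_line (case_prod (flow t))) B" .
  qed
qed

section \<open>The transition semigroup acting on functions\<close>

definition expect :: "real \<Rightarrow> (real \<Rightarrow> real) \<Rightarrow> real \<Rightarrow> real" where
  "expect t f x = (\<integral>\<omega>. f (X x t \<omega>) \<partial>M)"

lemma abs_expect_le: "(\<And>y. \<bar>f y\<bar> \<le> B) \<Longrightarrow> \<bar>expect t f x\<bar> \<le> B"
  unfolding expect_def by (rule abs_expectation_le)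

lemma expect_eq_flow:
  assumes "0 \<le> x" "0 \<le> t" and f: "f \<in> borel_measurable borel"
  shows "expect t f x = (\<integral>\<omega>. f (flow t x \<omega>) \<partial>M)"
  unfolding expect_def
proof (rule integral_cong_AE)
  show "(\<lambda>\<omega>. f (X x t \<omega>)) \<in> borel_measurable M"
    by (rule measurable_compose[OF X_measurable f]) fact+
  show "(\<lambda>\<omega>. f (flow t x \<omega>)) \<in> borel_measurable M"
    by (rule measurable_compose[OF measurable_half_line_borel[OF flow_measurable_snd] f]) fact+
  show "AE \<omega> in M. f (X x t \<omega>) = f (flow t x \<omega>)"
    using AE_flow[OF assms(1,2)] by eventually_elim simp
qed

lemma expect_measurable:
  assumes "0 \<le> t" and f: "f \<in> borel_measurable borel"
  shows "expect t f \<in> borel_measurable half_line"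
proof -
  have "(\<lambda>z. f (case_prod (flow t) z)) \<in> borel_measurable (half_line \<Otimes>\<^sub>M M)"
    by (rule measurable_compose[OF measurable_half_line_borel[OF flow_measurable] f]) fact
  then have "(\<lambda>x. \<integral>\<omega>. f (flow t x \<omega>) \<partial>M) \<in> borel_measurable half_line"
    by (intro borel_measurable_lebesgue_integral) (simp add: case_prod_beta')
  then show ?thesis
    by (rule measurable_cong[THEN iffD1, rotated]) (use expect_eq_flow assms in auto)
qed

lemma integral_bind_transition:
  assumes \<mu>: "prob_space \<mu>" and sets: "sets \<mu> = sets half_line" and t: "0 \<le> t"
    and f: "f \<in> borel_measurable borel" "\<And>y. \<bar>f y\<bar> \<le> B"
  shows "(\<integral>y. f y \<partial>(\<mu> \<bind> transition M X t)) = (\<integral>x. expect t f x \<partial>\<mu>)"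
proof -
  interpret \<mu>: prob_space \<mu> by fact
  interpret PP: pair_prob_space \<mu> M ..
  have space: "space \<mu> = {0..}" using sets_eq_imp_space_eq[OF sets] by simp
  have mp: "measurable (\<mu> \<Otimes>\<^sub>M M) half_line = measurable (half_line \<Otimes>\<^sub>M M) half_line"
    by (rule measurable_cong_sets[OF sets_pair_measure_cong[OF sets refl] refl])
  have fm: "case_prod (flow t) \<in> measurable (\<mu> \<Otimes>\<^sub>M M) half_line"
    unfolding mp using t by (rule flow_measurable)
  have ffm: "(\<lambda>z. f (case_prod (flow t) z)) \<in> borel_measurable (\<mu> \<Otimes>\<^sub>M M)"
    by (rule measurable_compose[OF measurable_half_line_borel[OF fm] f(1)])
  have "(\<integral>y. f y \<partial>(\<mu> \<bind> transition M X t)) = (\<integral>z. f (case_prod (flow t) z) \<partial>(\<mu> \<Otimes>\<^sub>M M))"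
    unfolding bind_transition[OF \<mu> sets t] using fm borel_measurable_half_line[OF f(1)] by (rule integral_distr)
  also have "\<dots> = (\<integral>x. \<integral>\<omega>. f (flow t x \<omega>) \<partial>M \<partial>\<mu>)"
    using f(2) ffm by (subst PP.integral_fst'[symmetric]) (auto intro!: PP.P.integrable_const_bound[where B = B])
  also have "\<dots> = (\<integral>x. expect t f x \<partial>\<mu>)"
    using t f(1) by (intro Bochner_Integration.integral_cong refl) (simp add: space expect_eq_flow)
  finally show ?thesis .
qed

text \<open>The Markov property. Both sides are limits of the same iterated kernels
  \<open>?K n\<close>, evaluated at \<open>X x s\<close>: on the left by running the scheme from
  time \<open>s\<close>, on the right by taking the limit inside the expectation.\<close>

lemma semigroup:
  assumes x: "0 \<le> x" and s: "0 \<le> s" and t: "0 \<le> t"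
    and f: "continuous_on UNIV f" "\<And>y. \<bar>f y\<bar> \<le> B"
  shows "expect (s + t) f x = (\<integral>\<omega>. expect t f (X x s \<omega>) \<partial>M)"
proof -
  have fb [measurable]: "f \<in> borel_measurable borel" using f(1) by (rule borel_measurable_continuous_onI)
  have expect_0: "expect 0 f y = f y" if "0 \<le> y" for y
  proof -
    have "(\<integral>\<omega>. f (X y 0 \<omega>) \<partial>M) = (\<integral>\<omega>. f y \<partial>M)"
      using AE_storage_path[OF that] X_measurable[OF that order_refl] by (intro integral_cong_AE) auto
    then show ?thesis by (simp add: expect_def prob_space)
  qed
  show ?thesis
  \<comment> \<open>The Euler scheme has step \<open>t / real (Suc n)\<close>, which must be
    positive.\<close>
  proof (cases "t = 0")
    case True
    have "(\<integral>\<omega>. expect 0 f (X x s \<omega>) \<partial>M) = (\<integral>\<omega>. f (X x s \<omega>) \<partial>M)"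
      using X_nonneg[OF x s] by (intro Bochner_Integration.integral_cong refl expect_0)
    then show ?thesis by (simp add: True expect_def)
  next
    case False
    then have t: "0 < t" using t by simp
    let ?K = "\<lambda>n. (euler_kernel (t / real (Suc n)) ^^ Suc n) f"
    have h: "0 < t / real (Suc n)" for n using t by simp
    have K [measurable]: "?K n \<in> borel_measurable borel" and KB: "\<bar>?K n y\<bar> \<le> B" for n y
      using euler_kernel_funpow[OF h fb f(2)] by blast+
    \<comment> \<open>Running the scheme from time \<open>0\<close> and the constant state
      \<open>y\<close> identifies the pointwise limit of the iterated kernels.\<close>
    have lim: "(\<lambda>n. ?K n y) \<longlonglongrightarrow> expect t f y" if y: "0 \<le> y" for y
    proof -
      have "(\<integral>\<omega>. ?K n (X y 0 \<omega>) \<partial>M) = (\<integral>\<omega>. ?K n y \<partial>M)" for n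
      proof (rule integral_cong_AE)
        show "(\<lambda>\<omega>. ?K n (X y 0 \<omega>)) \<in> borel_measurable M"
          by (rule measurable_compose[OF X_measurable[OF y order_refl] K])
        show "AE \<omega> in M. ?K n (X y 0 \<omega>) = ?K n y"
          using AE_storage_path[OF y] by eventually_elim simp
      qed simp
      moreover have "(\<lambda>n. \<integral>\<omega>. ?K n (X y 0 \<omega>) \<partial>M) \<longlonglongrightarrow> (\<integral>\<omega>. f (X y (0 + t) \<omega>) \<partial>M)"
        using y t f by (intro expectation_X_limit) auto
      ultimately show ?thesis by (simp add: expect_def prob_space del: funpow.simps of_nat_Suc)
    qed
    have "(\<lambda>n. \<integral>\<omega>. ?K n (X x s \<omega>) \<partial>M) \<longlonglongrightarrow> (\<integral>\<omega>. expect t f (X x s \<omega>) \<partial>M)"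
    proof (rule integral_dominated_convergence[where w = "\<lambda>_. B"])
      show "(\<lambda>\<omega>. expect t f (X x s \<omega>)) \<in> borel_measurable M"
        by (rule measurable_compose[OF X_measurable_half_line[OF x s] expect_measurable[OF _ fb]]) (use t in simp)
      show "(\<lambda>\<omega>. ?K n (X x s \<omega>)) \<in> borel_measurable M" for n
        by (rule measurable_compose[OF X_measurable[OF x s] K])
      show "AE \<omega> in M. (\<lambda>n. ?K n (X x s \<omega>)) \<longlonglongrightarrow> expect t f (X x s \<omega>)"
        using X_nonneg[OF x s] by (intro AE_I2 lim)
      show "AE \<omega> in M. norm (?K n (X x s \<omega>)) \<le> B" for n
        using KB[of n] by (simp del: funpow.simps of_nat_Suc)
    qed simp
    moreover have "(\<lambda>n. \<integral>\<omega>. ?K n (X x s \<omega>) \<partial>M) \<longlonglongrightarrow> expect (s + t) f x"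
      unfolding expect_def using x s t f by (intro expectation_X_limit) auto
    ultimately show ?thesis by (intro LIMSEQ_unique)
  qed
qed

end

section \<open>Uniqueness of the invariant measure\<close>

lemma powr_convex_comb:
  fixes x y \<theta> p :: real
  assumes p: "1 \<le> p" and "0 \<le> x" "0 \<le> y" "0 \<le> \<theta>" "\<theta> \<le> 1"
  shows "(\<theta> * x + (1 - \<theta>) * y) powr p \<le> \<theta> * x powr p + (1 - \<theta>) * y powr p"
proof -
  \<comment> \<open>For a zero argument the claim reduces to \<open>s powr p \<le> s\<close> on
    \<open>[0, 1]\<close>.\<close>
  have scale: "(s * z) powr p \<le> s * z powr p" if "0 \<le> s" "s \<le> 1" "0 \<le> z" for s z :: real
  proof -
    have "s powr p \<le> s"
    proof (cases "s = 0")
      case False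
      then show ?thesis using powr_mono'[of 1 p s] p that by simp
    qed (use p in simp)
    then show ?thesis using that by (simp add: powr_mult mult_right_mono)
  qed
  show ?thesis
  proof (cases "x = 0 \<or> y = 0")
    case True
    then show ?thesis using scale[of \<theta> x] scale[of "1 - \<theta>" y] assms by auto
  next
    case False
    then show ?thesis
      using convex_onD[OF powr_convex[OF p], of "1 - \<theta>" x y] assms by (auto simp: algebra_simps)
  qed
qed

lemma powr_markov:
  assumes [measurable]: "f \<in> borel_measurable N" and "0 \<le> u" "0 \<le> p"
  shows "ennreal (u powr p) * emeasure N {x \<in> space N. u < f x} \<le> (\<integral>\<^sup>+x. ennreal (f x powr p) \<partial>N)"
proof -
  have "ennreal (u powr p) * emeasure N {x \<in> space N. u < f x}
      = (\<integral>\<^sup>+x. ennreal (u powr p) * indicator {x \<in> space N. u < f x} x \<partial>N)"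
    by (subst nn_integral_cmult_indicator) auto
  also have "\<dots> \<le> (\<integral>\<^sup>+x. ennreal (f x powr p) \<partial>N)"
    using assms by (intro nn_integral_mono) (auto simp: indicator_def intro!: ennreal_leI powr_mono2)
  finally show ?thesis .
qed

text \<open>Small enough a class for the contraction to act on it with an explicit constant, large
  enough to determine a law. \<open>L\<close> is a parameter because it enters the
  estimates.\<close>

definition lipschitz_test :: "real \<Rightarrow> (real \<Rightarrow> real) \<Rightarrow> bool" where
  "lipschitz_test L f \<longleftrightarrow> 0 \<le> L \<and> (\<forall>x y. \<bar>f x - f y\<bar> \<le> L * \<bar>x - y\<bar>) \<and> (\<forall>x. \<bar>f x\<bar> \<le> 1)"

lemma lipschitz_test_continuous: "lipschitz_test L f \<Longrightarrow> continuous_on UNIV f"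
  by (rule lipschitz_on_continuous_on[of L]) (auto simp: lipschitz_test_def dist_real_def intro!: lipschitz_onI)

lemma lipschitz_test_measurable: "lipschitz_test L f \<Longrightarrow> f \<in> borel_measurable borel"
  by (intro borel_measurable_continuous_onI lipschitz_test_continuous)

lemma lipschitz_test_cts_step:
  assumes "a < b"
  shows "lipschitz_test (1 / (b - a)) (cts_step a b)"
proof -
  \<comment> \<open>An affine function clamped to \<open>[0, 1]\<close>; clamping is
    nonexpansive.\<close>
  have eq: "cts_step a b x = max 0 (min 1 ((b - x) / (b - a)))" for x
    using assms by (auto simp: cts_step_def max_def min_def field_simps)
  have "\<bar>cts_step a b x - cts_step a b y\<bar> \<le> \<bar>(b - x) / (b - a) - (b - y) / (b - a)\<bar>" for x y
    unfolding eq by (auto simp: max_def min_def abs_if)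
  also have "\<dots> x y = 1 / (b - a) * \<bar>x - y\<bar>" for x y
  proof -
    have "(b - x) / (b - a) - (b - y) / (b - a) = (y - x) / (b - a)"
      by (simp add: diff_divide_distrib[symmetric])
    then show ?thesis using assms by (simp add: abs_divide abs_minus_commute)
  qed
  finally show ?thesis using assms by (auto simp: lipschitz_test_def eq)
qed

text \<open>\<open>cts_step x y\<close> lies between the indicators of
  \<open>(-\<infinity>, x]\<close> and \<open>(-\<infinity>, y]\<close>. This compares one
  distribution function at \<open>x\<close> with the other at \<open>y > x\<close>, and right
  continuity removes the gap.\<close>

lemma measure_eq_of_lipschitz_test:
  assumes "prob_space \<mu>1" "prob_space \<mu>2"
    and sets: "sets \<mu>1 = sets half_line" "sets \<mu>2 = sets half_line"
    and eq: "\<And>L f. lipschitz_test L f \<Longrightarrow> (\<integral>x. f x \<partial>\<mu>1) = (\<integral>x. f x \<partial>\<mu>2)"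
  shows "\<mu>1 = \<mu>2"
proof -
  let ?N = "\<lambda>\<mu>. distr \<mu> borel (\<lambda>x. x)"
  have id: "(\<lambda>x. x) \<in> borel_measurable \<mu>" if "sets \<mu> = sets half_line" for \<mu> :: "real measure"
    unfolding measurable_cong_sets[OF that refl] by (rule borel_measurable_half_line) simp
  have rd: "real_distribution (?N \<mu>)" if "prob_space \<mu>" "sets \<mu> = sets half_line" for \<mu> :: "real measure"
    using prob_space.real_distribution_distr[OF that(1) id[OF that(2)]] .
  have le: "cdf (?N \<mu>) x \<le> cdf (?N \<eta>) x"
    if \<mu>: "prob_space \<mu>" "sets \<mu> = sets half_line" and \<eta>: "prob_space \<eta>" "sets \<eta> = sets half_line"
      and eq: "\<And>L f. lipschitz_test L f \<Longrightarrow> (\<integral>x. f x \<partial>\<mu>) = (\<integral>x. f x \<partial>\<eta>)"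
    for \<mu> \<eta> :: "real measure" and x
  proof -
    interpret N1: real_distribution "?N \<mu>" using rd[OF \<mu>] .
    interpret N2: real_distribution "?N \<eta>" using rd[OF \<eta>] .
    have "cdf (?N \<mu>) x \<le> cdf (?N \<eta>) y" if "x < y" for y
    proof -
      have meas: "cts_step x y \<in> borel_measurable borel"
        using lipschitz_test_measurable[OF lipschitz_test_cts_step[OF that]] .
      have "cdf (?N \<mu>) x \<le> (\<integral>z. cts_step x y z \<partial>?N \<mu>)"
        using N1.cdf_cts_step[OF that] by blast
      also have "\<dots> = (\<integral>z. cts_step x y z \<partial>\<mu>)"
        using id[OF \<mu>(2)] meas by (rule integral_distr)
      also have "\<dots> = (\<integral>z. cts_step x y z \<partial>\<eta>)"
        using lipschitz_test_cts_step[OF that] by (rule eq)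
      also have "\<dots> = (\<integral>z. cts_step x y z \<partial>?N \<eta>)"
        using id[OF \<eta>(2)] meas by (rule integral_distr[symmetric])
      also have "\<dots> \<le> cdf (?N \<eta>) y"
        using N2.cdf_cts_step[OF that] by blast
      finally show ?thesis .
    qed
    moreover have "(cdf (?N \<eta>) \<longlongrightarrow> cdf (?N \<eta>) x) (at_right x)"
      using N2.cdf_is_right_cont[of x] by (simp add: continuous_within)
    ultimately show ?thesis
      by (intro tendsto_lowerbound[of "cdf (?N \<eta>)" _ "at_right x"]) (auto simp: eventually_at_filter)
  qed
  have "cdf (?N \<mu>1) = cdf (?N \<mu>2)"
    using le[of \<mu>1 \<mu>2] le[of \<mu>2 \<mu>1] assms by (intro ext antisym) auto
  then have N: "?N \<mu>1 = ?N \<mu>2"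
    using rd assms by (intro cdf_unique) auto
  show ?thesis
  proof (rule measure_eqI)
    fix B assume "B \<in> sets \<mu>1"
    then have B: "B \<in> sets borel" "B \<subseteq> {0..}"
      using sets(1) by (auto simp: sets_restrict_space_iff)
    have "emeasure (?N \<mu>) B = emeasure \<mu> B" if "sets \<mu> = sets half_line" for \<mu> :: "real measure"
    proof -
      have "space \<mu> = {0..}" using sets_eq_imp_space_eq[OF that] by simp
      then have "B \<inter> space \<mu> = B" using B by blast
      then show ?thesis using emeasure_distr[OF id[OF that] B(1)] by simp
    qed
    from this[OF sets(1)] this[OF sets(2)] show "emeasure \<mu>1 B = emeasure \<mu>2 B"
      using N by simp
  qed (use sets in simp)
qed

text \<open>The content at time \<open>s + 1\<close> exceeds that at \<open>u\<close> by at most the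
  input after \<open>u\<close>, so \<open>y \<le> \<xi> u\<close> throughout, and at least
  \<open>r y\<close> leaves in the unit of time.\<close>

lemma (in monotone_release) storage_path_minus_input_le:
  assumes \<xi>: "storage_path r a x \<xi>" and a: "mono_on {0..} a"
    and s: "0 \<le> s" and y: "y = \<xi> (s + 1) - (a (s + 1) - a s)" "0 \<le> y"
  shows "y + r y \<le> \<xi> s"
proof -
  have "integral {s..s + 1} (\<lambda>u. r y) \<le> integral {s..s + 1} (\<lambda>u. r (\<xi> u))"
  proof (rule integral_le)
    show "r y \<le> r (\<xi> u)" if u: "u \<in> {s..s + 1}" for u
    proof (rule r_mono)
      have "\<xi> (s + 1) \<le> \<xi> u + (a (s + 1) - a u)"
        using s u by (intro storage_path_release_le[OF \<xi>]) auto
      moreover have "a s \<le> a u" using a s u by (auto simp: mono_on_def)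
      ultimately show "y \<le> \<xi> u" unfolding y(1) by linarith
    qed (rule y(2))
  qed (use storage_path_integrable[OF \<xi> s] in auto)
  then have "r y \<le> integral {s..s + 1} (\<lambda>u. r (\<xi> u))" by simp
  moreover have "\<xi> (s + 1) = \<xi> s + (a (s + 1) - a s) - integral {s..s + 1} (\<lambda>u. r (\<xi> u))"
    using storage_path_increment[OF \<xi> s, of "s + 1"] by simp
  ultimately show ?thesis unfolding y(1) by linarith
qed

section \<open>Bounded moments and merging of laws\<close>

context storage
begin

text \<open>The factor that results from solving
  \<open>y + \<Gamma> * (y * \<beta> 1) \<le> x\<close> for \<open>y\<close>.\<close>

definition drain :: real where "drain = 1 / (1 + \<Gamma> * \<beta> 1)"

lemma drain: "0 < drain" "drain < 1"
proof -
  have "0 < \<Gamma> * \<beta> 1" using \<Gamma> pos[of 1] by simp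
  then show "0 < drain" "drain < 1" by (simp_all add: drain_def divide_simps)
qed

text \<open>Since \<open>r y \<ge> \<Gamma> \<beta>(y) \<ge> \<Gamma> \<beta>(1) y\<close> for \<open>y \<ge> 1\<close>, a fixed fraction of the content leaves in unit time.\<close>

lemma storage_path_drain:
  assumes \<xi>: "storage_path r a x \<xi>" and a: "mono_on {0..} a" and s: "0 \<le> s"
  shows "\<xi> (s + 1) \<le> drain * \<xi> s + (1 + (a (s + 1) - a s))"
proof -
  define y where "y = \<xi> (s + 1) - (a (s + 1) - a s)"
  have "y \<le> drain * \<xi> s + 1"
  \<comment> \<open>The linear lower bound for \<open>r\<close> holds from \<open>1\<close> on;
    below, the summand \<open>1\<close> suffices.\<close>
  proof (cases "1 \<le> y")
    case True
    have "1 / y * y = 1" using True by simp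
    then have "\<beta> 1 \<le> 1 / y * \<beta> y" using le_scale[of "1 / y" y] True by simp
    then have "y * \<beta> 1 \<le> y * (1 / y * \<beta> y)" using True by (intro mult_left_mono) auto
    then have "\<Gamma> * (y * \<beta> 1) \<le> \<Gamma> * \<beta> y" using \<Gamma> True by simp
    also have "\<dots> \<le> r y" using dissipative[of 0 y] r_zero True by simp
    finally have "y + \<Gamma> * (y * \<beta> 1) \<le> \<xi> s"
      using storage_path_minus_input_le[OF \<xi> a s y_def] True by simp
    moreover have "0 < 1 + \<Gamma> * \<beta> 1" using \<Gamma> pos[of 1] by (simp add: add_pos_pos)
    ultimately have "y \<le> drain * \<xi> s" by (simp add: drain_def field_simps)
    then show ?thesis by simp
  next
    case False
    have "0 \<le> drain * \<xi> s" using drain storage_path_nonneg[OF \<xi> s] by simp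
    then show ?thesis using False by simp
  qed
  then show ?thesis by (simp add: y_def)
qed

text \<open>Convexity of the power with weights \<open>drain\<close> and \<open>1 - drain\<close>
  leaves exactly the factor \<open>drain\<close> before the old moment. As \<open>drain < 1\<close>,
  the affine recursion has a fixed point, which bounds all moments.\<close>

lemma moments_bounded: "\<exists>C. \<forall>n::nat. (\<integral>\<^sup>+\<omega>. ennreal (X 0 (real n) \<omega> powr p) \<partial>M) \<le> ennreal C"
proof -
  \<comment> \<open>Collects \<open>1 / (1 - drain)\<close> from the definition of \<open>w\<close>
    below and \<open>2 powr p\<close> from \<open>powr_add_le\<close>.\<close>
  define K where "K = (1 - drain) * (1 / (1 - drain)) powr p * 2 powr p"
  have K: "0 \<le> K" using drain by (simp add: K_def)
  define m where "m = enn2real (\<integral>\<^sup>+\<omega>. ennreal (A 1 \<omega> powr p) \<partial>M)"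
  have [measurable]: "A 1 \<in> borel_measurable M" by (rule A_measurable) simp
  have m: "0 \<le> m" "(\<integral>\<^sup>+\<omega>. ennreal (A 1 \<omega> powr p) \<partial>M) = ennreal m"
    using A1_moment_finite by (auto simp: m_def ennreal_enn2real_if)
  \<comment> \<open>The fixed point of the recursion, which starts at \<open>0\<close>.\<close>
  define C where "C = K * (1 + m) / (1 - drain)"
  have C: "0 \<le> C" "drain * C + K * (1 + m) = C"
    using K m drain by (auto simp: C_def field_simps)
  have "(\<integral>\<^sup>+\<omega>. ennreal (X 0 (real n) \<omega> powr p) \<partial>M) \<le> ennreal C" for n
  proof (induction n)
    case 0
    have "(\<integral>\<^sup>+\<omega>. ennreal (X 0 (real 0) \<omega> powr p) \<partial>M) = (\<integral>\<^sup>+\<omega>. 0 \<partial>M)"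
    proof (rule nn_integral_cong_AE)
      show "AE \<omega> in M. ennreal (X 0 (real 0) \<omega> powr p) = 0"
        using AE_storage_path[OF order_refl] by eventually_elim simp
    qed
    then show ?case by simp
  next
    case (Suc n)
    let ?s = "real n"
    let ?D = "\<lambda>\<omega>. A (?s + 1) \<omega> - A ?s \<omega>"
    have [measurable]: "A ?s \<in> borel_measurable M" "A (?s + 1) \<in> borel_measurable M"
      "X 0 ?s \<in> borel_measurable M"
      by (auto intro!: A_measurable X_measurable)
    have mD: "(\<integral>\<^sup>+\<omega>. ennreal (?D \<omega> powr p) \<partial>M) = ennreal m"
    proof -
      have "distr M borel ?D = distr M borel (A (?s + 1 - ?s))"
        by (rule increment_distr) auto
      then have "(\<integral>\<^sup>+z. ennreal (z powr p) \<partial>distr M borel ?D) = (\<integral>\<^sup>+z. ennreal (z powr p) \<partial>distr M borel (A 1))"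
        by simp
      then show ?thesis by (simp add: nn_integral_distr m(2))
    qed
    have "(\<integral>\<^sup>+\<omega>. ennreal (X 0 (real (Suc n)) \<omega> powr p) \<partial>M)
        \<le> (\<integral>\<^sup>+\<omega>. ennreal drain * ennreal (X 0 ?s \<omega> powr p) + ennreal K * (1 + ennreal (?D \<omega> powr p)) \<partial>M)"
    proof (rule nn_integral_mono_AE)
      show "AE \<omega> in M. ennreal (X 0 (real (Suc n)) \<omega> powr p)
          \<le> ennreal drain * ennreal (X 0 ?s \<omega> powr p) + ennreal K * (1 + ennreal (?D \<omega> powr p))"
        using AE_storage_path[OF order_refl] AE_A_path
      proof eventually_elim
        case (elim \<omega>)
        then have sp: "storage_path r (\<lambda>t. A t \<omega>) 0 (\<lambda>t. X 0 t \<omega>)" by blast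
        define d where "d = ?D \<omega>"
        define w where "w = (1 + d) * (1 / (1 - drain))"
        have d: "0 \<le> d" using elim by (auto simp: mono_on_def d_def)
        have w: "0 \<le> w" using d drain by (simp add: w_def)
        have X0: "0 \<le> X 0 ?s \<omega>" "0 \<le> X 0 (?s + 1) \<omega>"
          by (auto intro!: storage_path_nonneg[OF sp])
        have "X 0 (?s + 1) \<omega> \<le> drain * X 0 ?s \<omega> + (1 + d)"
          unfolding d_def using elim by (intro storage_path_drain[OF sp]) auto
        also have "\<dots> = drain * X 0 ?s \<omega> + (1 - drain) * w"
          using drain by (simp add: w_def)
        finally have "X 0 (?s + 1) \<omega> powr p \<le> (drain * X 0 ?s \<omega> + (1 - drain) * w) powr p"
          using X0 p by (intro powr_mono2) auto
        also have "\<dots> \<le> drain * X 0 ?s \<omega> powr p + (1 - drain) * w powr p"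
          using X0 w p drain by (intro powr_convex_comb) auto
        also have "\<dots> \<le> drain * X 0 ?s \<omega> powr p + K * (1 + d powr p)"
        proof -
          have "(1 + d) powr p \<le> 2 powr p * (1 powr p + d powr p)"
            using d p by (intro powr_add_le) auto
          then have "(1 - drain) * (1 / (1 - drain)) powr p * (1 + d) powr p
              \<le> (1 - drain) * (1 / (1 - drain)) powr p * (2 powr p * (1 + d powr p))"
            using drain by (intro mult_left_mono) auto
          moreover have "w powr p = (1 + d) powr p * (1 / (1 - drain)) powr p"
            unfolding w_def by (rule powr_mult)
          ultimately show ?thesis by (simp only: K_def mult_ac)
        qed
        finally have "X 0 (?s + 1) \<omega> powr p \<le> drain * X 0 ?s \<omega> powr p + K * (1 + d powr p)" .
        then have "ennreal (X 0 (?s + 1) \<omega> powr p) \<le> ennreal (drain * X 0 ?s \<omega> powr p + K * (1 + d powr p))"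
          by (rule ennreal_leI)
        also have "\<dots> = ennreal drain * ennreal (X 0 ?s \<omega> powr p) + ennreal K * (1 + ennreal (d powr p))"
          using drain K by (simp add: ennreal_mult ennreal_plus)
        finally show ?case by (simp add: d_def add.commute)
      qed
    qed
    also have "\<dots> = ennreal drain * (\<integral>\<^sup>+\<omega>. ennreal (X 0 ?s \<omega> powr p) \<partial>M) + ennreal K * (1 + ennreal m)"
      by (simp add: nn_integral_add nn_integral_cmult emeasure_space_1 mD)
    also have "\<dots> \<le> ennreal drain * ennreal C + ennreal K * (1 + ennreal m)"
      using Suc by (intro add_right_mono mult_left_mono) auto
    also have "\<dots> = ennreal (drain * C + K * (1 + m))"
      using drain K m(1) C(1) by (simp add: ennreal_mult ennreal_plus)
    finally show ?case by (simp only: C)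
  qed
  then show ?thesis by blast
qed

text \<open>Both starting points are driven by the same input. The first bound is uniform in
  \<open>t\<close> and gives continuity in the starting point; the second one decays in
  \<open>t\<close>.\<close>

lemma expect_lipschitz:
  assumes f: "lipschitz_test L f" and "0 \<le> x" "0 \<le> y" "0 \<le> t" 
  shows "\<bar>expect t f y - expect t f x\<bar> \<le> L * \<bar>y - x\<bar>"
    and "\<bar>expect t f y - expect t f x\<bar> \<le> L * (max 1 \<bar>y - x\<bar> * B_inv \<beta> 1 (\<Gamma> * t))"
proof -
  have fm [measurable]: "f \<in> borel_measurable borel" using f by (rule lipschitz_test_measurable)
  have [measurable]: "X x t \<in> borel_measurable M" "X y t \<in> borel_measurable M"
    using X_measurable assms by auto
  have int: "integrable M (\<lambda>\<omega>. f (X x t \<omega>))" "integrable M (\<lambda>\<omega>. f (X y t \<omega>))"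
    using f by (auto intro!: integrable_const_bound[where B = 1] simp: lipschitz_test_def)
  have *: "\<bar>expect t f y - expect t f x\<bar> \<le> L * c" if "AE \<omega> in M. \<bar>X y t \<omega> - X x t \<omega>\<bar> \<le> c" for c
  proof -
    have "expect t f y - expect t f x = (\<integral>\<omega>. f (X y t \<omega>) - f (X x t \<omega>) \<partial>M)"
      unfolding expect_def using int by simp
    also have "\<bar>\<dots>\<bar> \<le> (\<integral>\<omega>. \<bar>f (X y t \<omega>) - f (X x t \<omega>)\<bar> \<partial>M)"
      by (rule integral_abs_bound)
    also have "\<dots> \<le> (\<integral>\<omega>. L * c \<partial>M)"
    proof (rule integral_mono_AE)
      show "AE \<omega> in M. \<bar>f (X y t \<omega>) - f (X x t \<omega>)\<bar> \<le> L * c"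
        using that
      proof eventually_elim
        case (elim \<omega>)
        have "\<bar>f (X y t \<omega>) - f (X x t \<omega>)\<bar> \<le> L * \<bar>X y t \<omega> - X x t \<omega>\<bar>"
          using f by (simp add: lipschitz_test_def)
        also have "\<dots> \<le> L * c" using elim f by (intro mult_left_mono) (auto simp: lipschitz_test_def)
        finally show ?case .
      qed
    qed (use int in auto)
    finally show ?thesis by (simp add: prob_space)
  qed
  show "\<bar>expect t f y - expect t f x\<bar> \<le> L * \<bar>y - x\<bar>"
    by (rule *) (use AE_X_diff[OF assms(2-4)] in eventually_elim, blast)
  have "AE \<omega> in M. \<bar>X y t \<omega> - X x t \<omega>\<bar> \<le> max 1 \<bar>y - x\<bar> * B_inv \<beta> 1 (\<Gamma> * t)"
    using AE_X_diff[OF assms(2-4)]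
  proof eventually_elim
    case (elim \<omega>)
    then have "\<forall>\<kappa>>0. \<bar>X y t \<omega> - X x t \<omega>\<bar> \<le> max 1 (\<bar>y - x\<bar> / \<kappa>) * B_inv \<beta> \<kappa> (\<Gamma> * t)" by blast
    from this[rule_format, of 1] show ?case by simp
  qed
  then show "\<bar>expect t f y - expect t f x\<bar> \<le> L * (max 1 \<bar>y - x\<bar> * B_inv \<beta> 1 (\<Gamma> * t))"
    by (rule *)
qed

text \<open>The difference tends to \<open>0\<close> pointwise by \<open>expect_lipschitz\<close>.
  The pointwise rate grows with \<open>x\<close> and \<open>\<mu>\<close> carries no moment
  condition, so domination is by the constant \<open>2\<close>.\<close>

lemma expect_merge:
  assumes f: "lipschitz_test L f" and \<mu>: "prob_space \<mu>" "sets \<mu> = sets half_line"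
  shows "(\<lambda>n. (\<integral>x. expect (real n) f x \<partial>\<mu>) - expect (real n) f 0) \<longlonglongrightarrow> 0"
proof -
  interpret \<mu>: prob_space \<mu> by fact
  have space: "space \<mu> = {0..}" using sets_eq_imp_space_eq[OF \<mu>(2)] by simp
  have fm: "f \<in> borel_measurable borel" using f by (rule lipschitz_test_measurable)
  have bound: "\<bar>expect t f x\<bar> \<le> 1" for t x
    using f by (intro abs_expect_le) (simp add: lipschitz_test_def)
  have [measurable]: "expect (real n) f \<in> borel_measurable \<mu>" for n
    using expect_measurable[OF _ fm, of "real n"] measurable_cong_sets[OF \<mu>(2) refl] by auto
  have int: "integrable \<mu> (expect (real n) f)" for n
    using bound by (intro \<mu>.integrable_const_bound[where B = 1]) auto
  have "(\<lambda>n. \<integral>x. expect (real n) f x - expect (real n) f 0 \<partial>\<mu>) \<longlonglongrightarrow> (\<integral>x. 0 \<partial>\<mu>)"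
  proof (rule integral_dominated_convergence[where w = "\<lambda>_. 2"])
    show "AE x in \<mu>. norm (expect (real n) f x - expect (real n) f 0) \<le> 2" for n
    proof (rule AE_I2)
      fix x show "norm (expect (real n) f x - expect (real n) f 0) \<le> 2"
        using bound[of "real n" x] bound[of "real n" 0] by simp
    qed
    show "AE x in \<mu>. (\<lambda>n. expect (real n) f x - expect (real n) f 0) \<longlonglongrightarrow> 0"
    proof (rule AE_I2)
      fix x assume "x \<in> space \<mu>"
      then have x: "0 \<le> x" by (simp add: space)
      have "filterlim (\<lambda>n. \<Gamma> * real n) at_top sequentially"
        using \<Gamma> by (intro filterlim_tendsto_pos_mult_at_top[OF tendsto_const] filterlim_real_sequentially)
      then have "(\<lambda>n. B_inv \<beta> 1 (\<Gamma> * real n)) \<longlonglongrightarrow> 0"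
        by (rule filterlim_compose[OF B_inv_tendsto_0[OF zero_less_one]])
      then have "(\<lambda>n. L * (max 1 \<bar>x - 0\<bar> * B_inv \<beta> 1 (\<Gamma> * real n))) \<longlonglongrightarrow> L * (max 1 \<bar>x - 0\<bar> * 0)"
        by (intro tendsto_mult tendsto_const)
      then have lim: "(\<lambda>n. L * (max 1 \<bar>x - 0\<bar> * B_inv \<beta> 1 (\<Gamma> * real n))) \<longlonglongrightarrow> 0" by simp
      show "(\<lambda>n. expect (real n) f x - expect (real n) f 0) \<longlonglongrightarrow> 0"
      proof (rule Lim_null_comparison[OF always_eventually lim], rule allI)
        fix n show "norm (expect (real n) f x - expect (real n) f 0) \<le> L * (max 1 \<bar>x - 0\<bar> * B_inv \<beta> 1 (\<Gamma> * real n))"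
          using expect_lipschitz(2)[OF f order_refl x, of "real n"] by simp
      qed
    qed
  qed auto
  then show ?thesis using int by (simp add: \<mu>.prob_space)
qed

text \<open>The sequence does not involve \<open>\<pi>\<close>, so all invariant measures have the
  same integrals.\<close>

lemma invariant_expect_tendsto:
  assumes "invariant_measure M X \<pi>" and f: "lipschitz_test L f"
  shows "(\<lambda>n. expect (real n) f 0) \<longlonglongrightarrow> (\<integral>x. f x \<partial>\<pi>)"
proof -
  have \<pi>: "prob_space \<pi>" "sets \<pi> = sets half_line" "\<And>t. 0 \<le> t \<Longrightarrow> \<pi> \<bind> transition M X t = \<pi>"
    using assms(1) by (auto simp: invariant_measure_def)
  have "(\<integral>x. expect (real n) f x \<partial>\<pi>) = (\<integral>x. f x \<partial>\<pi>)" for n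
    using integral_bind_transition[OF \<pi>(1,2), of "real n" f 1] \<pi>(3)[of "real n"] f
      lipschitz_test_measurable[OF f] by (auto simp: lipschitz_test_def)
  then have "(\<lambda>n. (\<integral>x. f x \<partial>\<pi>) - expect (real n) f 0) \<longlonglongrightarrow> 0"
    using expect_merge[OF f \<pi>(1,2)] by simp
  from tendsto_diff[OF tendsto_const this, of "\<integral>x. f x \<partial>\<pi>"] show ?thesis by simp
qed

lemma invariant_measure_unique:
  assumes "invariant_measure M X \<pi>" "invariant_measure M X \<pi>'"
  shows "\<pi>' = \<pi>"
proof (rule measure_eq_of_lipschitz_test)
  fix L f assume "lipschitz_test L f"
  from invariant_expect_tendsto[OF assms(2) this] invariant_expect_tendsto[OF assms(1) this]
  show "(\<integral>x. f x \<partial>\<pi>') = (\<integral>x. f x \<partial>\<pi>)" by (rule LIMSEQ_unique)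
qed (use assms in \<open>auto simp: invariant_measure_def\<close>)

end

section \<open>Existence and Wasserstein contraction\<close>

lemma ennreal_powr_root_le:
  assumes "x \<le> ennreal (y powr p)" "0 \<le> y" "0 < p"
  shows "ennreal_powr x (1 / p) \<le> ennreal y"
proof -
  have fin: "x < \<infinity>" using assms(1) by (simp add: le_less_trans)
  have "enn2real x \<le> y powr p"
    using enn2real_mono[OF assms(1)] by simp
  then have "enn2real x powr (1 / p) \<le> (y powr p) powr (1 / p)"
    using assms by (intro powr_mono2) auto
  also have "\<dots> = y" using assms by (simp add: powr_powr)
  finally show ?thesis using fin by (auto simp: ennreal_powr_def intro: ennreal_leI)
qed

lemma le_of_ennreal_powr_root_less:
  assumes "ennreal_powr x (1 / p) < ennreal y" "0 < p"
  shows "x \<le> ennreal (y powr p)"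
proof -
  have fin: "x < \<infinity>" using assms(1) by (cases "x = \<infinity>") (auto simp: ennreal_powr_def less_top)
  then have "ennreal_powr x (1 / p) = ennreal (enn2real x powr (1 / p))"
    by (auto simp: ennreal_powr_def)
  then have lt: "enn2real x powr (1 / p) < y"
    using assms(1) by (simp add: ennreal_less_iff)
  have "enn2real x = (enn2real x powr (1 / p)) powr p"
    using assms(2) by (simp add: powr_powr)
  also have "\<dots> \<le> y powr p" using lt assms(2) by (intro powr_mono2) auto
  finally show ?thesis using fin by (metis ennreal_enn2real ennreal_leI infinity_ennreal_def)
qed

text \<open>A form of Minkowski's inequality \<open>\<parallel>1 + f\<parallel> \<le> 1 + \<parallel>f\<parallel>\<close>, by convexity of \<open>x \<mapsto> x\<^sup>p\<close> at the
  combination \<open>(1 + f) / (1 + a) = (1 - \<theta>) + \<theta> (f / a)\<close> with \<open>\<theta> = a / (1 + a)\<close>.\<close>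

lemma nn_integral_one_plus_powr_le:
  assumes "prob_space N" and [measurable]: "f \<in> borel_measurable N"
    and f: "\<And>x. 0 \<le> f x" and p: "1 \<le> p" and a: "0 < a"
    and le: "(\<integral>\<^sup>+x. ennreal (f x powr p) \<partial>N) \<le> ennreal (a powr p)"
  shows "(\<integral>\<^sup>+x. ennreal ((1 + f x) powr p) \<partial>N) \<le> ennreal ((1 + a) powr p)"
proof -
  interpret prob_space N by fact
  \<comment> \<open>This is the weight of the constant \<open>1\<close>, thus \<open>1\<close> minus
    the weight denoted by the same letter above.\<close>
  define \<theta> where "\<theta> = 1 / (1 + a)"
  \<comment> \<open>The coefficient of \<open>f x powr p\<close>; \<open>c * a powr p\<close> is the
    share \<open>1 - \<theta>\<close> of \<open>(1 + a) powr p\<close>.\<close>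
  define c where "c = (1 + a) powr p * (1 - \<theta>) / a powr p"
  have \<theta>: "0 \<le> \<theta>" "\<theta> \<le> 1" using a by (auto simp: \<theta>_def)
  have c: "0 \<le> c" using \<theta> by (simp add: c_def)
  have "(\<integral>\<^sup>+x. ennreal ((1 + f x) powr p) \<partial>N)
      \<le> (\<integral>\<^sup>+x. ennreal ((1 + a) powr p * \<theta>) + ennreal c * ennreal (f x powr p) \<partial>N)"
  proof (rule nn_integral_mono)
    fix x
    have "1 + f x = (1 + a) * (\<theta> * 1 + (1 - \<theta>) * (f x / a))"
      using a by (simp add: \<theta>_def field_simps)
    then have "(1 + f x) powr p = (1 + a) powr p * (\<theta> * 1 + (1 - \<theta>) * (f x / a)) powr p"
      by (simp only: powr_mult)
    also have "\<dots> \<le> (1 + a) powr p * (\<theta> * 1 powr p + (1 - \<theta>) * (f x / a) powr p)"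
      using \<theta> f a p by (intro mult_left_mono powr_convex_comb) auto
    also have "\<dots> = (1 + a) powr p * \<theta> + c * f x powr p"
      by (simp add: c_def powr_divide algebra_simps)
    finally have "(1 + f x) powr p \<le> (1 + a) powr p * \<theta> + c * f x powr p" .
    then have "ennreal ((1 + f x) powr p) \<le> ennreal ((1 + a) powr p * \<theta> + c * f x powr p)"
      by (rule ennreal_leI)
    also have "\<dots> = ennreal ((1 + a) powr p * \<theta>) + ennreal c * ennreal (f x powr p)"
      using \<theta> c by (simp add: ennreal_plus ennreal_mult)
    finally show "ennreal ((1 + f x) powr p) \<le> ennreal ((1 + a) powr p * \<theta>) + ennreal c * ennreal (f x powr p)" .
  qed
  also have "\<dots> = ennreal ((1 + a) powr p * \<theta>) + ennreal c * (\<integral>\<^sup>+x. ennreal (f x powr p) \<partial>N)"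
    by (simp add: nn_integral_add nn_integral_cmult emeasure_space_1)
  also have "\<dots> \<le> ennreal ((1 + a) powr p * \<theta>) + ennreal c * ennreal (a powr p)"
    using le by (intro add_left_mono mult_left_mono) auto
  also have "\<dots> = ennreal ((1 + a) powr p * \<theta> + c * a powr p)"
    using \<theta> c by (simp add: ennreal_plus ennreal_mult)
  also have "(1 + a) powr p * \<theta> + c * a powr p = (1 + a) powr p"
  proof -
    have "c * a powr p = (1 + a) powr p * (1 - \<theta>)" using a by (simp add: c_def)
    then show ?thesis by (simp add: right_diff_distrib)
  qed
  finally show ?thesis .
qed

section \<open>Tightness and existence of an invariant law\<close>

context storage
begin

lemma tight_marginals: "tight (\<lambda>n. distr M borel (X 0 (real n)))"
  unfolding tight_def
proof (intro conjI allI impI)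
  have [measurable]: "X 0 (real n) \<in> borel_measurable M" for n by (rule X_measurable) auto
  show "real_distribution (distr M borel (X 0 (real n)))" for n
    by (rule real_distribution_distr) simp
  fix \<epsilon> :: real assume \<epsilon>: "0 < \<epsilon>"
  obtain C where C: "\<And>n. (\<integral>\<^sup>+\<omega>. ennreal (X 0 (real n) \<omega> powr p) \<partial>M) \<le> ennreal C"
    using moments_bounded by blast
  \<comment> \<open>\<open>b > \<bar>C\<bar> / \<epsilon>\<close> serves Markov's inequality;
    \<open>b \<ge> 1\<close> allows \<open>b powr p\<close> to be replaced by the smaller
    \<open>b\<close>.\<close>
  define b where "b = max 1 (\<bar>C\<bar> / \<epsilon> + 1)"
  have b: "1 \<le> b" "\<bar>C\<bar> / \<epsilon> < b" by (auto simp: b_def)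
  \<comment> \<open>The left end is \<open>- 1\<close> because the interval is open there and must
    contain \<open>0\<close>.\<close>
  have "measure (distr M borel (X 0 (real n))) {- 1<..b} > 1 - \<epsilon>" for n
  proof -
    let ?E = "{\<omega> \<in> space M. b < X 0 (real n) \<omega>}"
    have "ennreal (b powr p) * emeasure M ?E \<le> ennreal \<bar>C\<bar>"
      using powr_markov[of "X 0 (real n)" M b p] b p C[of n]
      by (auto intro: order_trans ennreal_leI)
    then have "b powr p * prob ?E \<le> \<bar>C\<bar>"
      by (simp add: emeasure_eq_measure flip: ennreal_mult)
    moreover have "b * prob ?E \<le> b powr p * prob ?E"
      using b powr_mono[OF p b(1)] by (intro mult_right_mono) auto
    moreover have "\<bar>C\<bar> < b * \<epsilon>" using b \<epsilon> by (simp add: pos_divide_less_eq)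
    ultimately have "b * prob ?E < b * \<epsilon>" by linarith
    then have "prob ?E < \<epsilon>" by (rule mult_left_less_imp_less) (use b in simp)
    moreover have "measure (distr M borel (X 0 (real n))) {- 1<..b} = prob (space M - ?E)"
      using X_nonneg[OF order_refl, of "real n"]
      by (subst measure_distr) (force intro!: arg_cong[where f = prob])+
    ultimately show ?thesis by (simp add: prob_compl)
  qed
  then show "\<exists>a b. a < b \<and> (\<forall>n. measure (distr M borel (X 0 (real n))) {a<..b} > 1 - \<epsilon>)"
    using b by (intro exI[of _ "- 1"] exI[of _ b]) auto
qed

lemma law_X:
  fixes g :: "real \<Rightarrow> real"
  assumes "0 \<le> x" "0 \<le> t"
  shows "prob_space (distr M half_line (X x t))" "sets (distr M half_line (X x t)) = sets half_line"
    "g \<in> borel_measurable half_line \<Longrightarrow> (\<integral>y. g y \<partial>distr M half_line (X x t)) = (\<integral>\<omega>. g (X x t \<omega>) \<partial>M)"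
  using X_measurable_half_line[OF assms] by (auto intro: prob_space_distr integral_distr)

text \<open>Along times \<open>k n\<close> with a weak limit, the semigroup for time
  \<open>t\<close> leads to the limit of \<open>expect (t + k n) f 0\<close>, where continuity of
  \<open>expect t f\<close> lets the weak limit pass through. This limit agrees with that of
  \<open>expect (k n) f 0\<close>, because a start from the law of \<open>X 0 t\<close> is
  forgotten.\<close>

lemma invariant_measure_exists:
  "\<exists>\<pi>. invariant_measure M X \<pi> \<and> (\<integral>\<^sup>+u. ennreal (u powr p) \<partial>\<pi>) < \<infinity>"
proof -
  define \<mu> where "\<mu> n = distr M borel (X 0 (real n))" for n :: nat
  have Xm [measurable]: "X 0 (real n) \<in> borel_measurable M" for n by (rule X_measurable) auto
  have "tight \<mu>" unfolding \<mu>_def[abs_def] by (rule tight_marginals)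
  from tight_imp_convergent_subsubsequence[OF this, of id]
  obtain k D where k: "strict_mono k" and D: "real_distribution D" and conv: "weak_conv_m (\<mu> \<circ> id \<circ> k) D"
    by (auto simp: strict_mono_id)
  interpret D: real_distribution D by fact
  \<comment> \<open>Weak convergence lives on the whole line; \<open>max 0\<close> extends
    continuous functions from the half line to it.\<close>
  have lim: "(\<lambda>n. \<integral>\<omega>. g (X 0 (real (k n)) \<omega>) \<partial>M) \<longlonglongrightarrow> (\<integral>x. g (max 0 x) \<partial>D)"
    if g: "continuous_on {0..} g" "\<And>x. 0 \<le> x \<Longrightarrow> \<bar>g x\<bar> \<le> B" for g :: "real \<Rightarrow> real" and B
  proof -
    have cont: "continuous_on UNIV (\<lambda>x. g (max 0 x))"
      by (rule continuous_on_compose2[OF g(1)]) (auto intro!: continuous_intros)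
    have gm: "(\<lambda>x. g (max 0 x)) \<in> borel_measurable borel"
      using cont by (rule borel_measurable_continuous_onI)
    have rd: "real_distribution ((\<mu> \<circ> id \<circ> k) n)" for n
      unfolding \<mu>_def comp_def by (rule real_distribution_distr) simp
    have "(\<lambda>n. \<integral>x. g (max 0 x) \<partial>(\<mu> \<circ> id \<circ> k) n) \<longlonglongrightarrow> (\<integral>x. g (max 0 x) \<partial>D)"
    proof (rule weak_conv_imp_integral_bdd_continuous_conv[OF rd D conv])
      show "isCont (\<lambda>x. g (max 0 x)) x" for x
        using cont by (simp add: continuous_on_eq_continuous_at)
      show "norm (g (max 0 x)) \<le> B" for x using g(2)[of "max 0 x"] by simp
    qed
    moreover have "(\<integral>x. g (max 0 x) \<partial>(\<mu> \<circ> id \<circ> k) n) = (\<integral>\<omega>. g (X 0 (real (k n)) \<omega>) \<partial>M)" for n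
    proof -
      have "(\<integral>x. g (max 0 x) \<partial>(\<mu> \<circ> id \<circ> k) n) = (\<integral>\<omega>. g (max 0 (X 0 (real (k n)) \<omega>)) \<partial>M)"
        unfolding \<mu>_def comp_def id_def using Xm gm by (rule integral_distr)
      also have "\<dots> = (\<integral>\<omega>. g (X 0 (real (k n)) \<omega>) \<partial>M)"
        using X_nonneg[OF order_refl, of "real (k n)"]
        by (intro Bochner_Integration.integral_cong refl) (simp add: max_def)
      finally show ?thesis .
    qed
    ultimately show ?thesis by simp
  qed
  have maxm: "(\<lambda>x. max 0 x) \<in> measurable D half_line"
    by (subst measurable_restrict_space2_iff) auto
  define \<pi> where "\<pi> = distr D half_line (\<lambda>x. max 0 x)"
  have \<pi>: "prob_space \<pi>" "sets \<pi> = sets half_line"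
    unfolding \<pi>_def using maxm by (auto intro: D.prob_space_distr)
  have int_\<pi>: "(\<integral>x. g x \<partial>\<pi>) = (\<integral>x. g (max 0 x) \<partial>D)"
    if "g \<in> borel_measurable half_line" for g :: "real \<Rightarrow> real"
    unfolding \<pi>_def using maxm that by (rule integral_distr)
  obtain C where C: "\<And>n. (\<integral>\<^sup>+\<omega>. ennreal (X 0 (real n) \<omega> powr p) \<partial>M) \<le> ennreal C"
    using moments_bounded by blast
  have "(\<integral>\<^sup>+x. ennreal (max 0 x powr p) \<partial>D) \<le> ennreal \<bar>C\<bar>"
  proof (rule nn_integral_le_of_tendsto)
    \<comment> \<open>Truncation at \<open>N\<close> gives the bounded test functions that weak
      convergence admits; Fatou then removes \<open>N\<close>.\<close>
    let ?g = "\<lambda>N x. min (x powr p) (real N)"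
    show "(\<lambda>x. ?g N (max 0 x)) \<in> borel_measurable D" for N by simp
    show "AE x in D. (\<lambda>N. ?g N (max 0 x)) \<longlonglongrightarrow> max 0 x powr p"
    proof (rule AE_I2)
      fix x :: real
      obtain m where "max 0 x powr p \<le> real m" using real_arch_simple by blast
      then show "(\<lambda>N. ?g N (max 0 x)) \<longlonglongrightarrow> max 0 x powr p"
        by (intro tendsto_eventually eventually_sequentiallyI[of m]) (simp add: min_def)
    qed
    show "(\<integral>\<^sup>+x. ennreal (?g N (max 0 x)) \<partial>D) \<le> ennreal \<bar>C\<bar>" for N
    proof -
      have "(\<lambda>n. \<integral>\<omega>. ?g N (X 0 (real (k n)) \<omega>) \<partial>M) \<longlonglongrightarrow> (\<integral>x. ?g N (max 0 x) \<partial>D)"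
      proof (rule lim)
        show "continuous_on {0..} (?g N)"
          by (intro continuous_on_min continuous_on_powr' continuous_on_id continuous_on_const) (use p in auto)
        show "\<bar>?g N x\<bar> \<le> real N" for x by simp
      qed
      moreover have "(\<integral>\<omega>. ?g N (X 0 (real (k n)) \<omega>) \<partial>M) \<le> \<bar>C\<bar>" for n
      proof -
        have "integrable M (\<lambda>\<omega>. ?g N (X 0 (real (k n)) \<omega>))"
          by (rule integrable_const_bound[where B = "real N"]) auto
        then have "ennreal (\<integral>\<omega>. ?g N (X 0 (real (k n)) \<omega>) \<partial>M) = (\<integral>\<^sup>+\<omega>. ennreal (?g N (X 0 (real (k n)) \<omega>)) \<partial>M)"
          by (subst nn_integral_eq_integral) auto
        also have "\<dots> \<le> (\<integral>\<^sup>+\<omega>. ennreal (X 0 (real (k n)) \<omega> powr p) \<partial>M)"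
          by (intro nn_integral_mono ennreal_leI) simp
        also have "\<dots> \<le> ennreal \<bar>C\<bar>" using C[of "k n"] by (auto intro: order_trans ennreal_leI)
        finally show ?thesis by (simp add: ennreal_le_iff)
      qed
      ultimately have "(\<integral>x. ?g N (max 0 x) \<partial>D) \<le> \<bar>C\<bar>"
        by (intro LIMSEQ_le_const2) auto
      moreover have "integrable D (\<lambda>x. ?g N (max 0 x))"
        by (rule D.integrable_const_bound[where B = "real N"]) auto
      ultimately show ?thesis by (subst nn_integral_eq_integral) (auto intro: ennreal_leI)
    qed
  qed
  moreover have "(\<integral>\<^sup>+u. ennreal (u powr p) \<partial>\<pi>) = (\<integral>\<^sup>+x. ennreal (max 0 x powr p) \<partial>D)"
    unfolding \<pi>_def using maxm by (rule nn_integral_distr) (auto intro: borel_measurable_half_line)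
  ultimately have moment_\<pi>: "(\<integral>\<^sup>+u. ennreal (u powr p) \<partial>\<pi>) < \<infinity>"
    by (simp add: le_less_trans)
  have "\<pi> \<bind> transition M X t = \<pi>" if t: "0 \<le> t" for t
  proof (rule measure_eq_of_lipschitz_test)
    have tm: "transition M X t \<in> measurable \<pi> (subprob_algebra half_line)"
      using transition_measurable[OF t] measurable_cong_sets[OF \<pi>(2) refl] by blast
    have ne: "space \<pi> \<noteq> {}" using prob_space.not_empty[OF \<pi>(1)] .
    show "sets (\<pi> \<bind> transition M X t) = sets half_line"
      using ne by (subst sets_bind[OF sets_kernel[OF tm]]) auto
    show "prob_space (\<pi> \<bind> transition M X t)"
      unfolding bind_transition[OF \<pi> t]
    proof (rule prob_space.prob_space_distr)
      interpret \<pi>: prob_space \<pi> by (rule \<pi>(1))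
      interpret PP: pair_prob_space \<pi> M ..
      show "prob_space (\<pi> \<Otimes>\<^sub>M M)" by unfold_locales
      show "case_prod (flow t) \<in> measurable (\<pi> \<Otimes>\<^sub>M M) half_line"
        using flow_measurable[OF t] measurable_cong_sets[OF sets_pair_measure_cong[OF \<pi>(2) refl] refl] by blast
    qed
    fix L f assume f: "lipschitz_test L f"
    have f1: "\<bar>f x\<bar> \<le> 1" for x using f by (simp add: lipschitz_test_def)
    have fm: "f \<in> borel_measurable borel" using f by (rule lipschitz_test_measurable)
    have "(\<lambda>n. expect (real (k n)) f 0) \<longlonglongrightarrow> (\<integral>x. f (max 0 x) \<partial>D)"
      unfolding expect_def
      by (rule lim[OF continuous_on_subset[OF lipschitz_test_continuous[OF f]] f1]) simp
    then have 1: "(\<lambda>n. expect (real (k n)) f 0) \<longlonglongrightarrow> (\<integral>x. f x \<partial>\<pi>)"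
      using int_\<pi>[OF borel_measurable_half_line[OF fm]] by simp
    have "(L)-lipschitz_on {0..} (expect t f)"
      using expect_lipschitz(1)[OF f _ _ t] f
      by (intro lipschitz_onI) (auto simp: dist_real_def lipschitz_test_def)
    then have cont: "continuous_on {0..} (expect t f)" by (rule lipschitz_on_continuous_on)
    have "(\<lambda>n. \<integral>\<omega>. expect t f (X 0 (real (k n)) \<omega>) \<partial>M) \<longlonglongrightarrow> (\<integral>x. expect t f (max 0 x) \<partial>D)"
      using cont abs_expect_le[OF f1] by (rule lim)
    moreover have "(\<integral>\<omega>. expect t f (X 0 (real (k n)) \<omega>) \<partial>M) = expect (t + real (k n)) f 0" for n
      using semigroup[of 0 "real (k n)" t f 1] t lipschitz_test_continuous[OF f] f1 by (simp add: add.commute)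
    moreover have "(\<integral>x. expect t f (max 0 x) \<partial>D) = (\<integral>x. expect t f x \<partial>\<pi>)"
      using expect_measurable[OF t fm] by (rule int_\<pi>[symmetric])
    ultimately have 2: "(\<lambda>n. expect (t + real (k n)) f 0) \<longlonglongrightarrow> (\<integral>x. expect t f x \<partial>\<pi>)" by simp
    \<comment> \<open>Here the semigroup is used with the times in the other order, first
      \<open>t\<close> and then \<open>n\<close>, so that \<open>expect_merge\<close> applies to the
      law of \<open>X 0 t\<close>.\<close>
    have "(\<lambda>n. expect (t + real n) f 0 - expect (real n) f 0) \<longlonglongrightarrow> 0"
    proof -
      have "expect (t + real n) f 0 = (\<integral>x. expect (real n) f x \<partial>distr M half_line (X 0 t))" for n
        using semigroup[of 0 t "real n" f 1] t lipschitz_test_continuous[OF f] f1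
          expect_measurable[OF _ fm, of "real n"] law_X(3)[of 0 t "expect (real n) f"] by simp
      then show ?thesis using expect_merge[OF f law_X(1,2)[OF order_refl t]] by simp
    qed
    then have "(\<lambda>n. expect (t + real (k n)) f 0 - expect (real (k n)) f 0) \<longlonglongrightarrow> 0"
      using LIMSEQ_subseq_LIMSEQ[OF _ k] by (fastforce simp: comp_def)
    from LIMSEQ_unique[OF tendsto_add[OF this 1, simplified] 2]
    show "(\<integral>x. f x \<partial>(\<pi> \<bind> transition M X t)) = (\<integral>x. f x \<partial>\<pi>)"
      using integral_bind_transition[OF \<pi> t fm f1] by simp
  qed (rule \<pi>)+
  then have "invariant_measure M X \<pi>"
    using \<pi> by (auto simp: invariant_measure_def)
  then show ?thesis using moment_\<pi> by blast
qed

section \<open>Synchronous coupling and the Wasserstein bound\<close>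

lemma measurable_flow_pair:
  assumes sets: "sets Q = sets K" and g: "g \<in> measurable K half_line" and t: "0 \<le> t"
  shows "(\<lambda>z. flow t (g (fst z)) (snd z)) \<in> measurable (Q \<Otimes>\<^sub>M M) half_line"
proof -
  have "g \<in> measurable Q half_line"
    using g measurable_cong_sets[OF sets refl] by blast
  then have "(\<lambda>z. (g (fst z), snd z)) \<in> measurable (Q \<Otimes>\<^sub>M M) (half_line \<Otimes>\<^sub>M M)"
    by measurable
  from measurable_compose[OF this flow_measurable[OF t]] show ?thesis by simp
qed

lemma bind_transition_distr:
  assumes "prob_space Q" and sets: "sets Q = sets K" and g: "g \<in> measurable K half_line" and t: "0 \<le> t"
  shows "distr Q half_line g \<bind> transition M X t = distr (Q \<Otimes>\<^sub>M M) half_line (\<lambda>z. flow t (g (fst z)) (snd z))"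
proof -
  interpret Q: prob_space Q by fact
  have gQ: "g \<in> measurable Q half_line"
    using g measurable_cong_sets[OF sets refl] by blast
  have "distr Q half_line g \<Otimes>\<^sub>M M = distr Q half_line g \<Otimes>\<^sub>M distr M M (\<lambda>x. x)"
    by (simp add: distr_id)
  also have "\<dots> = distr (Q \<Otimes>\<^sub>M M) (half_line \<Otimes>\<^sub>M M) (\<lambda>(x, y). (g x, y))"
    using gQ by (rule pair_measure_distr) (auto simp: distr_id intro: prob_space_imp_sigma_finite prob_space_axioms)
  finally have *: "distr Q half_line g \<Otimes>\<^sub>M M = distr (Q \<Otimes>\<^sub>M M) (half_line \<Otimes>\<^sub>M M) (\<lambda>(x, y). (g x, y))" .
  have m: "(\<lambda>(x, y). (g x, y)) \<in> measurable (Q \<Otimes>\<^sub>M M) (half_line \<Otimes>\<^sub>M M)"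
    using gQ by measurable
  have "distr Q half_line g \<bind> transition M X t = distr (distr Q half_line g \<Otimes>\<^sub>M M) half_line (case_prod (flow t))"
    using t by (intro bind_transition Q.prob_space_distr gQ) auto
  also have "\<dots> = distr (Q \<Otimes>\<^sub>M M) half_line (case_prod (flow t) \<circ> (\<lambda>(x, y). (g x, y)))"
    unfolding * by (rule distr_distr[OF flow_measurable[OF t] m])
  finally show ?thesis by (simp add: comp_def case_prod_beta')
qed

text \<open>\<open>Q\<close> supplies the pair of starting points and a single
  \<open>\<omega>\<close> drives both; each marginal is a mixture by
  \<open>bind_transition_distr\<close>.\<close>

lemma synchronous_coupling:
  assumes Q: "Q \<in> couplings \<mu> \<eta>" and t: "0 \<le> t"
  shows "distr (Q \<Otimes>\<^sub>M M) (half_line \<Otimes>\<^sub>M half_line)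
      (\<lambda>z. (flow t (fst (fst z)) (snd z), flow t (snd (fst z)) (snd z)))
    \<in> couplings (\<mu> \<bind> transition M X t) (\<eta> \<bind> transition M X t)"
proof -
  have Q: "prob_space Q" "sets Q = sets (half_line \<Otimes>\<^sub>M half_line)"
    "distr Q half_line fst = \<mu>" "distr Q half_line snd = \<eta>"
    using Q by (auto simp: couplings_def)
  interpret Q: prob_space Q by (rule Q(1))
  interpret PP: pair_prob_space Q M ..
  have m1: "(\<lambda>z. flow t (fst (fst z)) (snd z)) \<in> measurable (Q \<Otimes>\<^sub>M M) half_line"
    and m2: "(\<lambda>z. flow t (snd (fst z)) (snd z)) \<in> measurable (Q \<Otimes>\<^sub>M M) half_line"
    using measurable_flow_pair[OF Q(2) measurable_fst t] measurable_flow_pair[OF Q(2) measurable_snd t] by auto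
  have m: "(\<lambda>z. (flow t (fst (fst z)) (snd z), flow t (snd (fst z)) (snd z)))
      \<in> measurable (Q \<Otimes>\<^sub>M M) (half_line \<Otimes>\<^sub>M half_line)"
    using m1 m2 by (rule measurable_Pair)
  show ?thesis
    unfolding couplings_def
  proof (intro CollectI conjI)
    show "distr (distr (Q \<Otimes>\<^sub>M M) (half_line \<Otimes>\<^sub>M half_line)
        (\<lambda>z. (flow t (fst (fst z)) (snd z), flow t (snd (fst z)) (snd z)))) half_line fst = \<mu> \<bind> transition M X t"
      using bind_transition_distr[OF Q(1,2) measurable_fst t] Q(3)
      by (simp add: distr_distr[OF measurable_fst m] comp_def)
    show "distr (distr (Q \<Otimes>\<^sub>M M) (half_line \<Otimes>\<^sub>M half_line)
        (\<lambda>z. (flow t (fst (fst z)) (snd z), flow t (snd (fst z)) (snd z)))) half_line snd = \<eta> \<bind> transition M X t"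
      using bind_transition_distr[OF Q(1,2) measurable_snd t] Q(4)
      by (simp add: distr_distr[OF measurable_snd m] comp_def)
  qed (auto intro: PP.prob_space_distr m)
qed

text \<open>The pathwise contraction under the integral, with \<open>max 1 x \<le> 1 + x\<close>,
  which puts the integrand into the form of \<open>nn_integral_one_plus_powr_le\<close>.\<close>

lemma synchronous_cost:
  assumes Q: "prob_space Q" "sets Q = sets (half_line \<Otimes>\<^sub>M half_line)" and t: "0 \<le> t" and \<kappa>: "0 < \<kappa>"
  defines "Q' \<equiv> distr (Q \<Otimes>\<^sub>M M) (half_line \<Otimes>\<^sub>M half_line)
      (\<lambda>z. (flow t (fst (fst z)) (snd z), flow t (snd (fst z)) (snd z)))"
  shows "(\<integral>\<^sup>+z. ennreal (\<bar>fst z - snd z\<bar> powr p) \<partial>Q')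
    \<le> ennreal (B_inv \<beta> \<kappa> (\<Gamma> * t) powr p) * (\<integral>\<^sup>+z. ennreal ((1 + \<bar>fst z - snd z\<bar> / \<kappa>) powr p) \<partial>Q)"
proof -
  let ?b = "B_inv \<beta> \<kappa> (\<Gamma> * t)"
  have b: "0 \<le> ?b" using B_inv_pos[OF \<kappa>, of "\<Gamma> * t"] \<Gamma> t by simp
  interpret Q: prob_space Q by (rule Q(1))
  interpret PP: pair_prob_space Q M ..
  have m1: "(\<lambda>z. flow t (fst (fst z)) (snd z)) \<in> measurable (Q \<Otimes>\<^sub>M M) half_line"
    and m2: "(\<lambda>z. flow t (snd (fst z)) (snd z)) \<in> measurable (Q \<Otimes>\<^sub>M M) half_line"
    using measurable_flow_pair[OF Q(2) measurable_fst t] measurable_flow_pair[OF Q(2) measurable_snd t] by auto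
  have m: "(\<lambda>z. (flow t (fst (fst z)) (snd z), flow t (snd (fst z)) (snd z)))
      \<in> measurable (Q \<Otimes>\<^sub>M M) (half_line \<Otimes>\<^sub>M half_line)"
    using m1 m2 by (rule measurable_Pair)
  note [measurable] = measurable_half_line_borel[OF m1] measurable_half_line_borel[OF m2]
  have [measurable]: "fst \<in> borel_measurable (half_line \<Otimes>\<^sub>M half_line)" "snd \<in> borel_measurable (half_line \<Otimes>\<^sub>M half_line)"
    by (auto intro: measurable_half_line_borel measurable_fst measurable_snd)
  then have [measurable]: "fst \<in> borel_measurable Q" "snd \<in> borel_measurable Q"
    using measurable_cong_sets[OF Q(2) refl] by blast+
  have space: "space Q = {0..} \<times> {0..}"
    using sets_eq_imp_space_eq[OF Q(2)] by (simp add: space_pair_measure)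
  have "(\<integral>\<^sup>+z. ennreal (\<bar>fst z - snd z\<bar> powr p) \<partial>Q')
      = (\<integral>\<^sup>+z. ennreal (\<bar>flow t (fst (fst z)) (snd z) - flow t (snd (fst z)) (snd z)\<bar> powr p) \<partial>(Q \<Otimes>\<^sub>M M))"
    unfolding Q'_def using p by (subst nn_integral_distr[OF m]) auto
  also have "\<dots> = (\<integral>\<^sup>+z. \<integral>\<^sup>+\<omega>. ennreal (\<bar>flow t (fst z) \<omega> - flow t (snd z) \<omega>\<bar> powr p) \<partial>M \<partial>Q)"
    using p by (subst nn_integral_fst[symmetric]) auto
  also have "\<dots> \<le> (\<integral>\<^sup>+z. ennreal (?b powr p) * ennreal ((1 + \<bar>fst z - snd z\<bar> / \<kappa>) powr p) \<partial>Q)"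
  proof (rule nn_integral_mono)
    fix z assume "z \<in> space Q"
    then have z: "0 \<le> fst z" "0 \<le> snd z" by (auto simp: space)
    have "(\<integral>\<^sup>+\<omega>. ennreal (\<bar>flow t (fst z) \<omega> - flow t (snd z) \<omega>\<bar> powr p) \<partial>M)
        \<le> (\<integral>\<^sup>+\<omega>. ennreal ((?b * (1 + \<bar>fst z - snd z\<bar> / \<kappa>)) powr p) \<partial>M)"
    proof (rule nn_integral_mono_AE)
      show "AE \<omega> in M. ennreal (\<bar>flow t (fst z) \<omega> - flow t (snd z) \<omega>\<bar> powr p)
          \<le> ennreal ((?b * (1 + \<bar>fst z - snd z\<bar> / \<kappa>)) powr p)"
        using AE_X_diff[OF z(2,1) t] AE_flow[OF z(1) t] AE_flow[OF z(2) t]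
      proof eventually_elim
        case (elim \<omega>)
        then have "\<bar>flow t (fst z) \<omega> - flow t (snd z) \<omega>\<bar> \<le> max 1 (\<bar>fst z - snd z\<bar> / \<kappa>) * ?b"
          using \<kappa> by simp
        also have "\<dots> \<le> (1 + \<bar>fst z - snd z\<bar> / \<kappa>) * ?b"
          using \<kappa> b by (intro mult_right_mono) auto
        finally show ?case
          using p by (intro ennreal_leI powr_mono2) (auto simp: mult.commute)
      qed
    qed
    also have "\<dots> = ennreal (?b powr p) * ennreal ((1 + \<bar>fst z - snd z\<bar> / \<kappa>) powr p)"
      by (simp add: emeasure_space_1 powr_mult flip: ennreal_mult)
    finally show "(\<integral>\<^sup>+\<omega>. ennreal (\<bar>flow t (fst z) \<omega> - flow t (snd z) \<omega>\<bar> powr p) \<partial>M)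
        \<le> ennreal (?b powr p) * ennreal ((1 + \<bar>fst z - snd z\<bar> / \<kappa>) powr p)" .
  qed
  also have "\<dots> = ennreal (?b powr p) * (\<integral>\<^sup>+z. ennreal ((1 + \<bar>fst z - snd z\<bar> / \<kappa>) powr p) \<partial>Q)"
    by (rule nn_integral_cmult) measurable
  finally show ?thesis .
qed

lemma wasserstein_transition_le:
  assumes t: "0 \<le> t" and \<kappa>: "0 < \<kappa>"
  shows "wasserstein p (\<mu> \<bind> transition M X t) (\<eta> \<bind> transition M X t)
    \<le> (wasserstein p \<mu> \<eta> / ennreal \<kappa> + 1) * ennreal (B_inv \<beta> \<kappa> (\<Gamma> * t))"
proof (cases "wasserstein p \<mu> \<eta>")
  \<comment> \<open>\<open>B_inv\<close> is positive, so the right side is infinite as well.\<close>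
  case top
  have "0 < B_inv \<beta> \<kappa> (\<Gamma> * t)" using \<Gamma> t by (intro B_inv_pos \<kappa>) simp
  then show ?thesis using \<kappa> by (simp add: top ennreal_top_divide ennreal_top_mult)
next
  case (real w)
  let ?b = "B_inv \<beta> \<kappa> (\<Gamma> * t)"
  have b: "0 < ?b" using \<Gamma> t by (intro B_inv_pos \<kappa>) simp
  \<comment> \<open>Any \<open>a > w / \<kappa>\<close> admits a coupling of cost below
    \<open>\<kappa> * a\<close>, so attainment of the infimum is not at issue. Strictness also gives
    \<open>a > 0\<close> when \<open>w = 0\<close>.\<close>
  have step: "wasserstein p (\<mu> \<bind> transition M X t) (\<eta> \<bind> transition M X t) \<le> ennreal (?b * (1 + a))"
    if a: "w / \<kappa> < a" for a
  proof -
    have a0: "0 < a" using a real(1) \<kappa> by (smt (verit) divide_nonneg_pos)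
    have "wasserstein p \<mu> \<eta> < ennreal (\<kappa> * a)"
      using a \<kappa> real by (simp add: ennreal_less_iff pos_divide_less_eq mult.commute)
    then obtain Q where Q: "Q \<in> couplings \<mu> \<eta>"
      and less: "ennreal_powr (\<integral>\<^sup>+z. ennreal (\<bar>fst z - snd z\<bar> powr p) \<partial>Q) (1 / p) < ennreal (\<kappa> * a)"
      unfolding wasserstein_def by (auto simp: INF_less_iff)
    have Qp: "prob_space Q" "sets Q = sets (half_line \<Otimes>\<^sub>M half_line)"
      using Q by (auto simp: couplings_def)
    have [measurable]: "fst \<in> borel_measurable (half_line \<Otimes>\<^sub>M half_line)" "snd \<in> borel_measurable (half_line \<Otimes>\<^sub>M half_line)"
      by (auto intro: measurable_half_line_borel measurable_fst measurable_snd)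
    then have [measurable]: "fst \<in> borel_measurable Q" "snd \<in> borel_measurable Q"
      using measurable_cong_sets[OF Qp(2) refl] by blast+
    have "(\<integral>\<^sup>+z. ennreal ((1 + \<bar>fst z - snd z\<bar> / \<kappa>) powr p) \<partial>Q) \<le> ennreal ((1 + a) powr p)"
    proof (rule nn_integral_one_plus_powr_le[OF Qp(1) _ _ p a0])
      have "(\<integral>\<^sup>+z. ennreal ((\<bar>fst z - snd z\<bar> / \<kappa>) powr p) \<partial>Q)
          = (\<integral>\<^sup>+z. ennreal (1 / \<kappa> powr p) * ennreal (\<bar>fst z - snd z\<bar> powr p) \<partial>Q)"
        by (intro nn_integral_cong) (simp add: powr_divide flip: ennreal_mult)
      also have "\<dots> = ennreal (1 / \<kappa> powr p) * (\<integral>\<^sup>+z. ennreal (\<bar>fst z - snd z\<bar> powr p) \<partial>Q)"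
        by (rule nn_integral_cmult) measurable
      also have "\<dots> \<le> ennreal (1 / \<kappa> powr p) * ennreal ((\<kappa> * a) powr p)"
        using less p by (intro mult_left_mono le_of_ennreal_powr_root_less) auto
      also have "\<dots> = ennreal (a powr p)"
        using \<kappa> by (simp add: powr_mult flip: ennreal_mult)
      finally show "(\<integral>\<^sup>+z. ennreal ((\<bar>fst z - snd z\<bar> / \<kappa>) powr p) \<partial>Q) \<le> ennreal (a powr p)" .
    qed (use \<kappa> in \<open>measurable, auto\<close>)
    then have cost: "ennreal (?b powr p) * (\<integral>\<^sup>+z. ennreal ((1 + \<bar>fst z - snd z\<bar> / \<kappa>) powr p) \<partial>Q)
        \<le> ennreal ((?b * (1 + a)) powr p)"
      by (simp add: powr_mult ennreal_mult mult_left_mono)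
    show ?thesis
      unfolding wasserstein_def
      using p b a0 order_trans[OF synchronous_cost[OF Qp t \<kappa>] cost]
      by (intro INF_lower2[OF synchronous_coupling[OF Q t]] ennreal_powr_root_le) auto
  qed
  have "wasserstein p (\<mu> \<bind> transition M X t) (\<eta> \<bind> transition M X t) \<le> ennreal (?b * (1 + w / \<kappa>)) + ennreal e"
    if "0 < e" for e
  proof -
    \<comment> \<open>\<open>a\<close> exceeds \<open>w / \<kappa>\<close> by \<open>e / ?b\<close>,
      which makes the error exactly \<open>e\<close>.\<close>
    have "wasserstein p (\<mu> \<bind> transition M X t) (\<eta> \<bind> transition M X t) \<le> ennreal (?b * (1 + (w / \<kappa> + e / ?b)))"
      using that b by (intro step) simp
    also have "?b * (1 + (w / \<kappa> + e / ?b)) = ?b * (1 + w / \<kappa>) + e"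
      using b by (simp add: field_simps)
    also have "ennreal \<dots> = ennreal (?b * (1 + w / \<kappa>)) + ennreal e"
      using b real \<kappa> that by (intro ennreal_plus) auto
    finally show ?thesis .
  qed
  then have "wasserstein p (\<mu> \<bind> transition M X t) (\<eta> \<bind> transition M X t) \<le> ennreal (?b * (1 + w / \<kappa>))"
    by (rule ennreal_le_epsilon)
  also have "\<dots> = ennreal (1 + w / \<kappa>) * ennreal ?b"
    using b real(1) \<kappa> by (subst mult.commute) (rule ennreal_mult, auto)
  also have "ennreal (1 + w / \<kappa>) = ennreal w / ennreal \<kappa> + 1"
    using real(1) \<kappa> by (simp add: divide_ennreal ennreal_plus add.commute)
  finally show ?thesis using real by simp
qed

end

theorem theorem2p5:
  fixes M :: "'a measure" and F :: "real \<Rightarrow> 'a measure"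
    and \<nu> :: "real measure" and A :: "real \<Rightarrow> 'a \<Rightarrow> real"
    and r :: "real \<Rightarrow> real" and X :: "real \<Rightarrow> real \<Rightarrow> 'a \<Rightarrow> real"
    and p \<Gamma> :: real and \<beta> :: "real \<Rightarrow> real"
  assumes "stochastic_basis M F"
    and "levy_measure \<nu>"
    and "pure_jump_subordinator M F \<nu> A"
    and "(C1 r \<and> C2 r \<and> C3 r \<nu>) \<or> (tail \<nu> 0 < \<infinity> \<and> C1_bar r \<and> C2_bar r \<and> C3 r \<nu>)"
    and "storage_process M F A r X"
    and "1 \<le> p"
    and "(\<integral>\<^sup>+u. ennreal (max u (u powr p)) \<partial>\<nu>) < \<infinity>"
    and "\<forall>t\<ge>0. 0 \<le> \<beta> t"
    and "convex_on {0..} \<beta>"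
    and "\<forall>t\<ge>0. \<beta> t = 0 \<longleftrightarrow> t = 0"
    and "0 < \<Gamma>"
    and "\<forall>u v. 0 \<le> u \<and> u \<le> v \<longrightarrow> r u - r v \<le> - \<Gamma> * \<beta> (v - u)"
  shows "\<exists>\<pi>\<in>P_space p.
      invariant_measure M X \<pi> \<and>
      (\<forall>\<pi>'. invariant_measure M X \<pi>' \<longrightarrow> \<pi>' = \<pi>) \<and>
      (\<forall>\<kappa>>0. \<forall>\<mu>\<in>P_space p. \<forall>t\<ge>0.
         wasserstein p (\<mu> \<bind> transition M X t) \<pi>
           \<le> (wasserstein p \<mu> \<pi> / ennreal \<kappa> + 1) * ennreal (B_inv \<beta> \<kappa> (\<Gamma> * t))) \<and>
      Limsup at_top (\<lambda>u. ennreal (u powr p) * tail \<pi> u) < \<infinity>"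
proof -
  have diss: "\<Gamma> * \<beta> (v - u) \<le> r v - r u" if "0 \<le> u" "u \<le> v" for u v
    using assms(12) that by fastforce
  interpret storage M F \<nu> A p r \<beta> \<Gamma> X
  proof
    show "r 0 = 0" using assms(4) by (force simp: C1_def C1_bar_def)
    show "r u \<le> r v" if "0 \<le> u" "u \<le> v" for u v
    proof -
      have "0 \<le> \<Gamma> * \<beta> (v - u)" using assms(8,11) that by simp
      then show ?thesis using diss[OF that] by linarith
    qed
  qed (use assms diss in auto)
  obtain \<pi> where \<pi>: "invariant_measure M X \<pi>" "(\<integral>\<^sup>+u. ennreal (u powr p) \<partial>\<pi>) < \<infinity>"
    using invariant_measure_exists by blast
  have \<pi>': "prob_space \<pi>" "sets \<pi> = sets half_line" "\<And>t. 0 \<le> t \<Longrightarrow> \<pi> \<bind> transition M X t = \<pi>"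
    using \<pi>(1) by (auto simp: invariant_measure_def)
  have space: "space \<pi> = {0..}" using sets_eq_imp_space_eq[OF \<pi>'(2)] by simp
  \<comment> \<open>Markov's inequality bounds the function by the moment of \<open>\<pi>\<close> at
    every \<open>u \<ge> 0\<close>.\<close>
  have "Limsup at_top (\<lambda>u. ennreal (u powr p) * tail \<pi> u) \<le> (\<integral>\<^sup>+u. ennreal (u powr p) \<partial>\<pi>)"
  proof (rule Limsup_bounded)
    show "\<forall>\<^sub>F u in at_top. ennreal (u powr p) * tail \<pi> u \<le> (\<integral>\<^sup>+u. ennreal (u powr p) \<partial>\<pi>)"
      using eventually_ge_at_top[of 0]
    proof eventually_elim
      case (elim u)
      have "(\<lambda>x. x) \<in> borel_measurable \<pi>"
        unfolding measurable_cong_sets[OF \<pi>'(2) refl] by (rule borel_measurable_half_line) simp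
      moreover have "{x \<in> space \<pi>. u < x} = {u<..}" using elim by (auto simp: space)
      ultimately show ?case
        using powr_markov[of "\<lambda>x. x" \<pi> u p] elim p by (simp add: tail_def)
    qed
  qed
  then have "Limsup at_top (\<lambda>u. ennreal (u powr p) * tail \<pi> u) < \<infinity>"
    using \<pi>(2) by (rule le_less_trans)
  moreover have "\<pi> \<in> P_space p" using \<pi>(2) \<pi>' by (simp add: P_space_def)
  moreover have "wasserstein p (\<mu> \<bind> transition M X t) \<pi>
      \<le> (wasserstein p \<mu> \<pi> / ennreal \<kappa> + 1) * ennreal (B_inv \<beta> \<kappa> (\<Gamma> * t))"
    if "0 < \<kappa>" "0 \<le> t" for \<kappa> \<mu> t
    using wasserstein_transition_le[OF that(2,1), of \<mu> \<pi>] \<pi>'(3)[OF that(2)] by simp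
  ultimately show ?thesis
    using \<pi>(1) invariant_measure_unique[OF \<pi>(1)] by blast
qed

end
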